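(* Let $X$ and $Y$ be complex infinite-dimensional Banach spaces, $A\in B(X)$, $B\in B(Y)$, $C\in B(Y,X)$, and let $M_C=\begin{pmatrix}A&C\\0&B\end{pmatrix}\in B(X\oplus Y)$. If $\sigma_*$ is any one of $\sigma_K,\sigma_{K_3},\sigma_{SF_0},\sigma_{lr}$, then $$\sigma_*(M_C)\cup S(A^* )\cup S(A)\cup S(B)=\sigma_*(A)\cup\sigma_*(B)\cup S(A^* )\cup S(A)\cup S(B)$$ and $$\sigma_*(M_C)\cup S(A^* )\cup S(B)\cup S(B^* )=\sigma_*(A)\cup\sigma_*(B)\cup S(A^* )\cup S(B)\cup S(B^* ).$$
   Context: $B(Y,X)$ is the set of bounded linear operators from $Y$ to $X$, and $B(X)=B(X,X)$. $T^*$ denotes the dual operator of $T$ acting on the dual space. For $T\in B(X)$ let $\alpha(T)=\dim N(T)$ and $\beta(T)=\dim X/R(T)$, where $N(T)$ and $R(T)$ are the kernel and range. Operator classes: $\Phi_+(X)=\{T:\alpha(T)<\infty\text{ and }R(T)\text{ is closed}\}$; $\Phi_-(X)=\{T:\beta(T)<\infty\}$; $\Phi_l(X)=\{T: R(T)\text{ is a closed and complemented subspace of }X\text{ and }\alpha(T)<\infty\}$; $\Phi_r(X)=\{T: N(T)\text{ is a closed and complemented subspace of }X\text{ and }\beta(T)<\infty\}$. Spectra: $\sigma_K(T)=\{\lambda\in\mathbb{C}:T-\lambda I\notin\Phi_+(X)\cup\Phi_-(X)\}$; $\sigma_{K_3}(T)=\{\lambda\in\mathbb{C}:T-\lambda I\notin\Phi_l(X)\cup\Phi_r(X)\}$;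 $\sigma_{SF_0}(T)=\{\lambda\in\mathbb{C}:T-\lambda I\notin SF_0(X)\}$, where $SF_0(X)=\{T\in\Phi_+(X)\cup\Phi_-(X):\alpha(T)=0\text{ or }\beta(T)=0\}$; $\sigma_{lr}(T)=\{\lambda\in\mathbb{C}:T-\lambda I\text{ is neither left invertible nor right invertible in }B(X)\}$. The same definitions apply on $Y$ and $X\oplus Y$. $T$ has the single valued extension property (SVEP) at $\lambda\in\mathbb{C}$ if there is $r>0$ such that for every open subset $V$ of the open disc $D(\lambda,r)$, the function $f\equiv 0$ is the only analytic solution of $(T-\mu)f(\mu)=0$ for all $\mu\in V$. $S(T)=\{\lambda\in\mathbb{C}: T\text{ fails to have the SVEP at }\lambda\}$. *)

theory Defs
  imports "HOL-Analysis.Analysis" "HOL-Library.Extended_Nat"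
begin

section \<open>Complex normed and Banach spaces\<close>

class complex_normed_vector = real_normed_vector +
  fixes scaleC :: "complex \<Rightarrow> 'a \<Rightarrow> 'a"  (infixr \<open>*\<^sub>C\<close> 75)
  assumes scaleC_add_right: "c *\<^sub>C (x + y) = c *\<^sub>C x + c *\<^sub>C y"
    and scaleC_add_left: "(c + d) *\<^sub>C x = c *\<^sub>C x + d *\<^sub>C x"
    and scaleC_scaleC: "c *\<^sub>C d *\<^sub>C x = (c * d) *\<^sub>C x"
    and scaleR_scaleC: "r *\<^sub>R x = complex_of_real r *\<^sub>C x"
    and norm_scaleC: "norm (c *\<^sub>C x) = cmod c * norm x"

class cbanach = complex_normed_vector + banach

lemma scaleC_one: "1 *\<^sub>C x = (x :: 'a::complex_normed_vector)"
  by (metis of_real_1 scaleR_one scaleR_scaleC)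

global_interpretation cvec: vector_space "scaleC :: complex \<Rightarrow> 'a \<Rightarrow> 'a::complex_normed_vector"
  defines cspan = cvec.span
    and csubspace = cvec.subspace
    and cdim = cvec.dim
  by standard (simp_all add: scaleC_add_right scaleC_add_left scaleC_scaleC scaleC_one)

instantiation complex :: cbanach
begin
definition scaleC_complex :: "complex \<Rightarrow> complex \<Rightarrow> complex" where
  "c *\<^sub>C x = c * x" for x :: complex
instance
  by standard (simp_all add: scaleC_complex_def algebra_simps norm_mult scaleR_conv_of_real)
end

instantiation prod :: (complex_normed_vector, complex_normed_vector) complex_normed_vector
begin
definition scaleC_prod :: "complex \<Rightarrow> 'a \<times> 'b \<Rightarrow> 'a \<times> 'b" where
  "c *\<^sub>C p = (c *\<^sub>C fst p, c *\<^sub>C snd p)"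
instance
proof
  fix c :: complex and p :: "'a \<times> 'b"
  show "norm (c *\<^sub>C p) = cmod c * norm p"
    by (simp add: scaleC_prod_def norm_prod_def norm_scaleC power_mult_distrib
        distrib_left [symmetric] real_sqrt_mult)
qed (simp_all add: scaleC_prod_def scaleR_prod_def scaleC_add_right scaleC_add_left
    scaleC_scaleC scaleR_scaleC)
end

instance prod :: (cbanach, cbanach) cbanach ..


section \<open>Bounded complex-linear operators\<close>

definition bounded_clinear :: "('a::complex_normed_vector \<Rightarrow> 'b::complex_normed_vector) \<Rightarrow> bool" where
  "bounded_clinear f \<longleftrightarrow> bounded_linear f \<and> (\<forall>c x. f (c *\<^sub>C x) = c *\<^sub>C f x)"

typedef (overloaded) ('a, 'b) cblinfun (\<open>(_ \<Rightarrow>\<^sub>C\<^sub>L /_)\<close> [22, 21] 21) =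
  "{f :: 'a::complex_normed_vector \<Rightarrow> 'b::complex_normed_vector. bounded_clinear f}"
  morphisms cblinfun_apply CBlinfun
proof
  show "(\<lambda>x. 0) \<in> {f :: 'a \<Rightarrow> 'b. bounded_clinear f}"
    by (simp add: bounded_clinear_def cvec.scale_zero_right)
qed

setup_lifting type_definition_cblinfun

instantiation cblinfun :: (complex_normed_vector, complex_normed_vector) complex_normed_vector
begin

lift_definition norm_cblinfun :: "'a \<Rightarrow>\<^sub>C\<^sub>L 'b \<Rightarrow> real" is onorm .

lift_definition minus_cblinfun :: "'a \<Rightarrow>\<^sub>C\<^sub>L 'b \<Rightarrow> 'a \<Rightarrow>\<^sub>C\<^sub>L 'b \<Rightarrow> 'a \<Rightarrow>\<^sub>C\<^sub>L 'b"
  is "\<lambda>f g x. f x - g x"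
  by (simp add: bounded_clinear_def bounded_linear_sub cvec.scale_right_diff_distrib)

definition dist_cblinfun :: "'a \<Rightarrow>\<^sub>C\<^sub>L 'b \<Rightarrow> 'a \<Rightarrow>\<^sub>C\<^sub>L 'b \<Rightarrow> real" where
  "dist_cblinfun S T = norm (S - T)"

definition uniformity_cblinfun :: "(('a \<Rightarrow>\<^sub>C\<^sub>L 'b) \<times> ('a \<Rightarrow>\<^sub>C\<^sub>L 'b)) filter" where
  [code del]: "uniformity_cblinfun = (INF e\<in>{0<..}. principal {(S, T). dist S T < e})"

definition open_cblinfun :: "('a \<Rightarrow>\<^sub>C\<^sub>L 'b) set \<Rightarrow> bool" where
  [code del]: "open_cblinfun U = (\<forall>S\<in>U. \<forall>\<^sub>F (S', T) in uniformity. S' = S \<longrightarrow> T \<in> U)"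

lift_definition uminus_cblinfun :: "'a \<Rightarrow>\<^sub>C\<^sub>L 'b \<Rightarrow> 'a \<Rightarrow>\<^sub>C\<^sub>L 'b" is "\<lambda>f x. - f x"
  by (simp add: bounded_clinear_def bounded_linear_minus cvec.scale_minus_right)

lift_definition zero_cblinfun :: "'a \<Rightarrow>\<^sub>C\<^sub>L 'b" is "\<lambda>x. 0"
  by (simp add: bounded_clinear_def cvec.scale_zero_right)

lift_definition plus_cblinfun :: "'a \<Rightarrow>\<^sub>C\<^sub>L 'b \<Rightarrow> 'a \<Rightarrow>\<^sub>C\<^sub>L 'b \<Rightarrow> 'a \<Rightarrow>\<^sub>C\<^sub>L 'b"
  is "\<lambda>f g x. f x + g x"
  by (simp add: bounded_clinear_def bounded_linear_add scaleC_add_right)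

lift_definition scaleC_cblinfun :: "complex \<Rightarrow> 'a \<Rightarrow>\<^sub>C\<^sub>L 'b \<Rightarrow> 'a \<Rightarrow>\<^sub>C\<^sub>L 'b"
  is "\<lambda>c f x. c *\<^sub>C f x"
proof -
  fix c and f :: "'a \<Rightarrow> 'b"
  assume f: "bounded_clinear f"
  interpret f: bounded_linear f
    using f by (simp add: bounded_clinear_def)
  have "bounded_linear (\<lambda>x. c *\<^sub>C f x)"
  proof (rule bounded_linear_intro)
    show "c *\<^sub>C f (x + y) = c *\<^sub>C f x + c *\<^sub>C f y" for x y
      by (simp add: f.add scaleC_add_right)
    show "c *\<^sub>C f (r *\<^sub>R x) = r *\<^sub>R c *\<^sub>C f x" for r x
      unfolding f.scaleR unfolding scaleR_scaleC scaleC_scaleC by (simp add: mult.commute)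
    show "norm (c *\<^sub>C f x) \<le> norm x * (onorm f * cmod c)" for x
      using mult_left_mono [OF onorm [OF f.bounded_linear_axioms, of x], of "cmod c"]
      by (simp add: norm_scaleC mult.commute mult.left_commute)
  qed
  then show "bounded_clinear (\<lambda>x. c *\<^sub>C f x)"
    using f by (simp add: bounded_clinear_def scaleC_scaleC mult.commute)
qed

definition scaleR_cblinfun :: "real \<Rightarrow> 'a \<Rightarrow>\<^sub>C\<^sub>L 'b \<Rightarrow> 'a \<Rightarrow>\<^sub>C\<^sub>L 'b" where
  "scaleR_cblinfun r T = complex_of_real r *\<^sub>C T"

definition sgn_cblinfun :: "'a \<Rightarrow>\<^sub>C\<^sub>L 'b \<Rightarrow> 'a \<Rightarrow>\<^sub>C\<^sub>L 'b" where
  "sgn_cblinfun T = inverse (norm T) *\<^sub>R T"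

instance
proof
  fix R S T :: "'a \<Rightarrow>\<^sub>C\<^sub>L 'b" and c d :: complex and r s :: real
    and U :: "('a \<Rightarrow>\<^sub>C\<^sub>L 'b) set"
  have onorm_scaleC: "onorm (\<lambda>x. c *\<^sub>C f x) = cmod c * onorm f"
    if "bounded_clinear f" for f :: "'a \<Rightarrow> 'b" and c
  proof (cases "c = 0")
    case True
    then show ?thesis by (simp add: onorm_zero cvec.scale_zero_left)
  next
    case False
    have le: "onorm (\<lambda>x. c *\<^sub>C g x) \<le> cmod c * onorm g"
      if "bounded_clinear g" for g :: "'a \<Rightarrow> 'b" and c
      using that onorm [of g] onorm_pos_le [of g]
      by (intro onorm_bound)
        (auto simp: bounded_clinear_def norm_scaleC mult.assoc intro!: mult_left_mono)
    have "bounded_clinear (\<lambda>x. c *\<^sub>C f x)"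
      using scaleC_cblinfun.rsp that by (simp add: rel_fun_def eq_onp_def)
    then have "onorm (\<lambda>x. inverse c *\<^sub>C c *\<^sub>C f x) \<le> cmod (inverse c) * onorm (\<lambda>x. c *\<^sub>C f x)"
      by (rule le)
    with False have "onorm f \<le> inverse (cmod c) * onorm (\<lambda>x. c *\<^sub>C f x)"
      by (simp add: scaleC_scaleC scaleC_one norm_inverse)
    with False have "cmod c * onorm f \<le> onorm (\<lambda>x. c *\<^sub>C f x)"
      by (simp add: inverse_eq_divide pos_le_divide_eq mult.commute)
    with le [OF that, of c] show ?thesis by simp
  qed
  show "R + S + T = R + (S + T)" "R + S = S + R" "0 + T = T" "- T + T = 0" "S - T = S + - T"
    by (transfer, force)+
  show C: "c *\<^sub>C (S + T) = c *\<^sub>C S + c *\<^sub>C T" "(c + d) *\<^sub>C T = c *\<^sub>C T + d *\<^sub>C T"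
    "c *\<^sub>C d *\<^sub>C T = (c * d) *\<^sub>C T" for c d S and T :: "'a \<Rightarrow>\<^sub>C\<^sub>L 'b"
    by (transfer, force simp: scaleC_add_right scaleC_add_left scaleC_scaleC)+
  show "r *\<^sub>R T = complex_of_real r *\<^sub>C T"
    by (simp add: scaleR_cblinfun_def)
  show "r *\<^sub>R (S + T) = r *\<^sub>R S + r *\<^sub>R T" "(r + s) *\<^sub>R T = r *\<^sub>R T + s *\<^sub>R T"
    "r *\<^sub>R s *\<^sub>R T = (r * s) *\<^sub>R T"
    by (simp_all add: scaleR_cblinfun_def C)
  show "1 *\<^sub>R T = T"
    unfolding scaleR_cblinfun_def by transfer (simp add: scaleC_one)
  show N: "norm (c *\<^sub>C T) = cmod c * norm T" for c
    by transfer (rule onorm_scaleC)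
  show "norm (r *\<^sub>R T) = \<bar>r\<bar> * norm T"
    by (simp add: scaleR_cblinfun_def N)
  show "norm (S + T) \<le> norm S + norm T"
    by transfer (simp add: bounded_clinear_def onorm_triangle)
  show "norm T = 0 \<longleftrightarrow> T = 0"
    by transfer (auto simp: bounded_clinear_def onorm_eq_0)
  show "dist S T = norm (S - T)"
    by (rule dist_cblinfun_def)
  show "sgn T = inverse (norm T) *\<^sub>R T"
    by (rule sgn_cblinfun_def)
  show "(uniformity :: (('a \<Rightarrow>\<^sub>C\<^sub>L 'b) \<times> ('a \<Rightarrow>\<^sub>C\<^sub>L 'b)) filter)
      = (INF e\<in>{0<..}. principal {(x, y). dist x y < e})"
    by (rule uniformity_cblinfun_def)
  show "open U = (\<forall>x\<in>U. \<forall>\<^sub>F (x', y) in uniformity. x' = x \<longrightarrow> y \<in> U)"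
    by (rule open_cblinfun_def)
qed

end

lemma bounded_clinear_cblinfun_apply: "bounded_clinear (cblinfun_apply T)"
  using cblinfun_apply [of T] by simp

lemma cblinfun_eqI: "(\<And>x. cblinfun_apply S x = cblinfun_apply T x) \<Longrightarrow> S = T"
  by (metis cblinfun_apply_inject ext)

text \<open>Completeness is inherited from the real operator space \<^typ>\<open>'a \<Rightarrow>\<^sub>L 'b\<close>, in which the
  complex-linear operators form a closed subspace.\<close>

instance cblinfun :: (complex_normed_vector, cbanach) cbanach
proof
  fix X :: "nat \<Rightarrow> 'a \<Rightarrow>\<^sub>C\<^sub>L 'b"
  assume X: "Cauchy X"
  define J :: "'a \<Rightarrow>\<^sub>C\<^sub>L 'b \<Rightarrow> 'a \<Rightarrow>\<^sub>L 'b" where "J T = Blinfun (cblinfun_apply T)" for T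
  have J: "blinfun_apply (J T) = cblinfun_apply T" for T
    using bounded_clinear_cblinfun_apply [of T]
    by (simp add: J_def bounded_linear_Blinfun_apply bounded_clinear_def)
  have dist_J: "dist (J S) (J T) = dist S T" for S T
  proof -
    have "J S - J T = J (S - T)"
      by (rule blinfun_eqI) (simp add: J blinfun.diff_left minus_cblinfun.rep_eq)
    then show ?thesis
      by (simp add: dist_norm norm_blinfun.rep_eq norm_cblinfun.rep_eq J)
  qed
  have "Cauchy (\<lambda>n. J (X n))"
    using X by (simp add: Cauchy_def dist_J)
  then obtain L where L: "(\<lambda>n. J (X n)) \<longlonglongrightarrow> L"
    by (auto simp: Cauchy_convergent_iff convergent_def)
  have lim: "(\<lambda>n. cblinfun_apply (X n) x) \<longlonglongrightarrow> blinfun_apply L x" for x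
    using blinfun.tendsto [OF L tendsto_const [of x]] by (simp add: J)
  have "blinfun_apply L (c *\<^sub>C x) = c *\<^sub>C blinfun_apply L x" for c x
  proof (rule LIMSEQ_unique)
    show "(\<lambda>n. cblinfun_apply (X n) (c *\<^sub>C x)) \<longlonglongrightarrow> blinfun_apply L (c *\<^sub>C x)"
      by (rule lim)
    have "(\<lambda>n. cmod c * dist (cblinfun_apply (X n) x) (blinfun_apply L x)) \<longlonglongrightarrow> cmod c * 0"
      using iffD1 [OF tendsto_dist_iff lim [of x]] by (intro tendsto_intros)
    then have "(\<lambda>n. c *\<^sub>C cblinfun_apply (X n) x) \<longlonglongrightarrow> c *\<^sub>C blinfun_apply L x"
      by (subst tendsto_dist_iff) (simp add: dist_norm
          cvec.scale_right_diff_distrib [symmetric] norm_scaleC)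
    moreover have "cblinfun_apply (X n) (c *\<^sub>C x) = c *\<^sub>C cblinfun_apply (X n) x" for n
      using bounded_clinear_cblinfun_apply by (auto simp: bounded_clinear_def)
    ultimately show "(\<lambda>n. cblinfun_apply (X n) (c *\<^sub>C x)) \<longlonglongrightarrow> c *\<^sub>C blinfun_apply L x"
      by simp
  qed
  then have "bounded_clinear (blinfun_apply L)"
    by (simp add: bounded_clinear_def blinfun.bounded_linear_right)
  then have "cblinfun_apply (CBlinfun (blinfun_apply L)) = blinfun_apply L"
    by (simp add: CBlinfun_inverse)
  then have "J (CBlinfun (blinfun_apply L)) = L"
    by (intro blinfun_eqI) (simp add: J)
  then have "X \<longlonglongrightarrow> CBlinfun (blinfun_apply L)"
    using iffD1 [OF tendsto_dist_iff L] dist_J [of _ "CBlinfun (blinfun_apply L)"]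
    by (subst tendsto_dist_iff) simp
  then show "convergent X"
    by (auto simp: convergent_def)
qed

lift_definition id_cblinfun :: "'a::complex_normed_vector \<Rightarrow>\<^sub>C\<^sub>L 'a" is "\<lambda>x. x"
  by (simp add: bounded_clinear_def)

lift_definition cblinfun_compose ::
  "'b::complex_normed_vector \<Rightarrow>\<^sub>C\<^sub>L 'c::complex_normed_vector \<Rightarrow>
   'a::complex_normed_vector \<Rightarrow>\<^sub>C\<^sub>L 'b \<Rightarrow> 'a \<Rightarrow>\<^sub>C\<^sub>L 'c"  (infixl \<open>o\<^sub>C\<^sub>L\<close> 67)
  is "\<lambda>S T x. S (T x)"
  by (simp add: bounded_clinear_def bounded_linear_compose)

lift_definition dual_op ::
  "'a::complex_normed_vector \<Rightarrow>\<^sub>C\<^sub>L 'b::complex_normed_vector \<Rightarrow>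
   ('b \<Rightarrow>\<^sub>C\<^sub>L complex) \<Rightarrow>\<^sub>C\<^sub>L ('a \<Rightarrow>\<^sub>C\<^sub>L complex)"
  is "\<lambda>T \<phi>. \<phi> o\<^sub>C\<^sub>L T"
proof -
  fix T :: "'a \<Rightarrow>\<^sub>C\<^sub>L 'b"
  have T: "bounded_linear (cblinfun_apply T)"
    using bounded_clinear_cblinfun_apply [of T] by (simp add: bounded_clinear_def)
  have "bounded_linear (\<lambda>\<phi> :: 'b \<Rightarrow>\<^sub>C\<^sub>L complex. \<phi> o\<^sub>C\<^sub>L T)"
  proof (rule bounded_linear_intro)
    show "(\<phi> + \<psi>) o\<^sub>C\<^sub>L T = \<phi> o\<^sub>C\<^sub>L T + \<psi> o\<^sub>C\<^sub>L T" for \<phi> \<psi> :: "'b \<Rightarrow>\<^sub>C\<^sub>L complex"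
      by transfer simp
    show "(r *\<^sub>R \<phi>) o\<^sub>C\<^sub>L T = r *\<^sub>R (\<phi> o\<^sub>C\<^sub>L T)" for r and \<phi> :: "'b \<Rightarrow>\<^sub>C\<^sub>L complex"
      unfolding scaleR_scaleC by transfer simp
    show "norm (\<phi> o\<^sub>C\<^sub>L T) \<le> norm \<phi> * norm T" for \<phi> :: "'b \<Rightarrow>\<^sub>C\<^sub>L complex"
      using onorm_compose [of "cblinfun_apply \<phi>" "cblinfun_apply T"]
        bounded_clinear_cblinfun_apply [of \<phi>] T
      by (simp add: norm_cblinfun.rep_eq cblinfun_compose.rep_eq bounded_clinear_def comp_def)
  qed
  moreover have "(c *\<^sub>C \<phi>) o\<^sub>C\<^sub>L T = c *\<^sub>C (\<phi> o\<^sub>C\<^sub>L T)" for c and \<phi> :: "'b \<Rightarrow>\<^sub>C\<^sub>L complex"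
    by transfer simp
  ultimately show "bounded_clinear (\<lambda>\<phi> :: 'b \<Rightarrow>\<^sub>C\<^sub>L complex. \<phi> o\<^sub>C\<^sub>L T)"
    by (simp add: bounded_clinear_def)
qed

text \<open>The operator matrix with rows \<open>(A, C)\<close> and \<open>(0, B)\<close>. The direct sum is the product type,
  whose norm is \<open>sqrt (norm x ^ 2 + norm y ^ 2)\<close>; all notions below depend only on the topology.\<close>

lift_definition upper_triangular_op ::
  "'a::complex_normed_vector \<Rightarrow>\<^sub>C\<^sub>L 'a \<Rightarrow> 'b::complex_normed_vector \<Rightarrow>\<^sub>C\<^sub>L 'a \<Rightarrow> 'b \<Rightarrow>\<^sub>C\<^sub>L 'b \<Rightarrow>
   ('a \<times> 'b) \<Rightarrow>\<^sub>C\<^sub>L ('a \<times> 'b)"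
  is "\<lambda>A C B (x, y). (A x + C y, B y)"
proof -
  fix A :: "'a \<Rightarrow> 'a" and C :: "'b \<Rightarrow> 'a" and B :: "'b \<Rightarrow> 'b"
  assume *: "bounded_clinear A" "bounded_clinear C" "bounded_clinear B"
  have "bounded_linear (\<lambda>p :: 'a \<times> 'b. (A (fst p) + C (snd p), B (snd p)))"
    using * unfolding bounded_clinear_def
    by (intro bounded_linear_Pair bounded_linear_add
        bounded_linear_compose [OF _ bounded_linear_fst]
        bounded_linear_compose [OF _ bounded_linear_snd]) simp_all
  with * show "bounded_clinear (\<lambda>(x, y). (A x + C y, B y))"
    by (simp add: bounded_clinear_def case_prod_unfold scaleC_prod_def scaleC_add_right)
qed


section \<open>Kernel, range, nullity and deficiency\<close>

definition kernel :: "'a::complex_normed_vector \<Rightarrow>\<^sub>C\<^sub>L 'b::complex_normed_vector \<Rightarrow> 'a set" where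
  "kernel T = {x. cblinfun_apply T x = 0}"

definition op_range :: "'a::complex_normed_vector \<Rightarrow>\<^sub>C\<^sub>L 'b::complex_normed_vector \<Rightarrow> 'b set" where
  "op_range T = range (cblinfun_apply T)"

text \<open>The library dimension of an infinite-dimensional space is the junk value 0, hence the
  extension to \<^typ>\<open>enat\<close>.\<close>

definition cedim :: "'a::complex_normed_vector set \<Rightarrow> enat" where
  "cedim S = (if \<exists>F. finite F \<and> cspan F = S then enat (cdim S) else \<infinity>)"

text \<open>For a subspace \<open>S\<close> and a finite set \<open>F\<close>: the cosets \<open>b + S\<close> with \<open>b \<in> F\<close> are pairwise
  distinct and form a basis of the quotient space of the whole space by \<open>S\<close>.\<close>

definition quotient_basis :: "'a::complex_normed_vector set \<Rightarrow> 'a set \<Rightarrow> bool" where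
  "quotient_basis S F \<longleftrightarrow>
     (\<forall>u. (\<Sum>b\<in>F. u b *\<^sub>C b) \<in> S \<longrightarrow> (\<forall>b\<in>F. u b = 0)) \<and>
     (\<forall>x. \<exists>u. x - (\<Sum>b\<in>F. u b *\<^sub>C b) \<in> S)"

definition quotient_edim :: "'a::complex_normed_vector set \<Rightarrow> enat" where
  "quotient_edim S =
     (if \<exists>F. finite F \<and> quotient_basis S F
      then enat (card (SOME F. finite F \<and> quotient_basis S F)) else \<infinity>)"

definition nullity :: "'a::complex_normed_vector \<Rightarrow>\<^sub>C\<^sub>L 'a \<Rightarrow> enat" where
  "nullity T = cedim (kernel T)"

definition deficiency :: "'a::complex_normed_vector \<Rightarrow>\<^sub>C\<^sub>L 'a \<Rightarrow> enat" where
  "deficiency T = quotient_edim (op_range T)"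

definition closed_complemented :: "'a::complex_normed_vector set \<Rightarrow> bool" where
  "closed_complemented S \<longleftrightarrow> csubspace S \<and> closed S \<and>
     (\<exists>N. csubspace N \<and> closed N \<and> S \<inter> N = {0} \<and> {x + y |x y. x \<in> S \<and> y \<in> N} = UNIV)"


section \<open>Semi-Fredholm classes and spectra\<close>

definition Phi_plus :: "('a::cbanach \<Rightarrow>\<^sub>C\<^sub>L 'a) set" where
  "Phi_plus = {T. nullity T < \<infinity> \<and> closed (op_range T)}"

definition Phi_minus :: "('a::cbanach \<Rightarrow>\<^sub>C\<^sub>L 'a) set" where
  "Phi_minus = {T. deficiency T < \<infinity>}"

definition Phi_l :: "('a::cbanach \<Rightarrow>\<^sub>C\<^sub>L 'a) set" where
  "Phi_l = {T. closed_complemented (op_range T) \<and> nullity T < \<infinity>}"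

definition Phi_r :: "('a::cbanach \<Rightarrow>\<^sub>C\<^sub>L 'a) set" where
  "Phi_r = {T. closed_complemented (kernel T) \<and> deficiency T < \<infinity>}"

definition SF0 :: "('a::cbanach \<Rightarrow>\<^sub>C\<^sub>L 'a) set" where
  "SF0 = {T \<in> Phi_plus \<union> Phi_minus. nullity T = 0 \<or> deficiency T = 0}"

definition left_invertible :: "'a::cbanach \<Rightarrow>\<^sub>C\<^sub>L 'a \<Rightarrow> bool" where
  "left_invertible T \<longleftrightarrow> (\<exists>S :: 'a \<Rightarrow>\<^sub>C\<^sub>L 'a. S o\<^sub>C\<^sub>L T = id_cblinfun)"

definition right_invertible :: "'a::cbanach \<Rightarrow>\<^sub>C\<^sub>L 'a \<Rightarrow> bool" where
  "right_invertible T \<longleftrightarrow> (\<exists>S :: 'a \<Rightarrow>\<^sub>C\<^sub>L 'a. T o\<^sub>C\<^sub>L S = id_cblinfun)"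

definition sigma_K :: "'a::cbanach \<Rightarrow>\<^sub>C\<^sub>L 'a \<Rightarrow> complex set" where
  "sigma_K T = {z. T - z *\<^sub>C id_cblinfun \<notin> Phi_plus \<union> Phi_minus}"

definition sigma_K3 :: "'a::cbanach \<Rightarrow>\<^sub>C\<^sub>L 'a \<Rightarrow> complex set" where
  "sigma_K3 T = {z. T - z *\<^sub>C id_cblinfun \<notin> Phi_l \<union> Phi_r}"

definition sigma_SF0 :: "'a::cbanach \<Rightarrow>\<^sub>C\<^sub>L 'a \<Rightarrow> complex set" where
  "sigma_SF0 T = {z. T - z *\<^sub>C id_cblinfun \<notin> SF0}"

definition sigma_lr :: "'a::cbanach \<Rightarrow>\<^sub>C\<^sub>L 'a \<Rightarrow> complex set" where
  "sigma_lr T = {z. \<not> left_invertible (T - z *\<^sub>C id_cblinfun) \<and>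
                    \<not> right_invertible (T - z *\<^sub>C id_cblinfun)}"

text \<open>A HOL variable cannot stand for a spectrum that is applied to operators on three different
  spaces, so the choice among the four spectra is encoded by a label.\<close>

datatype spectrum_label = Spec_K | Spec_K3 | Spec_SF0 | Spec_lr

primrec sigma_star :: "spectrum_label \<Rightarrow> 'a::cbanach \<Rightarrow>\<^sub>C\<^sub>L 'a \<Rightarrow> complex set" where
  "sigma_star Spec_K T = sigma_K T"
| "sigma_star Spec_K3 T = sigma_K3 T"
| "sigma_star Spec_SF0 T = sigma_SF0 T"
| "sigma_star Spec_lr T = sigma_lr T"


section \<open>Single valued extension property\<close>

text \<open>Vector-valued analyticity on an open set: existence of the complex derivative in norm at
  every point.\<close>

definition vec_analytic_on :: "(complex \<Rightarrow> 'a::complex_normed_vector) \<Rightarrow> complex set \<Rightarrow> bool" where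
  "vec_analytic_on f V \<longleftrightarrow>
     (\<forall>z\<in>V. \<exists>d. ((\<lambda>w. inverse (w - z) *\<^sub>C (f w - f z)) \<longlongrightarrow> d) (at z))"

definition SVEP_at :: "'a::cbanach \<Rightarrow>\<^sub>C\<^sub>L 'a \<Rightarrow> complex \<Rightarrow> bool" where
  "SVEP_at T z \<longleftrightarrow>
     (\<exists>r>0. \<forall>V. open V \<and> V \<subseteq> ball z r \<longrightarrow>
        (\<forall>f. vec_analytic_on f V \<and>
             (\<forall>\<mu>\<in>V. cblinfun_apply (T - \<mu> *\<^sub>C id_cblinfun) (f \<mu>) = 0) \<longrightarrow>
             (\<forall>\<mu>\<in>V. f \<mu> = 0)))"

definition not_SVEP :: "'a::cbanach \<Rightarrow>\<^sub>C\<^sub>L 'a \<Rightarrow> complex set" where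
  "not_SVEP T = {z. \<not> SVEP_at T z}"

end

theory Submission
  imports Defs
begin

text \<open>
  All statements about a point \<open>\<lambda>\<close> of a spectrum are moved to \<open>0\<close> by subtracting \<open>\<lambda>\<close> from the
  operators; the shifted matrix operator is again upper triangular.

  The engine is one inequality: if \<open>T\<close> has the single valued extension property (SVEP) at \<open>0\<close> and its
  range has finite codimension \<open>n\<close>, then the kernel of \<open>T\<close> has dimension at most \<open>n\<close>
  (\<open>SVEP_imp_nullity_le_deficiency\<close>). Suppose that there are more than \<open>n\<close> independent vectors in the
  kernel. Modulo an \<open>n\<close>-dimensional space \<open>span F\<close>, every vector has a preimage of comparable norm,
  so each kernel vector \<open>b\<close> starts a power series \<open>g b\<close> with \<open>(T - \<mu>) (g b \<mu>) \<in> span F\<close> near \<open>0\<close>. The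
  \<open>F\<close>-coordinates of these vectors are analytic in \<open>\<mu>\<close>; eliminating them one after the other, as in
  solving \<open>n\<close> linear equations in more than \<open>n\<close> unknowns, leaves an analytic \<open>f\<close> without zeros on some
  small open set with \<open>(T - \<mu>) (f \<mu>) = 0\<close>. This contradicts the SVEP. Because SVEP at \<open>0\<close> speaks about
  all open subsets of a disc, it does not matter that the small set may miss \<open>0\<close>.

  Hence, under the SVEP of \<open>T\<close>, a lower semi-Fredholm \<open>T\<close> is Fredholm, and a surjective \<open>T\<close> is
  bijective. Applied to the dual operator, with the Hahn--Banach theorem as the bridge, the SVEP of
  \<open>T\<^sup>*\<close> makes an upper semi-Fredholm \<open>T\<close> Fredholm, and a \<open>T\<close> that is bounded below bijective.

  The four spectra are treated together. A Boolean parameter \<open>p\<close> says whether the notions are meant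
  modulo finite rank (\<open>p = True\<close>) or exactly (\<open>p = False\<close>). With it, the complements of the four
  spectra are described by \<open>bounded_below_mod p \<or> onto_mod p\<close> and
  \<open>left_invertible_mod p \<or> right_invertible_mod p\<close>. An operator \<open>T\<close> that is in both \<open>bounded_below_mod p\<close> and
  \<open>onto_mod p\<close> is invertible modulo \<open>p\<close> on both sides (\<open>Fredholm_imp_invertible_mod\<close>).

  For the matrix operator \<open>M\<close> with diagonal \<open>A\<close>, \<open>B\<close> the rest is algebra. The entry \<open>A\<close> inherits each left-hand
  property from \<open>M\<close> and \<open>B\<close> inherits each right-hand property; the SVEP of \<open>A\<^sup>*\<close> or of \<open>B\<close> then makes this entry
  invertible modulo \<open>p\<close>, and such an entry can be split off, so that the other entry inherits the
  property of \<open>M\<close> as well. Conversely, \<open>M\<close> has a property if both entries have it, and if \<open>A\<close> and \<open>A\<^sup>*\<close>, or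
  \<open>B\<close> and \<open>B\<^sup>*\<close>, have the SVEP, then one entry has the properties of both sides and can match whichever
  side the other entry offers. The passage from \<open>M\<close> to the entries rests on
  the SVEP of \<open>A\<^sup>*\<close> and \<open>B\<close>, which both identities provide.
\<close>

section \<open>Bounded complex-linear operators\<close>

declare [[coercion "cblinfun_apply :: ('a::complex_normed_vector, 'b::complex_normed_vector) cblinfun \<Rightarrow> 'a \<Rightarrow> 'b"]]

lemma cblinfun_bounded_linear: "bounded_linear (cblinfun_apply T)"
  using bounded_clinear_cblinfun_apply [of T] by (simp add: bounded_clinear_def)

lemma cblinfun_scaleC [simp]:
  fixes T :: "'a::complex_normed_vector \<Rightarrow>\<^sub>C\<^sub>L 'b::complex_normed_vector"
  shows "T (c *\<^sub>C x) = c *\<^sub>C T x"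
  using bounded_clinear_cblinfun_apply [of T] by (simp add: bounded_clinear_def)

lemma
  fixes T :: "'a::complex_normed_vector \<Rightarrow>\<^sub>C\<^sub>L 'b::complex_normed_vector"
  shows cblinfun_add [simp]: "T (x + y) = T x + T y"
  and cblinfun_diff [simp]: "T (x - y) = T x - T y"
  and cblinfun_minus [simp]: "T (- x) = - T x"
  and cblinfun_zero [simp]: "T 0 = 0"
  and cblinfun_scaleR: "T (r *\<^sub>R x) = r *\<^sub>R T x"
  and cblinfun_sum: "T (sum g S) = (\<Sum>i\<in>S. T (g i))"
proof -
  interpret bounded_linear "cblinfun_apply T"
    by (rule cblinfun_bounded_linear)
  show "T (x + y) = T x + T y" "T (x - y) = T x - T y" "T (- x) = - T x" "T 0 = 0"
    "T (r *\<^sub>R x) = r *\<^sub>R T x" "T (sum g S) = (\<Sum>i\<in>S. T (g i))"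
    by (rule add diff neg zero scaleR sum)+
qed

lemma cblinfun_norm_le:
  fixes T :: "'a::complex_normed_vector \<Rightarrow>\<^sub>C\<^sub>L 'b::complex_normed_vector"
  shows "norm (T x) \<le> norm T * norm x"
  unfolding norm_cblinfun.rep_eq by (rule onorm [OF cblinfun_bounded_linear])

lemma cblinfun_tendsto [tendsto_intros]:
  fixes T :: "'a::complex_normed_vector \<Rightarrow>\<^sub>C\<^sub>L 'b::complex_normed_vector"
  shows "(f \<longlongrightarrow> l) F \<Longrightarrow> ((\<lambda>x. cblinfun_apply T (f x)) \<longlongrightarrow> T l) F"
  by (rule bounded_linear.tendsto [OF cblinfun_bounded_linear])

lemma cblinfun_continuous_on [continuous_intros]:
  "continuous_on S f \<Longrightarrow> continuous_on S (\<lambda>x. cblinfun_apply T (f x))"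
  by (rule bounded_linear.continuous_on [OF cblinfun_bounded_linear])

lemma cblinfun_apply_simps [simp]:
  fixes T :: "'a::complex_normed_vector \<Rightarrow>\<^sub>C\<^sub>L 'b::complex_normed_vector"
    and S :: "'b \<Rightarrow>\<^sub>C\<^sub>L 'c::complex_normed_vector" and U V :: "'a \<Rightarrow>\<^sub>C\<^sub>L 'b"
  shows
  "id_cblinfun (x :: 'a) = x"
  "(S o\<^sub>C\<^sub>L T) y = S (T y)"
  "(U - V) z = U z - V z"
  "(U + V) z = U z + V z"
  "(- U) z = - U z"
  "(0 :: 'a \<Rightarrow>\<^sub>C\<^sub>L 'b) z = 0"
  "(c *\<^sub>C U) z = c *\<^sub>C U z"
  by (simp_all add: id_cblinfun.rep_eq cblinfun_compose.rep_eq minus_cblinfun.rep_eq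
      plus_cblinfun.rep_eq uminus_cblinfun.rep_eq zero_cblinfun.rep_eq scaleC_cblinfun.rep_eq)

lemma dual_op_apply [simp]: "dual_op T \<phi> = \<phi> o\<^sub>C\<^sub>L T"
  by (simp add: dual_op.rep_eq)

lemma upper_triangular_op_apply [simp]: "upper_triangular_op A C B (x, y) = (A x + C y, B y)"
  by (simp add: upper_triangular_op.rep_eq)

lemmas scaleC_simps [simp] =
norm_scaleC scaleC_scaleC

lemma scaleC_complex_eq [simp]: "c *\<^sub>C x = c * x" for x :: complex
  by (simp add: scaleC_complex_def)

lemma scaleC_Pair [simp]: "c *\<^sub>C (x, y) = (c *\<^sub>C x, c *\<^sub>C y)"
  by (simp add: scaleC_prod_def)

lemma scaleC_diff_right: "c *\<^sub>C (x - y) = c *\<^sub>C x - c *\<^sub>C y"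
  and scaleC_diff_left: "(c - d) *\<^sub>C x = c *\<^sub>C x - d *\<^sub>C x"
  by (rule cvec.scale_right_diff_distrib cvec.scale_left_diff_distrib)+

lemma cblinfun_exI:
  fixes f :: "'a::complex_normed_vector \<Rightarrow> 'b::complex_normed_vector"
  assumes "\<And>x y. f (x + y) = f x + f y" and "\<And>c x. f (c *\<^sub>C x) = c *\<^sub>C f x"
    and "\<And>x. norm (f x) \<le> K * norm x"
  shows "\<exists>T :: 'a \<Rightarrow>\<^sub>C\<^sub>L 'b. \<forall>x. T x = f x"
proof -
  have "bounded_linear f"
    by (rule bounded_linear_intro [of _ K])
      (use assms in \<open>auto simp: scaleR_scaleC mult.commute\<close>)
  then have "bounded_clinear f"
    using assms by (simp add: bounded_clinear_def)
  then show ?thesis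
    by (intro exI [of _ "CBlinfun f"]) (simp add: CBlinfun_inverse)
qed

lemma bounded_bilinear_scaleC: "bounded_bilinear (scaleC :: complex \<Rightarrow> 'a \<Rightarrow> 'a::complex_normed_vector)"
  by (standard; (intro exI [of _ 1])?)
    (auto simp: scaleC_add_left scaleC_add_right scaleR_scaleC mult.commute)

lemmas tendsto_scaleC [tendsto_intros] = bounded_bilinear.tendsto [OF bounded_bilinear_scaleC]

lemma csubspace_imp_subspace: "csubspace S \<Longrightarrow> subspace S"
  by (simp add: cvec.subspace_def subspace_def scaleR_scaleC)

lemma csubspace_op_range: "csubspace (op_range T)"
  unfolding op_range_def cvec.subspace_def
  by (auto simp: image_iff) (metis cblinfun_zero cblinfun_add cblinfun_scaleC)+

lemma csubspace_kernel: "csubspace (kernel T)"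
  unfolding kernel_def cvec.subspace_def by auto

lemma closed_kernel: "closed (kernel T)"
proof -
  have "kernel T = cblinfun_apply T -` {0}"
    by (auto simp: kernel_def)
  then show ?thesis
    by (simp add: closed_vimage cblinfun_continuous_on)
qed

lift_definition fst_op :: "('a::complex_normed_vector \<times> 'b::complex_normed_vector) \<Rightarrow>\<^sub>C\<^sub>L 'a" is fst
  by (simp add: bounded_clinear_def bounded_linear_fst scaleC_prod_def)

lift_definition snd_op :: "('a::complex_normed_vector \<times> 'b::complex_normed_vector) \<Rightarrow>\<^sub>C\<^sub>L 'b" is snd
  by (simp add: bounded_clinear_def bounded_linear_snd scaleC_prod_def)

lift_definition inl_op :: "'a::complex_normed_vector \<Rightarrow>\<^sub>C\<^sub>L ('a \<times> 'b::complex_normed_vector)" is "\<lambda>x. (x, 0)"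
  by (simp add: bounded_clinear_def bounded_linear_Pair)

lift_definition inr_op :: "'b::complex_normed_vector \<Rightarrow>\<^sub>C\<^sub>L ('a::complex_normed_vector \<times> 'b)" is "\<lambda>y. (0, y)"
  by (simp add: bounded_clinear_def bounded_linear_Pair)

lemma product_op_apply [simp]:
  "fst_op p = fst p" "snd_op p = snd p" "inl_op x = (x, 0)" "inr_op y = (0, y)"
  by (simp_all add: fst_op.rep_eq snd_op.rep_eq inl_op.rep_eq inr_op.rep_eq)

lemma cspan_image: "cspan (cblinfun_apply T ` F) = cblinfun_apply T ` cspan F"
proof -
  interpret module_hom scaleC scaleC "cblinfun_apply T"
    by unfold_locales (auto simp: scaleC_add_left scaleC_add_right)
  show ?thesis
    unfolding cspan_def by (rule span_image)
qed

lemma csubspace_image: "csubspace S \<Longrightarrow> csubspace (cblinfun_apply T ` S)"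
  by (metis cspan_image cvec.span_eq_iff)

lemma cspan_insert_cspan: "cspan (insert b (cspan S)) = cspan (insert b S)"
  unfolding cvec.span_eq
  by (auto intro: cvec.span_base cvec.span_mono [THEN subsetD, of S])

section \<open>The complex Hahn--Banach theorem\<close>

text \<open>The extension theorem is proved on graphs: partial functionals are real subspaces of
  \<open>'a \<times> \<real>\<close>, and domination by a multiple of the norm already forces a subspace to be the graph of
  a function.\<close>

text \<open>The value \<open>a\<close> at the new vector \<open>x0\<close> must lie between all lower bounds \<open>r - K \<bar>x - x0\<bar>\<close> and all
  upper bounds \<open>K \<bar>y + x0\<bar> - s\<close> that the old graph imposes; the triangle inequality makes every
  lower bound at most every upper bound, so the supremum of the lower bounds works.\<close>

lemma Hahn_Banach_step:
  fixes M :: "('a::real_normed_vector \<times> real) set"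
  assumes sub: "subspace M" and dom: "\<And>x r. (x, r) \<in> M \<Longrightarrow> r \<le> K * norm x" and K: "K \<ge> 0"
  obtains a where "\<And>x r. (x, r) \<in> span (insert (x0, a) M) \<Longrightarrow> r \<le> K * norm x"
proof -
  let ?L = "(\<lambda>(x, r). r - K * norm (x - x0)) ` M"
  have 0: "(0, 0) \<in> M"
    using subspace_0 [OF sub] by (simp add: zero_prod_def)
  have le: "r - K * norm (x - x0) \<le> K * norm (y + x0) - s" if "(x, r) \<in> M" "(y, s) \<in> M" for x r y s
  proof -
    have "r + s \<le> K * norm (x + y)"
      using dom [of "x + y" "r + s"] subspace_add [OF sub that] by simp
    also have "\<dots> \<le> K * (norm (x - x0) + norm (y + x0))"
      using norm_triangle_ineq [of "x - x0" "y + x0"] K by (intro mult_left_mono) auto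
    finally show ?thesis
      by (simp add: algebra_simps)
  qed
  define a where "a = Sup ?L"
  have bdd: "bdd_above ?L"
    using le [OF _ 0] by (intro bdd_aboveI2) auto
  have lower: "r - K * norm (x - x0) \<le> a" if "(x, r) \<in> M" for x r
    unfolding a_def using that by (intro cSup_upper bdd) force
  have upper: "a \<le> K * norm (y + x0) - s" if "(y, s) \<in> M" for y s
    unfolding a_def using 0 that le by (intro cSup_least) auto
  \<comment> \<open>A point of the new graph is \<open>m + t (x0, a)\<close>; dividing by \<open>\<bar>t\<bar>\<close> reduces the claim to the bounds on \<open>a\<close>.\<close>
  have "r \<le> K * norm x" if xr: "(x, r) \<in> span (insert (x0, a) M)" for x r
  proof -
    have "span M = M"
      using sub by simp
    then obtain t where t: "(x - t *\<^sub>R x0, r - t * a) \<in> M"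
      using xr unfolding span_breakdown_eq by (metis diff_Pair real_scaleR_def scaleR_Pair)
    consider "t = 0" | "t > 0" | "t < 0"
      by linarith
    then show ?thesis
    proof cases
      case 1
      then show ?thesis
        using t dom by simp
    next
      case 2
      have "((1/t) *\<^sub>R (x - t *\<^sub>R x0), (1/t) * (r - t * a)) \<in> M"
        using subspace_scale [OF sub t, of "1/t"] by simp
      from upper [OF this] 2 have "a \<le> K * norm ((1/t) *\<^sub>R x) - (1/t) * (r - t * a)"
        by (simp add: algebra_simps)
      then show ?thesis
        using 2 by (simp add: field_simps)
    next
      case 3
      have "((-1/t) *\<^sub>R (x - t *\<^sub>R x0), (-1/t) * (r - t * a)) \<in> M"
        using subspace_scale [OF sub t, of "-1/t"] by simp
      from lower [OF this] 3 have "(-1/t) * (r - t * a) - K * norm ((-1/t) *\<^sub>R x) \<le> a"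
        by (simp add: algebra_simps)
      then show ?thesis
        using 3 by (simp add: field_simps)
    qed
  qed
  then show ?thesis
    by (rule that)
qed

lemma Hahn_Banach_graph:
  fixes G :: "('a::real_normed_vector \<times> real) set"
  assumes G: "subspace G" "\<And>x r. (x, r) \<in> G \<Longrightarrow> r \<le> K * norm x" and K: "K \<ge> 0"
  shows "\<exists>g :: 'a \<Rightarrow> real. linear g \<and> (\<forall>x. g x \<le> K * norm x) \<and> (\<forall>(x, r)\<in>G. g x = r)"
proof -
  let ?A = "{H. subspace H \<and> G \<subseteq> H \<and> (\<forall>(x, r)\<in>H. r \<le> K * norm x)}"
  have "\<exists>M\<in>?A. \<forall>H\<in>?A. M \<subseteq> H \<longrightarrow> H = M"
  proof (rule subset_Zorn_nonempty)
    show "?A \<noteq> {}"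
      using G by auto
  next
    fix \<C>
    assume \<C>: "\<C> \<noteq> {}" "subset.chain ?A \<C>"
    then obtain H0 where H0: "H0 \<in> \<C>"
      by blast
    have \<C>A: "H \<in> ?A" if "H \<in> \<C>" for H
      using that \<C>(2) by (auto simp: subset.chain_def)
    have "subspace (\<Union>\<C>)"
    proof (rule subspaceI)
      show "0 \<in> \<Union>\<C>"
        using H0 \<C>A [OF H0] subspace_0 by auto
    next
      fix p q assume "p \<in> \<Union>\<C>" "q \<in> \<Union>\<C>"
      then obtain H1 H2 where H: "H1 \<in> \<C>" "H2 \<in> \<C>" "p \<in> H1" "q \<in> H2"
        by blast
      then have "H1 \<subseteq> H2 \<or> H2 \<subseteq> H1"
        using \<C>(2) by (auto simp: subset_chain_def)
      then show "p + q \<in> \<Union>\<C>"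
        using H \<C>A subspace_add by blast
    next
      fix c p assume "p \<in> \<Union>\<C>"
      then show "c *\<^sub>R p \<in> \<Union>\<C>"
        using \<C>A subspace_scale by blast
    qed
    then show "\<Union>\<C> \<in> ?A"
      using \<C>A H0 by fastforce
  qed
  then obtain M where MA: "M \<in> ?A" and maxA: "\<forall>H\<in>?A. M \<subseteq> H \<longrightarrow> H = M"
    by (elim bexE)
  from MA have M: "subspace M" "G \<subseteq> M" "\<And>x r. (x, r) \<in> M \<Longrightarrow> r \<le> K * norm x"
    by auto
  have max: "H = M" if "subspace H" "\<And>x r. (x, r) \<in> H \<Longrightarrow> r \<le> K * norm x" "M \<subseteq> H" for H
    using that M(2) by (intro maxA [rule_format]) auto
  have total: "\<exists>r. (x, r) \<in> M" for x
  proof -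
    obtain a where "\<And>y r. (y, r) \<in> span (insert (x, a) M) \<Longrightarrow> r \<le> K * norm y"
      using Hahn_Banach_step [OF M(1,3) K] by metis
    then have "span (insert (x, a) M) = M"
      by (intro max) (auto intro: span_base)
    then show ?thesis
      using span_base [of "(x, a)" "insert (x, a) M"] by auto
  qed
  \<comment> \<open>Differences of values over the same point lie over \<open>0\<close>, where domination forces both signs to be nonpositive.\<close>
  have single: "r = s" if "(x, r) \<in> M" "(x, s) \<in> M" for x r s
    using M(3) [of 0 "r - s"] M(3) [of 0 "s - r"] subspace_diff [OF M(1) that]
      subspace_diff [OF M(1) that(2,1)] by simp
  define g where "g x = (THE r. (x, r) \<in> M)" for x
  have gM: "(x, g x) \<in> M" for x
    unfolding g_def by (rule theI') (use total single in blast)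
  have geq: "g x = r" if "(x, r) \<in> M" for x r
    using single [OF gM that] .
  have "linear g"
  proof (rule linearI)
    show "g (x + y) = g x + g y" for x y
      using subspace_add [OF M(1) gM gM] by (intro geq) simp
    show "g (c *\<^sub>R x) = c *\<^sub>R g x" for c x
      using subspace_scale [OF M(1) gM] by (intro geq) simp
  qed
  then show ?thesis
    using M gM geq by (intro exI [of _ g]) auto
qed

text \<open>A complex functional is determined by its real part \<open>g\<close> as \<open>x \<mapsto> g x - \<i> g (\<i> x)\<close>; so the real
  part is extended, and rotating \<open>x\<close> until the value becomes real keeps the bound.\<close>

theorem complex_Hahn_Banach:
  fixes f :: "'a::complex_normed_vector \<Rightarrow> complex"
  assumes S: "csubspace S"
    and add: "\<And>x y. x \<in> S \<Longrightarrow> y \<in> S \<Longrightarrow> f (x + y) = f x + f y"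
    and scale: "\<And>c x. x \<in> S \<Longrightarrow> f (c *\<^sub>C x) = c * f x"
    and bound: "\<And>x. x \<in> S \<Longrightarrow> cmod (f x) \<le> K * norm x" and K: "K \<ge> 0"
  shows "\<exists>\<phi> :: 'a \<Rightarrow>\<^sub>C\<^sub>L complex. \<forall>x\<in>S. \<phi> x = f x"
proof -
  let ?G = "(\<lambda>x. (x, Re (f x))) ` S"
  have sub: "subspace ?G"
  proof (rule subspaceI)
    have "f 0 = 0"
      using scale [of 0 0] cvec.subspace_0 [OF S] by simp
    then show "0 \<in> ?G"
      using cvec.subspace_0 [OF S] by (force simp: zero_prod_def)
    show "p + q \<in> ?G" if "p \<in> ?G" "q \<in> ?G" for p q
      using that add cvec.subspace_add [OF S] by (force simp: image_iff)
    show "c *\<^sub>R p \<in> ?G" if "p \<in> ?G" for c p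
      using that scale [of _ "complex_of_real c"] cvec.subspace_scale [OF S, of _ "complex_of_real c"]
      by (force simp: image_iff scaleR_scaleC)
  qed
  have dom: "r \<le> K * norm x" if "(x, r) \<in> ?G" for x r
    using that bound complex_Re_le_cmod order_trans by blast
  obtain g :: "'a \<Rightarrow> real" where g: "linear g" "\<And>x. g x \<le> K * norm x"
      and gG: "\<And>x r. (x, r) \<in> ?G \<Longrightarrow> g x = r"
    using Hahn_Banach_graph [OF sub dom K] by auto
  have gf: "g x = Re (f x)" if "x \<in> S" for x
    using gG that by blast
  define F where "F x = Complex (g x) (- g (\<i> *\<^sub>C x))" for x
  have gadd: "g (x + y) = g x + g y" and gscale: "g (c *\<^sub>R x) = c * g x" for x y c
    using g(1) by (simp_all add: linear_add linear_scale)
  have Fadd: "F (x + y) = F x + F y" for x y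
    by (simp add: F_def gadd scaleC_add_right complex_eq_iff)
  have Fscale: "F (c *\<^sub>C x) = c * F x" for c x
  proof -
    have c: "c *\<^sub>C x = Re c *\<^sub>R x + Im c *\<^sub>R (\<i> *\<^sub>C x)"
      by (simp add: scaleR_scaleC scaleC_add_left [symmetric] complex_eq_iff)
    have ic: "\<i> *\<^sub>C c *\<^sub>C x = Re c *\<^sub>R (\<i> *\<^sub>C x) - Im c *\<^sub>R x"
      by (simp add: scaleR_scaleC scaleC_diff_left [symmetric] complex_eq_iff)
    show ?thesis
      unfolding F_def ic unfolding c
      using gadd [of "Re c *\<^sub>R (\<i> *\<^sub>C x) - Im c *\<^sub>R x" "Im c *\<^sub>R x"]
      by (simp add: gadd gscale complex_eq_iff)
  qed
  have Fbound: "cmod (F x) \<le> K * norm x" for x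
  proof (cases "F x = 0")
    case True
    then show ?thesis
      using K by simp
  next
    case False
    \<comment> \<open>The unimodular factor that rotates \<open>F x\<close> to the positive real axis.\<close>
    define u where "u = cnj (F x) / cmod (F x)"
    have u: "cmod u = 1"
      using False by (simp add: u_def norm_divide)
    have "F (u *\<^sub>C x) = cmod (F x)"
      using False by (simp add: Fscale u_def complex_norm_square [symmetric] power2_eq_square mult.commute)
    then have "cmod (F x) = g (u *\<^sub>C x)"
      by (simp add: F_def complex_eq_iff)
    also have "\<dots> \<le> K * norm x"
      using g(2) [of "u *\<^sub>C x"] u by simp
    finally show ?thesis .
  qed
  obtain \<phi> :: "'a \<Rightarrow>\<^sub>C\<^sub>L complex" where \<phi>: "\<And>x. \<phi> x = F x"
    using cblinfun_exI [of F K] Fadd Fscale Fbound by auto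
  have "\<phi> x = f x" if "x \<in> S" for x
    using that cvec.subspace_scale [OF S that, of \<i>]
    by (simp add: \<phi> F_def gf scale complex_eq_iff)
  then show ?thesis
    by blast
qed

section \<open>Separation and finite-dimensional subspaces\<close>

text \<open>The coordinate along \<open>b\<close> in the span of \<open>b\<close> and \<open>S\<close> is a functional of norm at most \<open>1 / \<delta>\<close>, where
  \<open>\<delta>\<close> is a lower bound of the distance from \<open>b\<close> to \<open>S\<close>; it is extended by Hahn--Banach.\<close>

lemma closed_subspace_separation:
  fixes b :: "'a::complex_normed_vector"
  assumes S: "csubspace S" "closed S" and b: "b \<notin> S"
  obtains \<phi> :: "'a \<Rightarrow>\<^sub>C\<^sub>L complex" where "\<phi> b = 1" "\<And>x. x \<in> S \<Longrightarrow> \<phi> x = 0"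
proof -
  let ?V = "cspan (insert b S)"
  have spanS: "cspan S = S"
    using S(1) by simp
  obtain \<delta> where \<delta>: "\<delta> > 0" "\<And>s. s \<in> S \<Longrightarrow> \<delta> \<le> norm (b - s)"
  proof -
    obtain e where e: "e > 0" "ball b e \<inter> S = {}"
      using S(2) b by (metis Compl_iff disjoint_eq_subset_Compl open_Compl open_contains_ball_eq)
    show ?thesis
    proof (rule that [OF e(1)])
      show "e \<le> norm (b - s)" if "s \<in> S" for s
        using e(2) that by (force simp: disjoint_iff dist_norm not_less)
    qed
  qed
  define f where "f x = (THE t. x - t *\<^sub>C b \<in> S)" for x
  have unique: "t = u" if "x - t *\<^sub>C b \<in> S" "x - u *\<^sub>C b \<in> S" for x t u
  proof (rule ccontr)
    assume "t \<noteq> u"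
    have "(x - u *\<^sub>C b) - (x - t *\<^sub>C b) \<in> S"
      by (rule cvec.subspace_diff [OF S(1) that(2,1)])
    then have "(t - u) *\<^sub>C b \<in> S"
      by (simp add: scaleC_diff_left)
    then have "inverse (t - u) *\<^sub>C (t - u) *\<^sub>C b \<in> S"
      by (rule cvec.subspace_scale [OF S(1)])
    then show False
      using \<open>t \<noteq> u\<close> b by simp
  qed
  have f_eq: "f x = t" if "x - t *\<^sub>C b \<in> S" for x t
    unfolding f_def using that unique by blast
  have f_mem: "x - f x *\<^sub>C b \<in> S" if "x \<in> ?V" for x
    using that f_eq by (auto simp: cvec.span_breakdown_eq spanS)
  have bound: "cmod (f x) \<le> (1 / \<delta>) * norm x" if x: "x \<in> ?V" for x
  proof (cases "f x = 0")
    case False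
    have "- inverse (f x) *\<^sub>C (x - f x *\<^sub>C b) \<in> S"
      by (rule cvec.subspace_scale [OF S(1) f_mem [OF x]])
    from \<delta>(2) [OF this] have "\<delta> \<le> norm (inverse (f x) *\<^sub>C x)"
      using False by (simp add: scaleC_diff_right)
    then show ?thesis
      using False \<delta>(1) by (simp add: norm_divide field_simps)
  qed (use \<delta> in simp)
  have add: "f (x + y) = f x + f y" if "x \<in> ?V" "y \<in> ?V" for x y
    using cvec.subspace_add [OF S(1) f_mem f_mem, OF that]
    by (intro f_eq) (simp add: scaleC_add_left algebra_simps)
  have scale: "f (c *\<^sub>C x) = c * f x" if "x \<in> ?V" for c x
    using cvec.subspace_scale [OF S(1) f_mem, OF that, of c]
    by (intro f_eq) (simp add: scaleC_diff_right)
  obtain \<phi> :: "'a \<Rightarrow>\<^sub>C\<^sub>L complex" where \<phi>: "\<And>x. x \<in> ?V \<Longrightarrow> \<phi> x = f x"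
    using complex_Hahn_Banach [OF cvec.subspace_span [of "insert b S"] add scale bound] \<delta>(1) by auto
  show ?thesis
  proof (rule that)
    show "\<phi> b = 1"
      using \<phi> [of b] f_eq [of b 1] cvec.subspace_0 [OF S(1)] by (simp add: cvec.span_base)
    show "\<phi> x = 0" if "x \<in> S" for x
      using \<phi> [of x] f_eq [of x 0] that by (simp add: cvec.span_base)
  qed
qed

text \<open>A functional that separates \<open>b\<close> from \<open>S\<close> reads off the coordinate along \<open>b\<close>, so the larger space
  is the preimage of \<open>S\<close> under a continuous map.\<close>

lemma closed_cspan_insert:
  fixes S :: "'a::complex_normed_vector set"
  assumes S: "csubspace S" "closed S"
  shows "closed (cspan (insert b S))"
proof (cases "b \<in> S")
  case True
  then show ?thesis
    using S by (simp add: insert_absorb cvec.span_eq_iff [THEN iffD2])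
next
  case False
  then obtain \<phi> :: "'a \<Rightarrow>\<^sub>C\<^sub>L complex" where \<phi>: "\<phi> b = 1" "\<And>x. x \<in> S \<Longrightarrow> \<phi> x = 0"
    using closed_subspace_separation [OF S] by metis
  have "k = \<phi> x" if "x - k *\<^sub>C b \<in> S" for x k
    using \<phi>(2) [OF that] \<phi>(1) by simp
  then have "cspan (insert b S) = (\<lambda>x. x - \<phi> x *\<^sub>C b) -` S"
    using S(1) by (auto simp: cvec.span_breakdown_eq cvec.span_eq_iff [THEN iffD2])
  moreover have "continuous_on UNIV (\<lambda>x. x - \<phi> x *\<^sub>C b)"
    by (intro continuous_intros bounded_bilinear.continuous_on [OF bounded_bilinear_scaleC])
  ultimately show ?thesis
    using S(2) by (simp add: closed_vimage)
qed

lemma closed_cspan_Un_finite: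
  fixes S :: "'a::complex_normed_vector set"
  assumes S: "csubspace S" "closed S" and "finite F"
  shows "closed (cspan (F \<union> S))"
  using \<open>finite F\<close>
proof induction
  case empty
  then show ?case
    using S by (simp add: cvec.span_eq_iff [THEN iffD2])
next
  case (insert b F)
  then show ?case
    using closed_cspan_insert [OF cvec.subspace_span insert.IH, of b] by (simp add: cspan_insert_cspan)
qed

lemma closed_cspan_finite: "finite F \<Longrightarrow> closed (cspan F)"
  using closed_cspan_Un_finite [of "{0}" F] by simp

lemma dual_functionals:
  fixes F :: "'a::complex_normed_vector set"
  assumes "finite F" and "\<not> cvec.dependent F"
  obtains \<phi> :: "'a \<Rightarrow> 'a \<Rightarrow>\<^sub>C\<^sub>L complex" where "\<And>b c. b \<in> F \<Longrightarrow> c \<in> F \<Longrightarrow> \<phi> b c = (if b = c then 1 else 0)"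
proof -
  have "\<exists>\<psi> :: 'a \<Rightarrow>\<^sub>C\<^sub>L complex. \<forall>c\<in>F. \<psi> c = (if b = c then 1 else 0)" if "b \<in> F" for b
  proof -
    have "closed (cspan (F - {b}))" "b \<notin> cspan (F - {b})"
      using assms that by (auto simp: cvec.dependent_def intro: closed_cspan_finite)
    then obtain \<psi> :: "'a \<Rightarrow>\<^sub>C\<^sub>L complex" where "\<psi> b = 1" "\<And>x. x \<in> cspan (F - {b}) \<Longrightarrow> \<psi> x = 0"
      using closed_subspace_separation [OF cvec.subspace_span] by metis
    then show ?thesis
      by (intro exI [of _ \<psi>]) (auto intro: cvec.span_base)
  qed
  then show ?thesis
    using that by metis
qed

section \<open>Common kernels of finitely many functionals\<close>

text \<open>Closed subspaces of finite codimension are represented by finite sets of functionals, because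
  in this form preimages and intersections are immediate: they are \<open>vanishing_compose\<close> and
  \<open>vanishing_Un\<close>.\<close>

definition vanishing :: "('a::complex_normed_vector \<Rightarrow>\<^sub>C\<^sub>L complex) set \<Rightarrow> 'a set" where
  "vanishing \<Phi> = {x. \<forall>\<phi>\<in>\<Phi>. \<phi> x = 0}"

lemma csubspace_vanishing: "csubspace (vanishing \<Phi>)"
  by (auto simp: vanishing_def cvec.subspace_def)

lemma vanishing_empty [simp]: "vanishing {} = UNIV"
  by (simp add: vanishing_def)

lemma vanishing_insert: "vanishing (insert \<phi> \<Phi>) = {x \<in> vanishing \<Phi>. \<phi> x = 0}"
  by (auto simp: vanishing_def)

lemma vanishing_Un: "vanishing (\<Phi> \<union> \<Psi>) = vanishing \<Phi> \<inter> vanishing \<Psi>"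
  by (auto simp: vanishing_def)

lemma vanishing_compose: "vanishing ((\<lambda>\<phi>. \<phi> o\<^sub>C\<^sub>L S) ` \<Phi>) = {x. S x \<in> vanishing \<Phi>}"
  by (auto simp: vanishing_def)

lemma closed_vanishing: "closed (vanishing \<Phi>)"
proof -
  have "vanishing \<Phi> = (\<Inter>\<phi>\<in>\<Phi>. kernel \<phi>)"
    by (auto simp: vanishing_def kernel_def)
  then show ?thesis
    by (simp add: closed_INT closed_kernel)
qed

text \<open>Each functional costs at most one dimension. The relative version inside \<open>S\<close> yields two things: for
  \<open>S = UNIV\<close> the finite codimension of the common kernel, and for \<open>S\<close> meeting it only in \<open>0\<close> that \<open>S\<close> is
  finite-dimensional. The clause on the empty set transports the exact case.\<close>

lemma vanishing_finite_codim:
  assumes S: "csubspace S" and "finite \<Phi>"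
  shows "\<exists>F. finite F \<and> F \<subseteq> S \<and> (\<Phi> = {} \<longrightarrow> F = {}) \<and>
    (\<forall>x\<in>S. \<exists>z\<in>cspan F. x - z \<in> S \<inter> vanishing \<Phi>)"
  using \<open>finite \<Phi>\<close>
proof induction
  case empty
  then show ?case
    by (intro exI [of _ "{}"]) auto
next
  case (insert \<phi> \<Phi>)
  then obtain F where F: "finite F" "F \<subseteq> S" "\<And>x. x \<in> S \<Longrightarrow> \<exists>z\<in>cspan F. x - z \<in> S \<inter> vanishing \<Phi>"
    by auto
  show ?case
  proof (cases "\<exists>e\<in>S \<inter> vanishing \<Phi>. \<phi> e \<noteq> 0")
    case False
    have "\<exists>z\<in>cspan F. x - z \<in> S \<inter> vanishing (insert \<phi> \<Phi>)" if "x \<in> S" for x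
      using F(3) [OF that] False unfolding vanishing_insert by blast
    then show ?thesis
      using F by (intro exI [of _ F]) auto
  next
    case True
    then obtain e where e: "e \<in> S \<inter> vanishing \<Phi>" "\<phi> e \<noteq> 0"
      by blast
    have "\<exists>z\<in>cspan (insert e F). x - z \<in> S \<inter> vanishing (insert \<phi> \<Phi>)" if x: "x \<in> S" for x
    proof -
      obtain z where z: "z \<in> cspan F" "x - z \<in> S \<inter> vanishing \<Phi>"
        using F(3) [OF x] by blast
      define c where "c = \<phi> (x - z) / \<phi> e"
      have "(x - z) - c *\<^sub>C e \<in> S \<inter> vanishing \<Phi>"
        using z(2) e(1) S csubspace_vanishing [of \<Phi>]
        by (auto intro!: cvec.subspace_diff cvec.subspace_scale)
      moreover have "\<phi> ((x - z) - c *\<^sub>C e) = 0"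
        using e(2) by (simp add: c_def)
      ultimately have "x - (z + c *\<^sub>C e) \<in> S \<inter> vanishing (insert \<phi> \<Phi>)"
        by (simp add: vanishing_insert algebra_simps)
      moreover have "z + c *\<^sub>C e \<in> cspan (insert e F)"
        using z(1) cvec.span_mono [of F "insert e F"]
        by (intro cvec.span_add cvec.span_scale) (auto intro: cvec.span_base)
      ultimately show ?thesis
        by blast
    qed
    then show ?thesis
      using F e(1) by (intro exI [of _ "insert e F"]) auto
  qed
qed

text \<open>A functional on the quotient by a space of finite codimension is a combination of the given
  ones. This is what identifies the range of the dual operator up to finite dimension.\<close>

lemma functional_in_cspan:
  fixes \<psi> :: "'a::complex_normed_vector \<Rightarrow>\<^sub>C\<^sub>L complex"
  assumes "finite \<Phi>" and "\<And>x. x \<in> vanishing \<Phi> \<Longrightarrow> \<psi> x = 0"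
  shows "\<psi> \<in> cspan \<Phi>"
  using assms
proof (induction arbitrary: \<psi>)
  case empty
  then have "\<psi> = 0"
    by (intro cblinfun_eqI) simp
  then show ?case
    by simp
next
  case (insert \<phi> \<Phi>)
  show ?case
  proof (cases "\<exists>e\<in>vanishing \<Phi>. \<phi> e \<noteq> 0")
    case False
    then have "\<psi> \<in> cspan \<Phi>"
      using insert.prems by (intro insert.IH) (auto simp: vanishing_insert)
    then show ?thesis
      using cvec.span_mono [of \<Phi> "insert \<phi> \<Phi>"] by auto
  next
    case True
    then obtain e where e: "e \<in> vanishing \<Phi>" "\<phi> e \<noteq> 0"
      by blast
    define c where "c = \<psi> e / \<phi> e"
    have "(\<psi> - c *\<^sub>C \<phi>) x = 0" if "x \<in> vanishing \<Phi>" for x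
    proof -
      have "x - (\<phi> x / \<phi> e) *\<^sub>C e \<in> vanishing (insert \<phi> \<Phi>)"
        using that e by (auto simp: vanishing_def)
      from insert.prems [OF this] show ?thesis
        using e by (simp add: c_def field_simps)
    qed
    then have "\<psi> - c *\<^sub>C \<phi> \<in> cspan \<Phi>"
      by (rule insert.IH)
    then show ?thesis
      by (auto simp: cvec.span_breakdown_eq)
  qed
qed

lemma vanishing_cspan: "\<phi> \<in> cspan \<Phi> \<Longrightarrow> x \<in> vanishing \<Phi> \<Longrightarrow> \<phi> x = 0"
  by (induction rule: cvec.span_induct_alt) (auto simp: vanishing_def)

section \<open>The open mapping theorem on closed subspaces\<close>

text \<open>The Baire part of the open mapping theorem: the closures of the images of the balls of radius \<open>n\<close>
  cover the closed range, so one of them contains a relative ball, and differences move the ball to the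
  origin.\<close>

lemma approximate_preimages:
  fixes T :: "'a::cbanach \<Rightarrow>\<^sub>C\<^sub>L 'b::cbanach"
  assumes D: "csubspace D" and R: "closed (cblinfun_apply T ` D)"
  obtains K where "K \<ge> 0"
    "\<And>y. y \<in> cblinfun_apply T ` D \<Longrightarrow> \<exists>x\<in>D. norm x \<le> K * norm y \<and> norm (y - T x) \<le> norm y / 2"
proof -
  let ?R = "cblinfun_apply T ` D"
  define C where "C n = closure (cblinfun_apply T ` (D \<inter> cball 0 (real n)))" for n
  have subR: "csubspace ?R"
    by (rule csubspace_image [OF D])
  have CR: "C n \<subseteq> ?R" for n
    unfolding C_def using R by (intro closure_minimal) auto
  have union: "\<Union>(range C) = ?R"
  proof
    show "?R \<subseteq> \<Union>(range C)"
    proof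
      fix y assume "y \<in> ?R"
      then obtain x where x: "x \<in> D" "y = T x"
        by blast
      obtain n where "norm x \<le> real n"
        using real_arch_simple by blast
      then have "y \<in> C n"
        unfolding C_def using x by (intro closure_subset [THEN subsetD]) auto
      then show "y \<in> \<Union>(range C)"
        by blast
    qed
  qed (use CR in blast)
  have "\<exists>n. (top_of_set ?R) interior_of (C n) \<noteq> {}"
  proof (rule ccontr)
    assume "\<not> ?thesis"
    then have "(top_of_set ?R) interior_of \<Union>(range C) = {}"
      using CR completely_metrizable_space_closedin [OF completely_metrizable_space_euclidean] R
      by (intro Baire_category_alt disjI1) (auto simp: C_def closed_subset)
    then show False
      using cvec.subspace_0 [OF subR] interior_of_topspace [of "top_of_set ?R"] by (auto simp: union)
  qed
  then obtain n W y0 where W: "openin (top_of_set ?R) W" "W \<subseteq> C n" "y0 \<in> W"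
    unfolding interior_of_def by blast
  then obtain \<epsilon> where \<epsilon>: "\<epsilon> > 0" "ball y0 \<epsilon> \<inter> ?R \<subseteq> C n"
    by (metis openin_contains_ball order_trans)
  have y0: "y0 \<in> ?R"
    using W CR by blast
  have small: "\<exists>x\<in>D. norm x \<le> 2 * real n \<and> norm (y - T x) < 2 * \<delta>"
    if y: "y \<in> ?R" "norm y < \<epsilon>" and \<delta>: "\<delta> > 0" for y \<delta>
  proof -
    have "y0 + y \<in> C n" "y0 \<in> C n"
      using \<epsilon>(1) y y0 cvec.subspace_add [OF subR y0 y(1)]
      by (intro subsetD [OF \<epsilon>(2)] IntI; simp add: dist_norm)+
    then obtain x1 x2 where x: "x1 \<in> D" "norm x1 \<le> real n" "dist (T x1) y0 < \<delta>"
        "x2 \<in> D" "norm x2 \<le> real n" "dist (T x2) (y0 + y) < \<delta>"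
      unfolding C_def closure_approachable using \<delta> by fastforce
    have "norm (x2 - x1) \<le> 2 * real n"
      using norm_triangle_ineq4 [of x2 x1] x by linarith
    moreover have "norm (y - T (x2 - x1)) < 2 * \<delta>"
      using norm_triangle_ineq4 [of "T x1 - y0" "T x2 - (y0 + y)"] x
      by (simp add: dist_norm algebra_simps)
    ultimately show ?thesis
      using cvec.subspace_diff [OF D x(4,1)] by blast
  qed
  show ?thesis
  proof (rule that [of "4 * real n / \<epsilon>"])
    show "0 \<le> 4 * real n / \<epsilon>"
      using \<epsilon> by simp
    fix y assume y: "y \<in> ?R"
    show "\<exists>x\<in>D. norm x \<le> 4 * real n / \<epsilon> * norm y \<and> norm (y - T x) \<le> norm y / 2"
    proof (cases "y = 0")
      case True
      then show ?thesis
        using cvec.subspace_0 [OF D] by (intro bexI [of _ 0]) auto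
    next
      case False
      \<comment> \<open>Scaling by \<open>1 / s\<close> gives norm \<open>\<epsilon> / 2\<close>; precision \<open>\<epsilon> / 4\<close> scales back to half the norm of \<open>y\<close>.\<close>
      define s where "s = 2 * norm y / \<epsilon>"
      have s: "s > 0"
        using False \<epsilon> by (simp add: s_def)
      have "norm ((1 / s) *\<^sub>R y) < \<epsilon>"
        using False \<epsilon>(1) s by (simp add: s_def)
      moreover have "(1 / s) *\<^sub>R y \<in> ?R"
        unfolding scaleR_scaleC by (rule cvec.subspace_scale [OF subR y])
      ultimately obtain x where
        x: "x \<in> D" "norm x \<le> 2 * real n" "norm ((1 / s) *\<^sub>R y - T x) < \<epsilon> / 4"
        using small [of "(1 / s) *\<^sub>R y" "\<epsilon> / 8"] \<epsilon>(1) by auto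
      have "norm (s *\<^sub>R x) \<le> 4 * real n / \<epsilon> * norm y"
        using mult_left_mono [OF x(2), of s] s \<epsilon>(1) by (simp add: s_def field_simps)
      moreover have "norm (y - T (s *\<^sub>R x)) \<le> norm y / 2"
      proof -
        have "y - T (s *\<^sub>R x) = s *\<^sub>R ((1 / s) *\<^sub>R y - T x)"
          using s by (simp add: cblinfun_scaleR scaleR_right_diff_distrib)
        then have "norm (y - T (s *\<^sub>R x)) = s * norm ((1 / s) *\<^sub>R y - T x)"
          using s by simp
        also have "\<dots> \<le> s * (\<epsilon> / 4)"
          using x(3) s by (intro mult_left_mono) auto
        finally show ?thesis
          using \<epsilon> by (simp add: s_def)
      qed
      moreover have "s *\<^sub>R x \<in> D"
        using D x(1) by (simp add: scaleR_scaleC cvec.subspace_scale)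
      ultimately show ?thesis
        by blast
    qed
  qed
qed

text \<open>Approximate preimages are summed up: the remainders shrink geometrically. The version on a closed
  subspace \<open>D\<close> avoids forming quotient spaces and subspace types.\<close>

theorem open_mapping_closed_range:
  fixes T :: "'a::cbanach \<Rightarrow>\<^sub>C\<^sub>L 'b::cbanach"
  assumes D: "csubspace D" "closed D" and R: "closed (cblinfun_apply T ` D)"
  obtains K where "K \<ge> 0"
    "\<And>y. y \<in> cblinfun_apply T ` D \<Longrightarrow> \<exists>x\<in>D. T x = y \<and> norm x \<le> K * norm y"
proof -
  let ?R = "cblinfun_apply T ` D"
  obtain K where K: "K \<ge> 0"
    and approx: "\<And>y. y \<in> ?R \<Longrightarrow> \<exists>x\<in>D. norm x \<le> K * norm y \<and> norm (y - T x) \<le> norm y / 2"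
    using approximate_preimages [OF D(1) R] by blast
  then obtain h where h: "\<And>y. y \<in> ?R \<Longrightarrow> h y \<in> D" "\<And>y. y \<in> ?R \<Longrightarrow> norm (h y) \<le> K * norm y"
      "\<And>y. y \<in> ?R \<Longrightarrow> norm (y - T (h y)) \<le> norm y / 2"
    by metis
  have "\<exists>x\<in>D. T x = y \<and> norm x \<le> (2 * K) * norm y" if y: "y \<in> ?R" for y
  proof -
    define r where "r k = ((\<lambda>v. v - T (h v)) ^^ k) y" for k
    have r_Suc: "r (Suc k) = r k - T (h (r k))" and r_0: "r 0 = y" for k
      by (simp_all add: r_def)
    have rR: "r k \<in> ?R" for k
    proof (induction k)
      case 0
      then show ?case
        using y by (simp add: r_0)
    next
      case (Suc k)
      then obtain x where "x \<in> D" "r k = T x"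
        by blast
      then show ?case
        using h(1) [OF Suc] cvec.subspace_diff [OF D(1), of x "h (r k)"]
        by (auto simp: r_Suc intro!: image_eqI [of _ _ "x - h (r k)"])
    qed
    have r_le: "norm (r k) \<le> norm y * (1/2) ^ k" for k
    proof (induction k)
      case (Suc k)
      then show ?case
        using h(3) [OF rR [of k]] by (simp add: r_Suc)
    qed (simp add: r_0)
    have h_le: "norm (h (r k)) \<le> (K * norm y) * (1/2) ^ k" for k
      using order_trans [OF h(2) [OF rR] mult_left_mono [OF r_le K]] by (simp add: mult.assoc)
    have geo: "summable (\<lambda>k. (K * norm y) * (1/2::real) ^ k)"
      by (intro summable_mult summable_geometric) simp
    have sn: "summable (\<lambda>k. norm (h (r k)))"
      by (rule summable_comparison_test' [OF geo, of 0]) (use h_le in simp)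
    define x where "x = (\<Sum>k. h (r k))"
    have lim: "(\<lambda>n. \<Sum>k<n. h (r k)) \<longlonglongrightarrow> x"
      unfolding x_def by (rule summable_LIMSEQ [OF summable_norm_cancel [OF sn]])
    have "x \<in> D"
      by (rule closed_sequentially [OF D(2) _ lim]) (use h(1) rR D(1) in \<open>auto intro: cvec.subspace_sum\<close>)
    moreover have "T x = y"
    proof (rule LIMSEQ_unique)
      show "(\<lambda>n. T (\<Sum>k<n. h (r k))) \<longlonglongrightarrow> T x"
        by (intro tendsto_intros lim)
      have "T (\<Sum>k<n. h (r k)) = y - r n" for n
        by (induction n) (simp_all add: r_0 r_Suc)
      moreover have "r \<longlonglongrightarrow> 0"
      proof (rule Lim_null_comparison)
        show "\<forall>\<^sub>F k in sequentially. norm (r k) \<le> norm y * (1/2) ^ k"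
          using r_le by simp
        show "(\<lambda>k. norm y * (1/2) ^ k) \<longlonglongrightarrow> 0"
          by (intro tendsto_mult_right_zero LIMSEQ_realpow_zero) auto
      qed
      ultimately show "(\<lambda>n. T (\<Sum>k<n. h (r k))) \<longlonglongrightarrow> y"
        using tendsto_diff [OF tendsto_const] by fastforce
    qed
    moreover have "norm x \<le> (\<Sum>k. (K * norm y) * (1/2) ^ k)"
      unfolding x_def by (rule order_trans [OF summable_norm [OF sn] suminf_le [OF h_le sn geo]])
    then have "norm x \<le> (2 * K) * norm y"
      by (simp add: suminf_mult suminf_geometric)
    ultimately show ?thesis
      by blast
  qed
  then show ?thesis
    using K by (intro that [of "2 * K"]) auto
qed

text \<open>A quantitative form of \<open>T(N) + Z = UNIV\<close>: the open mapping theorem for the operator that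
  sends \<open>(x, z)\<close> to \<open>T x + z\<close> on \<open>N \<times> Z\<close>.\<close>

lemma sum_onto_bounded:
  fixes T :: "'a::cbanach \<Rightarrow>\<^sub>C\<^sub>L 'b::cbanach"
  assumes N: "csubspace N" "closed N" and Z: "csubspace Z" "closed Z"
    and onto: "\<And>y. \<exists>x\<in>N. \<exists>z\<in>Z. y = T x + z"
  shows "\<exists>K\<ge>0. \<forall>y. \<exists>x\<in>N. \<exists>z\<in>Z. y = T x + z \<and> norm x \<le> K * norm y \<and> norm z \<le> K * norm y"
proof -
  let ?U = "(T o\<^sub>C\<^sub>L fst_op) + snd_op"
  have range: "cblinfun_apply ?U ` (N \<times> Z) = UNIV"
    using onto by (force simp: image_iff)
  have "csubspace (N \<times> Z)"
    using N Z by (auto simp: cvec.subspace_def zero_prod_def)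
  moreover have "closed (N \<times> Z)"
    using N Z by (simp add: closed_Times)
  moreover have "closed (cblinfun_apply ?U ` (N \<times> Z))"
    unfolding range by simp
  ultimately obtain K where K: "K \<ge> 0"
      "\<And>y. y \<in> cblinfun_apply ?U ` (N \<times> Z) \<Longrightarrow> \<exists>p\<in>N \<times> Z. ?U p = y \<and> norm p \<le> K * norm y"
    by (rule open_mapping_closed_range) blast
  have "\<exists>x\<in>N. \<exists>z\<in>Z. y = T x + z \<and> norm x \<le> K * norm y \<and> norm z \<le> K * norm y" for y
  proof -
    obtain p where p: "p \<in> N \<times> Z" "?U p = y" "norm p \<le> K * norm y"
      using K(2) [of y] unfolding range by blast
    then show ?thesis
      using norm_fst_le [of "fst p" "snd p"] norm_snd_le [of "snd p" "fst p"]
      by (intro bexI [of _ "fst p"] bexI [of _ "snd p"]) (auto simp: mem_Times_iff)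
  qed
  then show ?thesis
    using K(1) by blast
qed

section \<open>Vector-valued analytic functions\<close>

lemma vec_analytic_on_subset: "vec_analytic_on f V \<Longrightarrow> W \<subseteq> V \<Longrightarrow> vec_analytic_on f W"
  by (auto simp: vec_analytic_on_def)

lemma vec_analytic_on_tendsto:
  assumes "vec_analytic_on f V" and "z \<in> V"
  shows "(f \<longlongrightarrow> f z) (at z)"
proof -
  obtain d where d: "((\<lambda>w. inverse (w - z) *\<^sub>C (f w - f z)) \<longlongrightarrow> d) (at z)"
    using assms by (auto simp: vec_analytic_on_def)
  have "((\<lambda>w. f z + (w - z) *\<^sub>C (inverse (w - z) *\<^sub>C (f w - f z))) \<longlongrightarrow> f z + (z - z) *\<^sub>C d) (at z)"
    by (intro tendsto_intros d)
  moreover have "\<forall>\<^sub>F w in at z. f z + (w - z) *\<^sub>C (inverse (w - z) *\<^sub>C (f w - f z)) = f w"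
    by (simp add: eventually_at_filter)
  ultimately show ?thesis
    using tendsto_cong [of "\<lambda>w. f z + (w - z) *\<^sub>C (inverse (w - z) *\<^sub>C (f w - f z))" f] by simp
qed

lemma vec_analytic_on_continuous:
  assumes "vec_analytic_on f V"
  shows "continuous_on V f"
  unfolding continuous_on_def
  using vec_analytic_on_tendsto [OF assms] tendsto_within_subset by blast

lemma vec_analytic_on_ident: "vec_analytic_on (\<lambda>\<mu>. \<mu>) V"
  unfolding vec_analytic_on_def
proof
  fix z :: complex
  have "((\<lambda>w. inverse (w - z) * (w - z)) \<longlongrightarrow> 1) (at z)"
    by (rule tendsto_eventually) (simp add: eventually_at_filter)
  then show "\<exists>d. ((\<lambda>w. inverse (w - z) *\<^sub>C (w - z)) \<longlongrightarrow> d) (at z)"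
    by auto
qed

lemma vec_analytic_on_cblinfun:
  fixes S :: "'a::complex_normed_vector \<Rightarrow>\<^sub>C\<^sub>L 'b::complex_normed_vector"
  assumes "vec_analytic_on f V"
  shows "vec_analytic_on (\<lambda>\<mu>. S (f \<mu>)) V"
  unfolding vec_analytic_on_def
proof
  fix z assume "z \<in> V"
  then obtain d where "((\<lambda>w. inverse (w - z) *\<^sub>C (f w - f z)) \<longlongrightarrow> d) (at z)"
    using assms by (auto simp: vec_analytic_on_def)
  then have "((\<lambda>w. S (inverse (w - z) *\<^sub>C (f w - f z))) \<longlongrightarrow> S d) (at z)"
    by (rule cblinfun_tendsto)
  then show "\<exists>d. ((\<lambda>w. inverse (w - z) *\<^sub>C (S (f w) - S (f z))) \<longlongrightarrow> d) (at z)"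
    by auto
qed

lemma vec_analytic_on_diff:
  assumes "vec_analytic_on f V" and "vec_analytic_on g V"
  shows "vec_analytic_on (\<lambda>\<mu>. f \<mu> - g \<mu>) V"
  unfolding vec_analytic_on_def
proof
  fix z assume "z \<in> V"
  then obtain d e where "((\<lambda>w. inverse (w - z) *\<^sub>C (f w - f z)) \<longlongrightarrow> d) (at z)"
      "((\<lambda>w. inverse (w - z) *\<^sub>C (g w - g z)) \<longlongrightarrow> e) (at z)"
    using assms by (fastforce simp: vec_analytic_on_def)
  from tendsto_diff [OF this]
  show "\<exists>d. ((\<lambda>w. inverse (w - z) *\<^sub>C (f w - g w - (f z - g z))) \<longlongrightarrow> d) (at z)"
    by (auto simp: scaleC_diff_right algebra_simps)
qed

text \<open>The product rule; it makes the elimination of coordinates below stay within analytic functions.\<close>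

lemma vec_analytic_on_scaleC:
  fixes f :: "complex \<Rightarrow> 'a::complex_normed_vector"
  assumes h: "vec_analytic_on h V" and f: "vec_analytic_on f V"
  shows "vec_analytic_on (\<lambda>\<mu>. h \<mu> *\<^sub>C f \<mu>) V"
  unfolding vec_analytic_on_def
proof
  fix z assume z: "z \<in> V"
  obtain d where d: "((\<lambda>w. inverse (w - z) *\<^sub>C (h w - h z)) \<longlongrightarrow> d) (at z)"
    using h z by (auto simp: vec_analytic_on_def)
  obtain e where e: "((\<lambda>w. inverse (w - z) *\<^sub>C (f w - f z)) \<longlongrightarrow> e) (at z)"
    using f z by (auto simp: vec_analytic_on_def)
  have "((\<lambda>w. (inverse (w - z) *\<^sub>C (h w - h z)) *\<^sub>C f w + h z *\<^sub>C (inverse (w - z) *\<^sub>C (f w - f z)))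
      \<longlongrightarrow> d *\<^sub>C f z + h z *\<^sub>C e) (at z)"
    by (intro tendsto_intros d e vec_analytic_on_tendsto [OF f z])
  moreover have "(inverse (w - z) *\<^sub>C (h w - h z)) *\<^sub>C f w + h z *\<^sub>C (inverse (w - z) *\<^sub>C (f w - f z))
      = inverse (w - z) *\<^sub>C (h w *\<^sub>C f w - h z *\<^sub>C f z)" for w
    by (simp add: scaleC_diff_right scaleC_diff_left right_diff_distrib mult.commute)
  ultimately show "\<exists>d. ((\<lambda>w. inverse (w - z) *\<^sub>C (h w *\<^sub>C f w - h z *\<^sub>C f z)) \<longlongrightarrow> d) (at z)"
    by auto
qed

text \<open>The first two termwise derivatives of the geometric series, which majorise the difference
  quotients of a power series.\<close>

lemma summable_diffs_geometric:
  fixes q :: real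
  assumes "0 \<le> q" "q < 1"
  shows "summable (\<lambda>k. real k * q ^ (k - 1))" and "summable (\<lambda>k. real k * real (k - 1) * q ^ (k - 2))"
proof -
  have 0: "summable (\<lambda>n. 1 * x ^ n)" if "norm x < 1" for x :: real
    using that by (simp add: summable_geometric)
  have 1: "summable (\<lambda>n. diffs (\<lambda>_. 1) n * x ^ n)" if "norm x < 1" for x :: real
    by (rule termdiff_converges [OF that 0])
  have 2: "summable (\<lambda>n. diffs (diffs (\<lambda>_. 1)) n * x ^ n)" if "norm x < 1" for x :: real
    by (rule termdiff_converges [OF that 1])
  have "summable (\<lambda>n. real (n + 1) * q ^ (n + 1 - 1))"
    using 1 [of q] assms by (simp add: diffs_def)
  then show "summable (\<lambda>k. real k * q ^ (k - 1))"
    by (subst (asm) summable_iff_shift)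
  have "summable (\<lambda>n. real (n + 2) * real (n + 2 - 1) * q ^ (n + 2 - 2))"
    using 2 [of q] assms by (simp add: diffs_def algebra_simps)
  then show "summable (\<lambda>k. real k * real (k - 1) * q ^ (k - 2))"
    by (subst (asm) summable_iff_shift)
qed

lemma power_series_summable:
  fixes x :: "nat \<Rightarrow> 'a::cbanach" and z :: complex
  assumes x: "\<And>k. norm (x k) \<le> M * c ^ k" and c: "c > 0" and z: "cmod z < 1 / c"
  shows "summable (\<lambda>k. z ^ k *\<^sub>C x k)"
proof (rule summable_comparison_test' [of _ 0])
  show "summable (\<lambda>k. M * (cmod z * c) ^ k)"
    using c z by (intro summable_mult summable_geometric) (simp add: field_simps)
  show "norm (z ^ k *\<^sub>C x k) \<le> M * (cmod z * c) ^ k" for k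
    using mult_left_mono [OF x [of k], of "cmod z ^ k"]
    by (simp add: norm_power power_mult_distrib mult_ac)
qed

text \<open>The usual proof of termwise differentiation, with vector coefficients.\<close>

lemma power_series_analytic:
  fixes x :: "nat \<Rightarrow> 'a::cbanach"
  assumes x: "\<And>k. norm (x k) \<le> M * c ^ k" and c: "c > 0"
  shows "vec_analytic_on (\<lambda>\<mu>. \<Sum>k. \<mu> ^ k *\<^sub>C x k) (ball 0 (1 / c))"
  unfolding vec_analytic_on_def
proof
  let ?f = "\<lambda>\<mu>. \<Sum>k. \<mu> ^ k *\<^sub>C x k"
  fix z :: complex assume "z \<in> ball 0 (1 / c)"
  then have z: "cmod z < 1 / c"
    by simp
  then obtain K where K: "cmod z < K" "K < 1 / c"
    using dense by blast
  then have K0: "K > 0"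
    using norm_ge_zero [of z] by linarith
  have Kc: "0 \<le> K * c" "K * c < 1"
    using K K0 c by (auto simp: field_simps)
  have M: "M \<ge> 0"
    using order_trans [OF norm_ge_zero x [of 0]] by simp
  let ?d = "\<lambda>k. (of_nat k * z ^ (k - 1)) *\<^sub>C x k"
  have sd: "summable ?d"
  proof (rule summable_comparison_test' [of _ 0])
    show "summable (\<lambda>k. M * c * (real k * (K * c) ^ (k - 1)))"
      by (intro summable_mult summable_diffs_geometric Kc)
    fix k :: nat
    have "norm (?d k) \<le> (real k * K ^ (k - 1)) * (M * c ^ k)"
      using K K0 M c by (auto simp: norm_mult norm_power intro!: mult_mono power_mono x)
    also have "\<dots> = M * c * (real k * (K * c) ^ (k - 1))"
      by (cases k) (simp_all add: power_mult_distrib)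
    finally show "norm (?d k) \<le> M * c * (real k * (K * c) ^ (k - 1))" .
  qed
  let ?b = "\<lambda>k. M * c\<^sup>2 * (real k * real (k - 1) * (K * c) ^ (k - 2))"
  have sb: "summable ?b"
    by (intro summable_mult summable_diffs_geometric Kc)
  define b where "b = suminf ?b"
  \<comment> \<open>The remainder of the difference quotient is linear in \<open>w - z\<close>, uniformly for \<open>\<bar>w\<bar> < K\<close>.\<close>
  have le: "norm (inverse (w - z) *\<^sub>C (?f w - ?f z) - suminf ?d) \<le> cmod (w - z) * b"
    if w: "w \<noteq> z" "cmod w < K" for w
  proof -
    have wc: "cmod w < 1 / c"
      using w K by linarith
    have "(\<lambda>k. inverse (w - z) *\<^sub>C (w ^ k *\<^sub>C x k - z ^ k *\<^sub>C x k) - ?d k) sums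
        (inverse (w - z) *\<^sub>C (?f w - ?f z) - suminf ?d)"
      by (intro sums_diff bounded_linear.sums
          [OF bounded_bilinear.bounded_linear_right [OF bounded_bilinear_scaleC]]
          summable_sums power_series_summable [OF x c wc] power_series_summable [OF x c z] sd)
    then show ?thesis
    proof (rule norm_sums_le)
      show "(\<lambda>k. cmod (w - z) * ?b k) sums (cmod (w - z) * b)"
        unfolding b_def by (intro sums_mult summable_sums sb)
      fix k
      have "inverse (w - z) *\<^sub>C (w ^ k *\<^sub>C x k - z ^ k *\<^sub>C x k) - ?d k =
          ((w ^ k - z ^ k) / (w - z) - of_nat k * z ^ (k - 1)) *\<^sub>C x k"
        by (simp add: scaleC_diff_left [symmetric] divide_inverse mult.commute)
      moreover have "cmod ((w ^ k - z ^ k) / (w - z) - of_nat k * z ^ (k - 1)) \<le>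
          real k * real (k - 1) * K ^ (k - 2) * cmod (w - z)"
        using lemma_termdiff3 [of "w - z" z K k] w K by simp
      ultimately have "norm (inverse (w - z) *\<^sub>C (w ^ k *\<^sub>C x k - z ^ k *\<^sub>C x k) - ?d k) \<le>
          (real k * real (k - 1) * K ^ (k - 2) * cmod (w - z)) * (M * c ^ k)"
        using K0 by (auto intro!: mult_mono x)
      also have "\<dots> = cmod (w - z) * ?b k"
      proof -
        consider "k = 0" | "k = 1" | m where "k = m + 2"
          by (metis One_nat_def add_2_eq_Suc' not0_implies_Suc)
        then show ?thesis
          by cases (simp_all add: power_mult_distrib power_add power2_eq_square mult_ac)
      qed
      finally show "norm (inverse (w - z) *\<^sub>C (w ^ k *\<^sub>C x k - z ^ k *\<^sub>C x k) - ?d k) \<le> cmod (w - z) * ?b k" .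
    qed
  qed
  have "((\<lambda>w. inverse (w - z) *\<^sub>C (?f w - ?f z) - suminf ?d) \<longlongrightarrow> 0) (at z)"
  proof (rule Lim_null_comparison)
    have "\<forall>\<^sub>F w in at z. w \<in> ball 0 K"
      using K by (intro eventually_at_topological [THEN iffD2]) (auto intro!: exI [of _ "ball 0 K"])
    moreover have "\<forall>\<^sub>F w in at z. w \<noteq> z"
      by (simp add: eventually_at_filter)
    ultimately show "\<forall>\<^sub>F w in at z. norm (inverse (w - z) *\<^sub>C (?f w - ?f z) - suminf ?d) \<le> cmod (w - z) * b"
      by eventually_elim (use le in simp)
    have "((\<lambda>w. cmod (w - z) * b) \<longlongrightarrow> cmod (z - z) * b) (at z)"
      by (intro tendsto_intros)
    then show "((\<lambda>w. cmod (w - z) * b) \<longlongrightarrow> 0) (at z)"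
      by simp
  qed
  then show "\<exists>d. ((\<lambda>w. inverse (w - z) *\<^sub>C (?f w - ?f z)) \<longlongrightarrow> d) (at z)"
    using Lim_null by blast
qed

lemma closed_csubspace_sums:
  assumes S: "csubspace S" "closed S" and f: "\<And>k. f k \<in> S" and "f sums s"
  shows "s \<in> S"
  by (rule closed_sequentially [OF S(2) _ \<open>f sums s\<close> [unfolded sums_def]])
    (use f S(1) in \<open>auto intro: cvec.subspace_sum\<close>)

section \<open>The single valued extension property bounds the nullity\<close>

text \<open>Gaussian elimination with analytic coefficients. If \<open>b\<close> is the next vector of \<open>F\<close>, let \<open>h i\<close> be the
  \<open>b\<close>-coordinate of \<open>(T - \<mu>) (g i \<mu>)\<close>. Where some \<open>h j\<close> has no zero, \<open>h j g i - h i g j\<close> for \<open>i \<noteq> j\<close> no longer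
  has a \<open>b\<close>-coordinate. One function and one vector of \<open>F\<close> are spent in each step, hence a function is left
  at the end. Multiplying through by \<open>h j\<close> avoids quotients of analytic functions, and pointwise linear
  independence survives because \<open>h j\<close> has no zero on the smaller open set.\<close>

lemma eigenvector_elimination:
  fixes T :: "'a::cbanach \<Rightarrow>\<^sub>C\<^sub>L 'a" and g :: "'i \<Rightarrow> complex \<Rightarrow> 'a"
  assumes "finite F" and "finite G" and "card F < card G" and "open V" and "V \<noteq> {}"
    and "\<And>i. i \<in> G \<Longrightarrow> vec_analytic_on (g i) V"
    and "\<And>\<mu> c. \<mu> \<in> V \<Longrightarrow> (\<Sum>i\<in>G. c i *\<^sub>C g i \<mu>) = 0 \<Longrightarrow> \<forall>i\<in>G. c i = 0"
    and "\<And>i \<mu>. i \<in> G \<Longrightarrow> \<mu> \<in> V \<Longrightarrow> T (g i \<mu>) - \<mu> *\<^sub>C g i \<mu> \<in> cspan F"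
  shows "\<exists>W f. open W \<and> W \<noteq> {} \<and> W \<subseteq> V \<and> vec_analytic_on f W \<and>
    (\<forall>\<mu>\<in>W. f \<mu> \<noteq> 0 \<and> T (f \<mu>) - \<mu> *\<^sub>C f \<mu> = 0)"
  using assms
proof (induction F arbitrary: G V g)
  case empty
  then obtain i where i: "i \<in> G"
    by fastforce
  have "g i \<mu> \<noteq> 0" if \<mu>: "\<mu> \<in> V" for \<mu>
  proof
    assume "g i \<mu> = 0"
    then have "(\<Sum>j\<in>G. (if j = i then 1 else 0) *\<^sub>C g j \<mu>) = 0"
      by (intro sum.neutral) auto
    from empty.prems(6) [OF \<mu> this] i show False
      by auto
  qed
  then show ?case
    using empty.prems i by (intro exI [of _ V] exI [of _ "g i"]) auto
next
  case (insert b F)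
  note analytic = insert.prems(5) and indep = insert.prems(6) and mem = insert.prems(7)
  have card: "card F < card G"
    using insert by simp
  show ?case
  proof (cases "b \<in> cspan F")
    case True
    then have "T (g i \<mu>) - \<mu> *\<^sub>C g i \<mu> \<in> cspan F" if "i \<in> G" "\<mu> \<in> V" for i \<mu>
      using mem [OF that] by (simp add: cvec.span_redundant)
    then show ?thesis
      by (intro insert.IH [OF insert.prems(1) card insert.prems(3,4) analytic indep])
  next
    case False
    then obtain \<phi> :: "'a \<Rightarrow>\<^sub>C\<^sub>L complex" where \<phi>: "\<phi> b = 1" "\<And>x. x \<in> cspan F \<Longrightarrow> \<phi> x = 0"
      using closed_subspace_separation [OF cvec.subspace_span closed_cspan_finite [OF insert.hyps(1)]]
      by metis
    have in_F: "x \<in> cspan F" if x: "x \<in> cspan (insert b F)" "\<phi> x = 0" for x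
    proof -
      obtain k where k: "x - k *\<^sub>C b \<in> cspan F"
        using x(1) by (auto simp: cvec.span_breakdown_eq)
      from \<phi>(2) [OF this] have "k = 0"
        using x(2) \<phi>(1) by simp
      then show ?thesis
        using k by simp
    qed
    define e where "e i \<mu> = T (g i \<mu>) - \<mu> *\<^sub>C g i \<mu>" for i \<mu>
    define h where "h i \<mu> = \<phi> (e i \<mu>)" for i \<mu>
    have h_analytic: "vec_analytic_on (h i) V" if "i \<in> G" for i
      unfolding h_def e_def
      by (intro vec_analytic_on_cblinfun vec_analytic_on_diff vec_analytic_on_scaleC
          vec_analytic_on_ident analytic that)
    show ?thesis
    proof (cases "\<forall>i\<in>G. \<forall>\<mu>\<in>V. h i \<mu> = 0")
      case True
      then have "T (g i \<mu>) - \<mu> *\<^sub>C g i \<mu> \<in> cspan F" if "i \<in> G" "\<mu> \<in> V" for i \<mu>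
        using in_F [OF mem [OF that]] that by (simp add: h_def e_def)
      then show ?thesis
        by (intro insert.IH [OF insert.prems(1) card insert.prems(3,4) analytic indep])
    next
      case False
      then obtain j \<mu>0 where j: "j \<in> G" and \<mu>0: "\<mu>0 \<in> V" "h j \<mu>0 \<noteq> 0"
        by blast
      define V' where "V' = V \<inter> h j -` (- {0})"
      define G' where "G' = G - {j}"
      define g' where "g' i \<mu> = h j \<mu> *\<^sub>C g i \<mu> - h i \<mu> *\<^sub>C g j \<mu>" for i \<mu>
      have V': "V' \<subseteq> V" "open V'" "V' \<noteq> {}"
        using \<mu>0 insert.prems(3) unfolding V'_def
        by (auto intro!: continuous_open_preimage vec_analytic_on_continuous h_analytic j)
      have G': "finite G'" "card F < card G'" "G' \<subseteq> G"
        using insert.prems(1,2) insert.hyps j by (auto simp: G'_def)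
      have analytic': "vec_analytic_on (g' i) V'" if "i \<in> G'" for i
        unfolding g'_def using that G'(3)
        by (intro vec_analytic_on_diff vec_analytic_on_scaleC vec_analytic_on_subset [OF _ V'(1)]
            analytic h_analytic j) auto
      have indep': "\<forall>i\<in>G'. c i = 0" if \<mu>: "\<mu> \<in> V'" and c: "(\<Sum>i\<in>G'. c i *\<^sub>C g' i \<mu>) = 0" for \<mu> c
      proof -
        \<comment> \<open>A relation among the new functions is a relation among the old ones with these coefficients.\<close>
        define c' where "c' i = (if i = j then - (\<Sum>k\<in>G'. c k * h k \<mu>) else c i * h j \<mu>)" for i
        have "(\<Sum>i\<in>G. c' i *\<^sub>C g i \<mu>) = c' j *\<^sub>C g j \<mu> + (\<Sum>i\<in>G'. c' i *\<^sub>C g i \<mu>)"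
          unfolding G'_def using insert.prems(1) j by (rule sum.remove)
        also have "(\<Sum>i\<in>G'. c' i *\<^sub>C g i \<mu>) = (\<Sum>i\<in>G'. (c i * h j \<mu>) *\<^sub>C g i \<mu>)"
          by (intro sum.cong) (auto simp: c'_def G'_def)
        also have "c' j *\<^sub>C g j \<mu> = - (\<Sum>i\<in>G'. (c i * h i \<mu>) *\<^sub>C g j \<mu>)"
          by (simp add: c'_def cvec.scale_sum_left)
        also have "- (\<Sum>i\<in>G'. (c i * h i \<mu>) *\<^sub>C g j \<mu>) + (\<Sum>i\<in>G'. (c i * h j \<mu>) *\<^sub>C g i \<mu>)
            = (\<Sum>i\<in>G'. c i *\<^sub>C g' i \<mu>)"
          by (simp add: g'_def scaleC_diff_right sum_subtractf)
        finally have "\<forall>i\<in>G. c' i = 0"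
          using c \<mu> V'(1) by (intro indep) auto
        then have "\<forall>i\<in>G'. c i * h j \<mu> = 0"
          by (metis Diff_iff G'_def c'_def insertI1)
        then show ?thesis
          using \<mu> by (auto simp: V'_def)
      qed
      have mem': "T (g' i \<mu>) - \<mu> *\<^sub>C g' i \<mu> \<in> cspan F" if i: "i \<in> G'" and \<mu>: "\<mu> \<in> V'" for i \<mu>
      proof -
        have "T (g' i \<mu>) - \<mu> *\<^sub>C g' i \<mu> = h j \<mu> *\<^sub>C e i \<mu> - h i \<mu> *\<^sub>C e j \<mu>"
          by (simp add: g'_def e_def scaleC_diff_right mult.commute)
        moreover have "e i \<mu> \<in> cspan (insert b F)" "e j \<mu> \<in> cspan (insert b F)"
          using mem i j \<mu> V'(1) G'(3) by (auto simp: e_def)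
        then have "h j \<mu> *\<^sub>C e i \<mu> - h i \<mu> *\<^sub>C e j \<mu> \<in> cspan F"
          by (intro in_F cvec.span_diff cvec.span_scale) (simp_all add: h_def)
        ultimately show ?thesis
          by simp
      qed
      have "\<exists>W f. open W \<and> W \<noteq> {} \<and> W \<subseteq> V' \<and> vec_analytic_on f W \<and>
          (\<forall>\<mu>\<in>W. f \<mu> \<noteq> 0 \<and> T (f \<mu>) - \<mu> *\<^sub>C f \<mu> = 0)"
        by (rule insert.IH [OF G'(1,2) V'(2,3) analytic' indep' mem'])
      then show ?thesis
        using V'(1) by (meson order_trans)
    qed
  qed
qed

text \<open>For surjective operators (\<open>F\<close> empty) this is the fact that the SVEP at \<open>0\<close> implies injectivity.
  Finite-dimensional defects are absorbed by allowing more kernel vectors than defects.\<close>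

theorem SVEP_imp_nullity_le_deficiency:
  fixes T :: "'a::cbanach \<Rightarrow>\<^sub>C\<^sub>L 'a"
  assumes F: "finite F" "\<And>x. \<exists>z\<in>cspan F. x - z \<in> op_range T"
    and G: "finite G" "G \<subseteq> kernel T" "\<not> cvec.dependent G"
    and svep: "SVEP_at T 0"
  shows "card G \<le> card F"
proof (rule ccontr)
  assume "\<not> ?thesis"
  then have card: "card F < card G"
    by simp
  have onto: "\<exists>x\<in>UNIV. \<exists>z\<in>cspan F. y = T x + z" for y
  proof -
    obtain z x where "z \<in> cspan F" "y - z = T x"
      using F(2) [of y] by (auto simp: op_range_def)
    then show ?thesis
      by (auto simp: algebra_simps)
  qed
  obtain K where K: "K \<ge> 0"
      "\<forall>y. \<exists>x\<in>UNIV. \<exists>z\<in>cspan F. y = T x + z \<and> norm x \<le> K * norm y \<and> norm z \<le> K * norm y"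
    using sum_onto_bounded [OF cvec.subspace_UNIV closed_UNIV cvec.subspace_span closed_cspan_finite [OF F(1)] onto]
    by (elim exE conjE)
  obtain \<phi> :: "'a \<Rightarrow> 'a \<Rightarrow>\<^sub>C\<^sub>L complex"
    where \<phi>: "\<And>b b'. b \<in> G \<Longrightarrow> b' \<in> G \<Longrightarrow> \<phi> b b' = (if b = b' then 1 else 0)"
    using dual_functionals [OF G(1,3)] by metis
  define L where "L = 1 + (\<Sum>b\<in>G. norm (\<phi> b) * norm b)"
  define c where "c = K * L + 1"
  have L: "L \<ge> 0"
    unfolding L_def by (intro add_nonneg_nonneg sum_nonneg) auto
  have c: "c > 0"
    using K(1) L by (simp add: c_def add_nonneg_pos)
  \<comment> \<open>A preimage can be corrected by the kernel vectors in \<open>G\<close> so that all the functionals dual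
    to \<open>G\<close> vanish on it.\<close>
  have "\<exists>x. (\<forall>b\<in>G. \<phi> b x = 0) \<and> T x - y \<in> cspan F \<and> norm x \<le> c * norm y" for y
  proof -
    obtain x z where x: "z \<in> cspan F" "y = T x + z" "norm x \<le> K * norm y"
      using K(2) by blast
    let ?p = "\<Sum>b\<in>G. \<phi> b x *\<^sub>C b"
    have "\<phi> b ?p = \<phi> b x" if "b \<in> G" for b
    proof -
      have "\<phi> b ?p = (\<Sum>b'\<in>G. if b = b' then \<phi> b' x else 0)"
        unfolding cblinfun_sum using that by (intro sum.cong) (auto simp: \<phi>)
      then show ?thesis
        using that G(1) by simp
    qed
    moreover have "T ?p = 0"
      unfolding cblinfun_sum using G(2) by (intro sum.neutral) (auto simp: kernel_def)
    moreover have "norm (x - ?p) \<le> c * norm y"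
    proof -
      have "norm ?p \<le> (\<Sum>b\<in>G. (norm (\<phi> b) * norm b) * norm x)"
      proof (rule sum_norm_le)
        show "norm (\<phi> b x *\<^sub>C b) \<le> (norm (\<phi> b) * norm b) * norm x" for b
          using mult_right_mono [OF cblinfun_norm_le [of "\<phi> b" x], of "norm b"] by (simp add: mult_ac)
      qed
      then have "norm ?p \<le> (\<Sum>b\<in>G. norm (\<phi> b) * norm b) * norm x"
        by (simp only: sum_distrib_right)
      then have "norm (x - ?p) \<le> L * norm x"
        using norm_triangle_ineq4 [of x ?p] by (simp add: L_def algebra_simps)
      also have "\<dots> \<le> L * (K * norm y)"
        using x(3) L by (rule mult_left_mono)
      also have "\<dots> \<le> c * norm y"
        by (simp add: c_def algebra_simps)
      finally show ?thesis .
    qed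
    ultimately show ?thesis
      using x(1,2) by (intro exI [of _ "x - ?p"]) (auto simp: cvec.span_neg)
  qed
  then obtain nx where nx: "\<And>y b. b \<in> G \<Longrightarrow> \<phi> b (nx y) = 0" "\<And>y. T (nx y) - y \<in> cspan F"
      "\<And>y. norm (nx y) \<le> c * norm y"
    by metis
  \<comment> \<open>Iterated preimages modulo \<open>span F\<close> are the Taylor coefficients of the local eigenvectors.\<close>
  define X where "X b k = (nx ^^ k) b" for b k
  have X_0: "X b 0 = b" and X_Suc: "X b (Suc k) = nx (X b k)" for b k
    by (simp_all add: X_def)
  have X_le: "norm (X b k) \<le> norm b * c ^ k" for b k
  proof (induction k)
    case (Suc k)
    show ?case
      using order_trans [OF nx(3) mult_left_mono [OF Suc, of c]] c by (simp add: X_Suc mult_ac)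
  qed (simp add: X_0)
  define g where "g b \<mu> = (\<Sum>k. \<mu> ^ k *\<^sub>C X b k)" for b \<mu>
  have g_sums: "(\<lambda>k. \<mu> ^ k *\<^sub>C X b k) sums g b \<mu>" if "\<mu> \<in> ball 0 (1 / c)" for b \<mu>
    unfolding g_def using that by (intro summable_sums power_series_summable [OF X_le c]) simp
  have g_analytic: "vec_analytic_on (g b) (ball 0 (1 / c))" for b
    unfolding g_def by (rule power_series_analytic [OF X_le c])
  have g_dual: "\<phi> b (g b' \<mu>) = (if b = b' then 1 else 0)"
    if b: "b \<in> G" "b' \<in> G" and \<mu>: "\<mu> \<in> ball 0 (1 / c)" for b b' \<mu>
  proof (rule sums_unique2)
    show "(\<lambda>k. \<phi> b (\<mu> ^ k *\<^sub>C X b' k)) sums \<phi> b (g b' \<mu>)"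
      by (rule bounded_linear.sums [OF cblinfun_bounded_linear g_sums [OF \<mu>]])
    have "\<phi> b (\<mu> ^ k *\<^sub>C X b' k) = (if k = 0 then (if b = b' then 1 else 0) else 0)" for k
      by (cases k) (auto simp: X_0 X_Suc nx(1) \<phi> b)
    then show "(\<lambda>k. \<phi> b (\<mu> ^ k *\<^sub>C X b' k)) sums (if b = b' then 1 else 0)"
      using sums_single [of 0 "\<lambda>_. if b = b' then 1 else 0"] by simp
  qed
  \<comment> \<open>The series telescopes: the constant term is \<open>T b = 0\<close>, and each other term lies in \<open>span F\<close>.\<close>
  have mem: "T (g b \<mu>) - \<mu> *\<^sub>C g b \<mu> \<in> cspan F" if b: "b \<in> G" and \<mu>: "\<mu> \<in> ball 0 (1 / c)" for b \<mu>
  proof (rule closed_csubspace_sums [OF cvec.subspace_span closed_cspan_finite [OF F(1)]])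
    have "(\<lambda>k. \<mu> ^ k *\<^sub>C T (X b k)) sums T (g b \<mu>)"
      using bounded_linear.sums [OF cblinfun_bounded_linear [of T] g_sums [OF \<mu>, of b]] by simp
    moreover have "\<mu> ^ 0 *\<^sub>C T (X b 0) = 0"
      using b G(2) by (auto simp: X_0 kernel_def)
    ultimately have "(\<lambda>k. \<mu> ^ Suc k *\<^sub>C T (X b (Suc k))) sums T (g b \<mu>)"
      by (subst sums_Suc_iff) simp
    moreover have "(\<lambda>k. \<mu> *\<^sub>C \<mu> ^ k *\<^sub>C X b k) sums (\<mu> *\<^sub>C g b \<mu>)"
      by (rule bounded_linear.sums
          [OF bounded_bilinear.bounded_linear_right [OF bounded_bilinear_scaleC] g_sums [OF \<mu>]])
    ultimately show "(\<lambda>k. \<mu> ^ Suc k *\<^sub>C T (X b (Suc k)) - \<mu> *\<^sub>C \<mu> ^ k *\<^sub>C X b k) sums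
        (T (g b \<mu>) - \<mu> *\<^sub>C g b \<mu>)"
      by (rule sums_diff)
    fix k
    have "\<mu> ^ Suc k *\<^sub>C T (X b (Suc k)) - \<mu> *\<^sub>C \<mu> ^ k *\<^sub>C X b k
        = \<mu> ^ Suc k *\<^sub>C (T (nx (X b k)) - X b k)"
      by (simp add: X_Suc scaleC_diff_right)
    then show "\<mu> ^ Suc k *\<^sub>C T (X b (Suc k)) - \<mu> *\<^sub>C \<mu> ^ k *\<^sub>C X b k \<in> cspan F"
      using nx(2) by (simp only: cvec.span_scale)
  qed
  \<comment> \<open>Every \<open>g b \<mu>\<close> has the same dual pairings as \<open>b\<close> itself, so independence persists away from \<open>0\<close>.\<close>
  have indep: "\<forall>b\<in>G. u b = 0"
    if \<mu>: "\<mu> \<in> ball 0 (1 / c)" and u: "(\<Sum>b\<in>G. u b *\<^sub>C g b \<mu>) = 0" for \<mu> u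
  proof
    fix b assume b: "b \<in> G"
    have "0 = \<phi> b (\<Sum>b'\<in>G. u b' *\<^sub>C g b' \<mu>)"
      by (simp add: u)
    also have "\<dots> = (\<Sum>b'\<in>G. if b = b' then u b' else 0)"
      unfolding cblinfun_sum by (intro sum.cong) (auto simp: g_dual [OF b _ \<mu>])
    finally show "u b = 0"
      using b G(1) by simp
  qed
  obtain r where r: "r > 0"
    and svep_r: "\<forall>V. open V \<and> V \<subseteq> ball 0 r \<longrightarrow> (\<forall>f. vec_analytic_on f V \<and>
      (\<forall>\<mu>\<in>V. (T - \<mu> *\<^sub>C id_cblinfun) (f \<mu>) = 0) \<longrightarrow> (\<forall>\<mu>\<in>V. f \<mu> = 0))"
    using svep unfolding SVEP_at_def by (elim exE conjE)
  define V where "V = ball (0 :: complex) (min r (1 / c))"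
  have V: "V \<subseteq> ball 0 r" "V \<subseteq> ball 0 (1 / c)" "open V" "V \<noteq> {}"
    using r c by (auto simp: V_def min_def not_le)
  have "\<exists>W f. open W \<and> W \<noteq> {} \<and> W \<subseteq> V \<and> vec_analytic_on f W \<and>
      (\<forall>\<mu>\<in>W. f \<mu> \<noteq> 0 \<and> T (f \<mu>) - \<mu> *\<^sub>C f \<mu> = 0)"
    by (rule eigenvector_elimination [OF F(1) G(1) card V(3,4)
          vec_analytic_on_subset [OF g_analytic V(2)] indep [OF subsetD [OF V(2)]]
          mem [OF _ subsetD [OF V(2)]]])
  then obtain W f where W: "open W" "W \<noteq> {}" "W \<subseteq> V" "vec_analytic_on f W"
      "\<And>\<mu>. \<mu> \<in> W \<Longrightarrow> f \<mu> \<noteq> 0" "\<And>\<mu>. \<mu> \<in> W \<Longrightarrow> T (f \<mu>) - \<mu> *\<^sub>C f \<mu> = 0"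
    by (elim exE conjE) metis
  have "\<forall>\<mu>\<in>W. f \<mu> = 0"
    using svep_r [rule_format, of W f] W(1,3,4,6) V(1) by auto
  then show False
    using W(2,5) by blast
qed

section \<open>Semi-Fredholm operators modulo finite rank\<close>

text \<open>For \<open>p = True\<close> the next five notions are meant up to finite dimensions; for \<open>p = False\<close> the finite
  sets \<open>\<Phi>\<close> and \<open>F\<close> must be empty and the notions become \<open>bounded below\<close>, \<open>surjective\<close>, \<open>zero\<close>, \<open>left
  invertible\<close> and \<open>right invertible\<close>. The finite sets occur existentially, without counting
  dimensions, so that all closure properties below are proved for both cases at once.\<close>

definition bounded_below_mod :: "bool \<Rightarrow> 'a::complex_normed_vector \<Rightarrow>\<^sub>C\<^sub>L 'b::complex_normed_vector \<Rightarrow> bool" where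
  "bounded_below_mod p T \<longleftrightarrow> (\<exists>\<Phi> c. finite \<Phi> \<and> (p \<or> \<Phi> = {}) \<and>
     (\<forall>x\<in>vanishing \<Phi>. norm x \<le> c * norm (T x)))"

definition onto_mod :: "bool \<Rightarrow> 'a::complex_normed_vector \<Rightarrow>\<^sub>C\<^sub>L 'b::complex_normed_vector \<Rightarrow> bool" where
  "onto_mod p T \<longleftrightarrow> (\<exists>F. finite F \<and> (p \<or> F = {}) \<and> (\<forall>y. \<exists>z\<in>cspan F. y - z \<in> op_range T))"

definition finite_rank_mod :: "bool \<Rightarrow> 'a::complex_normed_vector \<Rightarrow>\<^sub>C\<^sub>L 'b::complex_normed_vector \<Rightarrow> bool" where
  "finite_rank_mod p K \<longleftrightarrow> (\<exists>F. finite F \<and> (p \<or> F = {}) \<and> op_range K \<subseteq> cspan F)"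

definition left_invertible_mod :: "bool \<Rightarrow> 'a::complex_normed_vector \<Rightarrow>\<^sub>C\<^sub>L 'a \<Rightarrow> bool" where
  "left_invertible_mod p T \<longleftrightarrow> (\<exists>S :: 'a \<Rightarrow>\<^sub>C\<^sub>L 'a. finite_rank_mod p (id_cblinfun - S o\<^sub>C\<^sub>L T))"

definition right_invertible_mod :: "bool \<Rightarrow> 'a::complex_normed_vector \<Rightarrow>\<^sub>C\<^sub>L 'a \<Rightarrow> bool" where
  "right_invertible_mod p T \<longleftrightarrow> (\<exists>S :: 'a \<Rightarrow>\<^sub>C\<^sub>L 'a. finite_rank_mod p (id_cblinfun - T o\<^sub>C\<^sub>L S))"

lemma finite_rank_mod_add:
  assumes "finite_rank_mod p K" and "finite_rank_mod p L"
  shows "finite_rank_mod p (K + L)"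
proof -
  obtain F G where F: "finite F" "p \<or> F = {}" "op_range K \<subseteq> cspan F"
      and G: "finite G" "p \<or> G = {}" "op_range L \<subseteq> cspan G"
    using assms by (auto simp: finite_rank_mod_def)
  have "op_range (K + L) \<subseteq> cspan (F \<union> G)"
    using F(3) G(3) by (force simp: op_range_def cvec.span_Un image_subset_iff)
  then show ?thesis
    using F(1,2) G(1,2) unfolding finite_rank_mod_def by (intro exI [of _ "F \<union> G"]) auto
qed

lemma finite_rank_mod_compose_left:
  assumes "finite_rank_mod p K"
  shows "finite_rank_mod p (S o\<^sub>C\<^sub>L K)"
proof -
  obtain F where F: "finite F" "p \<or> F = {}" "op_range K \<subseteq> cspan F"
    using assms by (auto simp: finite_rank_mod_def)
  have "op_range (S o\<^sub>C\<^sub>L K) \<subseteq> cspan (cblinfun_apply S ` F)"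
    using F(3) by (auto simp: cspan_image op_range_def)
  then show ?thesis
    using F(1,2) unfolding finite_rank_mod_def by (intro exI [of _ "cblinfun_apply S ` F"]) auto
qed

lemma finite_rank_mod_compose_right:
  assumes "finite_rank_mod p K"
  shows "finite_rank_mod p (K o\<^sub>C\<^sub>L S)"
proof -
  have "op_range (K o\<^sub>C\<^sub>L S) \<subseteq> op_range K"
    by (auto simp: op_range_def)
  then show ?thesis
    using assms unfolding finite_rank_mod_def by blast
qed

lemma finite_rank_False_iff: "finite_rank_mod False K \<longleftrightarrow> K = 0"
  unfolding finite_rank_mod_def op_range_def by (auto simp: image_subset_iff intro!: cblinfun_eqI)

lemma left_invertible_iff: "left_invertible T \<longleftrightarrow> left_invertible_mod False T"
  unfolding left_invertible_def left_invertible_mod_def finite_rank_False_iff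
  by (metis eq_iff_diff_eq_0)

lemma right_invertible_iff: "right_invertible T \<longleftrightarrow> right_invertible_mod False T"
  unfolding right_invertible_def right_invertible_mod_def finite_rank_False_iff
  by (metis eq_iff_diff_eq_0)

text \<open>The functionals dual to a basis of the finite-dimensional space cut out a closed complement.\<close>

lemma finite_dim_complement:
  fixes F :: "'a::complex_normed_vector set"
  assumes "finite F"
  obtains \<Phi> :: "('a \<Rightarrow>\<^sub>C\<^sub>L complex) set" where "finite \<Phi>" "F = {} \<longrightarrow> \<Phi> = {}"
    "vanishing \<Phi> \<inter> cspan F = {0}" "\<And>x. \<exists>n\<in>vanishing \<Phi>. x - n \<in> cspan F"
proof -
  obtain B where B: "B \<subseteq> F" "\<not> cvec.dependent B" "F \<subseteq> cspan B"
    using cvec.maximal_independent_subset by metis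
  then have finB: "finite B" and span: "cspan F = cspan B"
    using assms finite_subset cvec.span_mono [OF B(1)] cvec.span_minimal [OF B(3) cvec.subspace_span]
    by auto
  obtain \<phi> :: "'a \<Rightarrow> 'a \<Rightarrow>\<^sub>C\<^sub>L complex"
    where \<phi>: "\<And>b b'. b \<in> B \<Longrightarrow> b' \<in> B \<Longrightarrow> \<phi> b b' = (if b = b' then 1 else 0)"
    using dual_functionals [OF finB B(2)] by metis
  have coeff: "\<phi> b (\<Sum>b'\<in>B. u b' *\<^sub>C b') = u b" if "b \<in> B" for b u
  proof -
    have "\<phi> b (\<Sum>b'\<in>B. u b' *\<^sub>C b') = (\<Sum>b'\<in>B. if b = b' then u b' else 0)"
      unfolding cblinfun_sum using that by (intro sum.cong) (auto simp: \<phi>)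
    then show ?thesis
      using that finB by simp
  qed
  have "x = 0" if x: "x \<in> vanishing (\<phi> ` B)" "x \<in> cspan F" for x
  proof -
    obtain u where u: "x = (\<Sum>b\<in>B. u b *\<^sub>C b)"
      using x(2) span cvec.span_finite [OF finB] by auto
    have "u b = 0" if "b \<in> B" for b
      using x(1) coeff [OF that, of u] that by (auto simp: vanishing_def u)
    then show ?thesis
      by (simp add: u)
  qed
  moreover have "\<exists>n\<in>vanishing (\<phi> ` B). x - n \<in> cspan F" for x
  proof
    let ?q = "\<Sum>b\<in>B. \<phi> b x *\<^sub>C b"
    show "x - ?q \<in> vanishing (\<phi> ` B)"
      by (auto simp: vanishing_def coeff)
    show "x - (x - ?q) \<in> cspan F"
      unfolding span by (auto intro: cvec.span_sum cvec.span_scale cvec.span_base)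
  qed
  moreover have "0 \<in> vanishing (\<phi> ` B) \<inter> cspan F"
    by (auto simp: vanishing_def cvec.span_zero)
  ultimately show ?thesis
    using finB B(1) by (intro that [of "\<phi> ` B"]) auto
qed

lemma finite_rank_vanishing:
  assumes "finite_rank_mod p K"
  obtains \<Phi> where "finite \<Phi>" "p \<or> \<Phi> = {}" "\<And>x. x \<in> vanishing \<Phi> \<Longrightarrow> K x = 0"
proof -
  obtain F where F: "finite F" "p \<or> F = {}" "op_range K \<subseteq> cspan F"
    using assms by (auto simp: finite_rank_mod_def)
  obtain \<Phi> where \<Phi>: "finite \<Phi>" "F = {} \<longrightarrow> \<Phi> = {}" "vanishing \<Phi> \<inter> cspan F = {0}"
    using finite_dim_complement [OF F(1)] by metis
  show ?thesis
  proof (rule that [of "(\<lambda>\<phi>. \<phi> o\<^sub>C\<^sub>L K) ` \<Phi>"])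
    fix x assume "x \<in> vanishing ((\<lambda>\<phi>. \<phi> o\<^sub>C\<^sub>L K) ` \<Phi>)"
    then have "K x \<in> vanishing \<Phi> \<inter> cspan F"
      using F(3) by (auto simp: vanishing_def op_range_def)
    then show "K x = 0"
      using \<Phi>(3) by blast
  qed (use F \<Phi> in auto)
qed

lemma left_invertible_mod_imp_bounded_below_mod:
  assumes "left_invertible_mod p T"
  shows "bounded_below_mod p T"
proof -
  obtain S where S: "finite_rank_mod p (id_cblinfun - S o\<^sub>C\<^sub>L T)"
    using assms by (auto simp: left_invertible_mod_def)
  obtain \<Phi> where \<Phi>: "finite \<Phi>" "p \<or> \<Phi> = {}"
      "\<And>x. x \<in> vanishing \<Phi> \<Longrightarrow> (id_cblinfun - S o\<^sub>C\<^sub>L T) x = 0"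
    using finite_rank_vanishing [OF S] by metis
  have "norm x \<le> norm S * norm (T x)" if "x \<in> vanishing \<Phi>" for x
    using \<Phi>(3) [OF that] cblinfun_norm_le [of S "T x"] by simp
  then show ?thesis
    using \<Phi>(1,2) unfolding bounded_below_mod_def by blast
qed

lemma right_invertible_mod_imp_onto_mod:
  assumes "right_invertible_mod p T"
  shows "onto_mod p T"
proof -
  obtain S F where SF: "finite F" "p \<or> F = {}" "op_range (id_cblinfun - T o\<^sub>C\<^sub>L S) \<subseteq> cspan F"
    using assms by (auto simp: right_invertible_mod_def finite_rank_mod_def)
  have "\<exists>z\<in>cspan F. y - z \<in> op_range T" for y
    using SF(3) by (intro bexI [of _ "(id_cblinfun - T o\<^sub>C\<^sub>L S) y"]) (auto simp: op_range_def)
  then show ?thesis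
    using SF(1,2) unfolding onto_mod_def by blast
qed

lemma quotient_basis_cspan:
  assumes "finite F"
  shows "quotient_basis S F \<longleftrightarrow>
    (\<forall>u. (\<Sum>b\<in>F. u b *\<^sub>C b) \<in> S \<longrightarrow> (\<forall>b\<in>F. u b = 0)) \<and> (\<forall>x. \<exists>z\<in>cspan F. x - z \<in> S)"
  unfolding quotient_basis_def cvec.span_finite [OF assms] by auto

lemma quotient_basis_Int:
  assumes F: "finite F" "quotient_basis S F" and S: "csubspace S"
  shows "S \<inter> cspan F = {0}"
proof -
  have "x = 0" if x: "x \<in> S" "x \<in> cspan F" for x
  proof -
    obtain u where u: "x = (\<Sum>b\<in>F. u b *\<^sub>C b)"
      using x(2) cvec.span_finite [OF F(1)] by auto
    then have "\<forall>b\<in>F. u b = 0"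
      using F(2) x(1) unfolding quotient_basis_def by blast
    then show ?thesis
      by (simp add: u)
  qed
  then show ?thesis
    using cvec.subspace_0 [OF S] by (auto simp: cvec.span_zero)
qed

text \<open>As long as the cosets of \<open>F\<close> are dependent, one vector of \<open>F\<close> is redundant and can be dropped.\<close>

lemma exists_quotient_basis:
  assumes S: "csubspace S" and "finite F" and "\<forall>x. \<exists>z\<in>cspan F. x - z \<in> S"
  shows "\<exists>B\<subseteq>F. quotient_basis S B"
  using assms(2,3)
proof (induction F rule: finite_psubset_induct)
  case (psubset F)
  show ?case
  proof (cases "quotient_basis S F")
    case False
    then obtain u b where u: "(\<Sum>b\<in>F. u b *\<^sub>C b) \<in> S" "b \<in> F" "u b \<noteq> 0"
      using psubset.prems quotient_basis_cspan [OF psubset.hyps] by blast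
    define w where "w = (\<Sum>a\<in>F. u a *\<^sub>C a)"
    define v where "v = (\<Sum>a\<in>F - {b}. u a *\<^sub>C a)"
    have w: "w = u b *\<^sub>C b + v"
      unfolding w_def v_def by (rule sum.remove [OF psubset.hyps u(2)])
    have v: "v \<in> cspan (F - {b})"
      unfolding v_def by (auto intro: cvec.span_sum cvec.span_scale cvec.span_base)
    have "\<exists>z\<in>cspan (F - {b}). x - z \<in> S" for x
    proof -
      obtain z where z: "z \<in> cspan F" "x - z \<in> S"
        using psubset.prems by blast
      then obtain k where k: "z - k *\<^sub>C b \<in> cspan (F - {b})"
        using u(2) cvec.span_breakdown_eq [of z b "F - {b}"] by (auto simp: insert_absorb)
      let ?z = "z - k *\<^sub>C b - (k / u b) *\<^sub>C v"
      have "(k / u b) *\<^sub>C w \<in> S"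
        using u(1) by (auto simp: w_def intro: cvec.subspace_scale [OF S])
      then have "(x - z) + (k / u b) *\<^sub>C w \<in> S"
        by (rule cvec.subspace_add [OF S z(2)])
      moreover have "(x - z) + (k / u b) *\<^sub>C w = x - ?z"
        using u(3) by (simp add: w scaleC_add_right)
      moreover have "?z \<in> cspan (F - {b})"
        by (intro cvec.span_diff k cvec.span_scale v)
      ultimately show ?thesis
        by metis
    qed
    then have "\<exists>B\<subseteq>F - {b}. quotient_basis S B"
      using u(2) by (intro psubset.IH) auto
    then show ?thesis
      by blast
  qed blast
qed

lemma Phi_minus_iff: "T \<in> Phi_minus \<longleftrightarrow> onto_mod True T"
proof -
  have "(\<exists>F. finite F \<and> quotient_basis (op_range T) F) \<longleftrightarrow> onto_mod True T"
    unfolding onto_mod_def using exists_quotient_basis [OF csubspace_op_range, of _ T]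
    by (meson finite_subset quotient_basis_cspan)
  then show ?thesis
    by (simp add: Phi_minus_def deficiency_def quotient_edim_def)
qed

lemma deficiency_0_iff: "deficiency T = 0 \<longleftrightarrow> onto_mod False T"
proof
  assume "deficiency T = 0"
  then have ex: "\<exists>F. finite F \<and> quotient_basis (op_range T) F"
      and "card (SOME F. finite F \<and> quotient_basis (op_range T) F) = 0"
    unfolding deficiency_def quotient_edim_def by (auto simp: zero_enat_def split: if_splits)
  then have "quotient_basis (op_range T) {}"
    using someI_ex [OF ex] by auto
  then show "onto_mod False T"
    unfolding onto_mod_def by (auto simp: quotient_basis_def)
next
  assume "onto_mod False T"
  then have range: "op_range T = UNIV"
    by (auto simp: onto_mod_def)
  have *: "quotient_basis (op_range T) F \<longleftrightarrow> F = {}" if "finite F" for F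
  proof
    assume "quotient_basis (op_range T) F"
    then have "\<forall>b\<in>F. (1 :: complex) = 0"
      unfolding quotient_basis_def range by (elim conjE allE [of _ "\<lambda>_. 1"]) simp
    then show "F = {}"
      by simp
  qed (simp add: quotient_basis_def range)
  then have "(SOME F. finite F \<and> quotient_basis (op_range T) F) = {}"
    by (intro some_equality) auto
  then show "deficiency T = 0"
    using * unfolding deficiency_def quotient_edim_def by (auto simp: zero_enat_def)
qed

text \<open>Let \<open>y\<close> be a limit of points of the range and \<open>z\<close> its component along a finite-dimensional
  complement. The components of the differences between \<open>y\<close> and points of the range all equal \<open>z\<close>, and by the
  open mapping theorem they are as small as the differences; so \<open>z = 0\<close>.\<close>

lemma onto_mod_closed_range:
  fixes T :: "'a::cbanach \<Rightarrow>\<^sub>C\<^sub>L 'b::cbanach"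
  assumes "onto_mod p T"
  shows "closed (op_range T)"
proof -
  obtain F where F: "finite F" "quotient_basis (op_range T) F"
    using assms exists_quotient_basis [OF csubspace_op_range] finite_subset
    unfolding onto_mod_def by metis
  have onto: "\<exists>x\<in>UNIV. \<exists>z\<in>cspan F. y = T x + z" for y
  proof -
    obtain z x where "z \<in> cspan F" "y - z = T x"
      using F(2) unfolding quotient_basis_cspan [OF F(1)] op_range_def by blast
    then show ?thesis
      by (auto simp: algebra_simps)
  qed
  obtain K where K: "K \<ge> 0"
      "\<forall>y. \<exists>x\<in>UNIV. \<exists>z\<in>cspan F. y = T x + z \<and> norm x \<le> K * norm y \<and> norm z \<le> K * norm y"
    using sum_onto_bounded [OF cvec.subspace_UNIV closed_UNIV cvec.subspace_span closed_cspan_finite [OF F(1)] onto]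
    by (elim exE conjE)
  have "y \<in> op_range T" if y: "y \<in> closure (op_range T)" for y
  proof -
    obtain x z where xz: "z \<in> cspan F" "y = T x + z"
      using K(2) by blast
    have "norm z \<le> 0 + e" if e: "e > 0" for e
    proof -
      obtain x' where x': "dist (T x') y < e / (K + 1)"
        using y e K(1) unfolding closure_approachable op_range_def
        by (metis add_nonneg_pos divide_pos_pos imageE zero_less_one)
      obtain x'' z'' where z'': "z'' \<in> cspan F" "y - T x' = T x'' + z''" "norm z'' \<le> K * norm (y - T x')"
        using K(2) by blast
      have "z - z'' = T (x' + x'' - x)"
        using xz(2) z''(2) by (simp add: algebra_simps)
      then have "z - z'' \<in> op_range T"
        unfolding op_range_def by (rule range_eqI)
      moreover have "z - z'' \<in> cspan F"
        by (rule cvec.span_diff [OF xz(1) z''(1)])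
      ultimately have "z - z'' \<in> {0}"
        using quotient_basis_Int [OF F csubspace_op_range] by blast
      then have "z = z''"
        by simp
      then have "norm z \<le> K * (e / (K + 1))"
        using z''(3) x' mult_left_mono [of "norm (y - T x')" "e / (K + 1)" K] K(1)
        by (simp add: dist_norm norm_minus_commute)
      also have "\<dots> \<le> e"
        using K(1) e by (simp add: field_simps)
      finally show ?thesis
        by simp
    qed
    then have "norm z \<le> 0"
      by (rule field_le_epsilon)
    then show ?thesis
      using xz(2) by (simp add: op_range_def)
  qed
  then show ?thesis
    by (metis closure_subset closure_eq subsetI subset_antisym)
qed

text \<open>The image of a common kernel of finitely many functionals fills the range up to finitely many
  vectors.\<close>

lemma op_range_eq_cspan:
  fixes T :: "'a::complex_normed_vector \<Rightarrow>\<^sub>C\<^sub>L 'b::complex_normed_vector"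
  assumes "finite \<Phi>"
  shows "\<exists>E. finite E \<and> op_range T = cspan (E \<union> cblinfun_apply T ` vanishing \<Phi>)"
proof -
  let ?N = "vanishing \<Phi>"
  obtain E where E: "finite E" "\<And>x. \<exists>z\<in>cspan E. x - z \<in> ?N"
    using vanishing_finite_codim [OF cvec.subspace_UNIV assms] by auto
  have "\<exists>z\<in>cspan E. \<exists>n\<in>?N. x = z + n" for x
    using E(2) [of x] by (metis add_diff_cancel_left' diff_add_cancel add.commute)
  then have "cspan (E \<union> ?N) = UNIV"
    unfolding cvec.span_Un using cvec.span_base by blast
  then show ?thesis
    using E(1) by (intro exI [of _ "cblinfun_apply T ` E"])
      (simp add: image_Un [symmetric] cspan_image op_range_def)
qed

text \<open>The link to the textbook definition of upper semi-Fredholm operators: the image of the common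
  kernel of \<open>\<Phi>\<close> is complete and only finitely many dimensions are missing from the range; conversely, the open
  mapping theorem gives the lower bound on a complement of the kernel.\<close>

lemma bounded_below_mod_iff:
  fixes T :: "'a::cbanach \<Rightarrow>\<^sub>C\<^sub>L 'b::cbanach"
  shows "bounded_below_mod p T \<longleftrightarrow>
    closed (op_range T) \<and> (\<exists>F. finite F \<and> (p \<or> F = {}) \<and> cspan F = kernel T)"
proof
  assume "bounded_below_mod p T"
  then obtain \<Phi> c where \<Phi>: "finite \<Phi>" "p \<or> \<Phi> = {}"
      and bd: "\<And>x. x \<in> vanishing \<Phi> \<Longrightarrow> norm x \<le> c * norm (T x)"
    by (auto simp: bounded_below_mod_def)
  let ?N = "vanishing \<Phi>"
  have ker: "x = 0" if "x \<in> kernel T" "x \<in> ?N" for x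
    using bd [OF that(2)] that(1) by (simp add: kernel_def)
  obtain F where F: "finite F" "F \<subseteq> kernel T" "\<Phi> = {} \<longrightarrow> F = {}"
      "\<And>x. x \<in> kernel T \<Longrightarrow> \<exists>z\<in>cspan F. x - z \<in> kernel T \<inter> ?N"
    using vanishing_finite_codim [OF csubspace_kernel \<Phi>(1)] by metis
  have "cspan F = kernel T"
  proof
    show "cspan F \<subseteq> kernel T"
      by (rule cvec.span_minimal [OF F(2) csubspace_kernel])
    show "kernel T \<subseteq> cspan F"
      using F(4) ker by fastforce
  qed
  moreover have "closed (op_range T)"
  proof -
    obtain E where E: "finite E" "op_range T = cspan (E \<union> cblinfun_apply T ` ?N)"
      using op_range_eq_cspan [OF \<Phi>(1)] by blast
    have "complete (cblinfun_apply T ` ?N)"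
    proof (rule complete_isometric_image)
      show "0 < 1 / (\<bar>c\<bar> + 1)"
        by simp
      show "subspace ?N"
        by (rule csubspace_imp_subspace [OF csubspace_vanishing])
      show "complete ?N"
        by (simp add: complete_eq_closed closed_vanishing)
      show "\<forall>x\<in>?N. 1 / (\<bar>c\<bar> + 1) * norm x \<le> norm (T x)"
      proof
        fix x assume "x \<in> ?N"
        then have "norm x \<le> c * norm (T x)"
          by (rule bd)
        also have "\<dots> \<le> (\<bar>c\<bar> + 1) * norm (T x)"
          by (intro mult_right_mono) auto
        finally show "1 / (\<bar>c\<bar> + 1) * norm x \<le> norm (T x)"
          by (simp add: field_simps)
      qed
    qed (rule cblinfun_bounded_linear)
    then show ?thesis
      unfolding E(2) using E(1) csubspace_image [OF csubspace_vanishing, of T \<Phi>]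
      by (intro closed_cspan_Un_finite) (auto simp: complete_eq_closed)
  qed
  ultimately show "closed (op_range T) \<and> (\<exists>F. finite F \<and> (p \<or> F = {}) \<and> cspan F = kernel T)"
    using F(1,3) \<Phi>(2) by blast
next
  assume "closed (op_range T) \<and> (\<exists>F. finite F \<and> (p \<or> F = {}) \<and> cspan F = kernel T)"
  then obtain F where cl: "closed (op_range T)" and F: "finite F" "p \<or> F = {}" "cspan F = kernel T"
    by blast
  obtain \<Phi> :: "('a \<Rightarrow>\<^sub>C\<^sub>L complex) set" where \<Phi>: "finite \<Phi>" "F = {} \<longrightarrow> \<Phi> = {}"
      "vanishing \<Phi> \<inter> cspan F = {0}" "\<And>x. \<exists>n\<in>vanishing \<Phi>. x - n \<in> cspan F"
    using finite_dim_complement [OF F(1)] by metis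
  have range: "cblinfun_apply T ` vanishing \<Phi> = op_range T"
  proof -
    have "T x \<in> cblinfun_apply T ` vanishing \<Phi>" for x
      using \<Phi>(4) [of x] unfolding F(3) kernel_def by force
    then show ?thesis
      by (auto simp: op_range_def)
  qed
  obtain K where K: "\<And>y. y \<in> op_range T \<Longrightarrow> \<exists>x\<in>vanishing \<Phi>. T x = y \<and> norm x \<le> K * norm y"
    using open_mapping_closed_range [OF csubspace_vanishing [of \<Phi>] closed_vanishing [of \<Phi>], of T] cl
    unfolding range by metis
  have "norm x \<le> K * norm (T x)" if x: "x \<in> vanishing \<Phi>" for x
  proof -
    obtain x' where x': "x' \<in> vanishing \<Phi>" "T x' = T x" "norm x' \<le> K * norm (T x)"
      using K [of "T x"] by (auto simp: op_range_def)
    have "x - x' \<in> vanishing \<Phi> \<inter> cspan F"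
      using x x'(1,2) csubspace_vanishing [of \<Phi>] by (auto simp: F(3) kernel_def cvec.subspace_diff)
    then show ?thesis
      using \<Phi>(3) x'(3) by auto
  qed
  then show "bounded_below_mod p T"
    using \<Phi>(1,2) F(2) unfolding bounded_below_mod_def by blast
qed

lemma nullity_0_iff: "nullity T = 0 \<longleftrightarrow> kernel T = {0}"
  for T :: "'a::complex_normed_vector \<Rightarrow>\<^sub>C\<^sub>L 'a"
proof
  assume "nullity T = 0"
  then obtain F where F: "finite F" "cspan F = kernel T" "cdim (kernel T) = 0"
    unfolding nullity_def cedim_def by (auto simp: zero_enat_def split: if_splits)
  obtain B where B: "B \<subseteq> kernel T" "\<not> cvec.dependent B" "kernel T \<subseteq> cspan B" "card B = cdim (kernel T)"
    using cvec.basis_exists by metis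
  have "finite B"
    using cvec.independent_span_bound [OF F(1) B(2)] B(1) F(2) by auto
  then have "B = {}"
    using B(4) F(3) by simp
  then show "kernel T = {0}"
    using B(3) cvec.subspace_0 [OF csubspace_kernel [of T]] by auto
next
  assume k: "kernel T = {0}"
  then have "cspan {} = kernel T"
    by simp
  moreover have "cdim (kernel T) = 0"
    using cvec.dim_eq_card_independent [OF cvec.independent_empty] cvec.dim_span [of "{} :: 'a set"] k by simp
  ultimately show "nullity T = 0"
    unfolding nullity_def cedim_def by (auto simp: zero_enat_def intro: exI [of _ "{}"])
qed

lemma nullity_finite_iff: "nullity T < \<infinity> \<longleftrightarrow> (\<exists>F. finite F \<and> cspan F = kernel T)"
  by (simp add: nullity_def cedim_def)

lemma Phi_plus_iff: "T \<in> Phi_plus \<longleftrightarrow> bounded_below_mod True T"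
  unfolding Phi_plus_def bounded_below_mod_iff nullity_finite_iff mem_Collect_eq by auto

lemma bounded_below_mod_mono: "bounded_below_mod False T \<Longrightarrow> bounded_below_mod p T"
  and onto_mod_mono: "onto_mod False T \<Longrightarrow> onto_mod p T"
  unfolding bounded_below_mod_def onto_mod_def by auto

lemma bounded_below_False_iff:
  fixes T :: "'a::cbanach \<Rightarrow>\<^sub>C\<^sub>L 'a"
  shows "bounded_below_mod False T \<longleftrightarrow> closed (op_range T) \<and> nullity T = 0"
  by (auto simp: bounded_below_mod_iff nullity_0_iff)

text \<open>The ranges of operators in either semi-Fredholm class are closed, so nullity zero means bounded
  below.\<close>

lemma SF0_iff: "T \<in> SF0 \<longleftrightarrow> bounded_below_mod False T \<or> onto_mod False T"
proof -
  have "closed (op_range T)" if "T \<in> Phi_plus \<union> Phi_minus"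
    using that by (auto simp: Phi_plus_iff Phi_minus_iff bounded_below_mod_iff onto_mod_closed_range)
  then show ?thesis
    unfolding SF0_def deficiency_0_iff
    using bounded_below_False_iff [of T] bounded_below_mod_mono [of T True] onto_mod_mono [of T True]
    by (auto simp: Phi_plus_iff Phi_minus_iff)
qed

section \<open>Inverses modulo finite rank\<close>

text \<open>If kernel and range have closed complements \<open>N\<close> and \<open>Z\<close>, then \<open>S\<close> sends \<open>y\<close> to the unique \<open>x \<in> N\<close> with
  \<open>y - T x \<in> Z\<close>; boundedness is the open mapping theorem. All constructions of left or right inverses
  modulo finite rank are instances.\<close>

lemma generalized_inverse:
  fixes T :: "'a::cbanach \<Rightarrow>\<^sub>C\<^sub>L 'b::cbanach"
  assumes N: "csubspace N" "closed N" "N \<inter> kernel T = {0}" "\<And>x. \<exists>n\<in>N. x - n \<in> kernel T"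
    and Z: "csubspace Z" "closed Z" "Z \<inter> op_range T = {0}" "\<And>y. \<exists>z\<in>Z. y - z \<in> op_range T"
  shows "\<exists>S :: 'b \<Rightarrow>\<^sub>C\<^sub>L 'a. (\<forall>x. x - S (T x) \<in> kernel T) \<and> (\<forall>y. y - T (S y) \<in> Z)"
proof -
  have lift: "\<exists>n\<in>N. T x = T n" for x
    using N(4) [of x] by (auto simp: kernel_def)
  have onto: "\<exists>x\<in>N. \<exists>z\<in>Z. y = T x + z" for y
  proof -
    obtain z x where "z \<in> Z" "y - z = T x"
      using Z(4) [of y] by (auto simp: op_range_def)
    moreover obtain n where "n \<in> N" "T x = T n"
      using lift by blast
    ultimately show ?thesis
      by (intro bexI [of _ n] bexI [of _ z]) (auto simp: algebra_simps)
  qed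
  obtain K where K: "K \<ge> 0"
      "\<forall>y. \<exists>x\<in>N. \<exists>z\<in>Z. y = T x + z \<and> norm x \<le> K * norm y \<and> norm z \<le> K * norm y"
    using sum_onto_bounded [OF N(1,2) Z(1,2) onto] by (elim exE conjE)
  have unique: "x = x'" if x: "x \<in> N" "y - T x \<in> Z" and x': "x' \<in> N" "y - T x' \<in> Z" for x x' y
  proof -
    have "(y - T x') - (y - T x) \<in> Z"
      by (rule cvec.subspace_diff [OF Z(1) x'(2) x(2)])
    moreover have "(y - T x') - (y - T x) = T (x - x')"
      by simp
    ultimately have "T (x - x') \<in> Z \<inter> op_range T"
      unfolding op_range_def by (metis IntI rangeI)
    then have "x - x' \<in> N \<inter> kernel T"
      unfolding Z(3) using cvec.subspace_diff [OF N(1) x(1) x'(1)] by (simp add: kernel_def)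
    then show ?thesis
      unfolding N(3) by simp
  qed
  define s where "s y = (THE x. x \<in> N \<and> y - T x \<in> Z)" for y
  have s_eq: "s y = x" if "x \<in> N" "y - T x \<in> Z" for x y
    unfolding s_def using that unique by blast
  have s: "s y \<in> N \<and> y - T (s y) \<in> Z \<and> norm (s y) \<le> K * norm y" for y
  proof -
    obtain x z where x: "x \<in> N" "z \<in> Z" "y = T x + z" "norm x \<le> K * norm y"
      using K(2) by blast
    then show ?thesis
      using s_eq [of x y] by simp
  qed
  have "s (y + y') = s y + s y'" for y y'
  proof (rule s_eq)
    show "s y + s y' \<in> N"
      using s by (intro cvec.subspace_add N(1)) auto
    have "(y - T (s y)) + (y' - T (s y')) \<in> Z"
      using s by (intro cvec.subspace_add Z(1)) auto
    then show "y + y' - T (s y + s y') \<in> Z"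
      by (simp add: algebra_simps)
  qed
  moreover have "s (c *\<^sub>C y) = c *\<^sub>C s y" for c y
  proof (rule s_eq)
    show "c *\<^sub>C s y \<in> N"
      using s by (intro cvec.subspace_scale N(1)) auto
    have "c *\<^sub>C (y - T (s y)) \<in> Z"
      using s by (intro cvec.subspace_scale Z(1)) auto
    then show "c *\<^sub>C y - T (c *\<^sub>C s y) \<in> Z"
      by (simp add: scaleC_diff_right)
  qed
  ultimately obtain S :: "'b \<Rightarrow>\<^sub>C\<^sub>L 'a" where S: "\<And>y. S y = s y"
    using cblinfun_exI [of s K] s by auto
  have "x - S (T x) \<in> kernel T" for x
  proof -
    obtain n where n: "n \<in> N" "T x = T n"
      using lift by blast
    then have "S (T x) = n"
      unfolding S by (intro s_eq) (auto simp: cvec.subspace_0 [OF Z(1)])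
    then show ?thesis
      using n by (simp add: kernel_def)
  qed
  then show ?thesis
    using s S by (intro exI [of _ S]) auto
qed

lemma Fredholm_imp_invertible_mod:
  fixes T :: "'a::cbanach \<Rightarrow>\<^sub>C\<^sub>L 'a"
  assumes "bounded_below_mod p T" and "onto_mod p T"
  shows "left_invertible_mod p T" and "right_invertible_mod p T"
proof -
  obtain F where F: "finite F" "p \<or> F = {}" "cspan F = kernel T"
    using assms(1) by (auto simp: bounded_below_mod_iff)
  obtain \<Phi> :: "('a \<Rightarrow>\<^sub>C\<^sub>L complex) set" where \<Phi>:
      "vanishing \<Phi> \<inter> cspan F = {0}" "\<And>x. \<exists>n\<in>vanishing \<Phi>. x - n \<in> cspan F"
    using finite_dim_complement [OF F(1)] by metis
  obtain E where "finite E" "p \<or> E = {}" "\<forall>y. \<exists>z\<in>cspan E. y - z \<in> op_range T"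
    using assms(2) by (auto simp: onto_mod_def)
  then obtain G where G: "finite G" "p \<or> G = {}" "quotient_basis (op_range T) G"
    using exists_quotient_basis [OF csubspace_op_range] finite_subset by (metis subset_empty)
  obtain S :: "'a \<Rightarrow>\<^sub>C\<^sub>L 'a" where S: "\<And>x. x - S (T x) \<in> kernel T" "\<And>y. y - T (S y) \<in> cspan G"
    using generalized_inverse [OF csubspace_vanishing closed_vanishing _ _ cvec.subspace_span
        closed_cspan_finite [OF G(1)], of \<Phi> T]
      \<Phi> quotient_basis_Int [OF G(1,3) csubspace_op_range] G(3)
    unfolding F(3) quotient_basis_cspan [OF G(1)] by (auto simp: Int_commute)
  show "left_invertible_mod p T"
    unfolding left_invertible_mod_def finite_rank_mod_def
    using F S(1) by (intro exI [of _ S] exI [of _ F]) (auto simp: op_range_def)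
  show "right_invertible_mod p T"
    unfolding right_invertible_mod_def finite_rank_mod_def
    using G S(2) by (intro exI [of _ S] exI [of _ G]) (auto simp: op_range_def)
qed

lemma rank_one_op:
  fixes \<psi> :: "'a::complex_normed_vector \<Rightarrow>\<^sub>C\<^sub>L complex" and e :: "'b::complex_normed_vector"
  obtains R :: "'a \<Rightarrow>\<^sub>C\<^sub>L 'b" where "\<And>x. R x = \<psi> x *\<^sub>C e"
proof -
  have "norm (\<psi> x *\<^sub>C e) \<le> (norm \<psi> * norm e) * norm x" for x
    using mult_right_mono [OF cblinfun_norm_le [of \<psi> x], of "norm e"] by (simp add: mult_ac)
  then have "\<exists>R :: 'a \<Rightarrow>\<^sub>C\<^sub>L 'b. \<forall>x. R x = \<psi> x *\<^sub>C e"
    by (intro cblinfun_exI) (auto simp: scaleC_add_left)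
  then show ?thesis
    using that by blast
qed

lemma op_range_projection: "P o\<^sub>C\<^sub>L P = P \<Longrightarrow> op_range P = {x. P x = x}"
  unfolding op_range_def by (auto simp: set_eq_iff image_iff) (metis cblinfun_apply_simps(2))+

lemma closed_complemented_op_range_projection:
  assumes P: "P o\<^sub>C\<^sub>L P = P"
  shows "closed_complemented (op_range P)"
proof -
  have range: "op_range P = {x. P x = x}"
    by (rule op_range_projection [OF P])
  have PP: "P (P x) = P x" for x
    using P by (metis cblinfun_apply_simps(2))
  have "op_range P = kernel (id_cblinfun - P)"
    unfolding range by (auto simp: kernel_def)
  then have "csubspace (op_range P)" "closed (op_range P)"
    by (simp_all add: csubspace_kernel closed_kernel)
  moreover have "op_range P \<inter> kernel P = {0}"
    unfolding range by (auto simp: kernel_def)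
  moreover have "\<exists>u v. x = u + v \<and> u \<in> op_range P \<and> v \<in> kernel P" for x
    by (intro exI [of _ "P x"] exI [of _ "x - P x"]) (auto simp: range kernel_def PP)
  ultimately show ?thesis
    unfolding closed_complemented_def
    by (intro conjI exI [of _ "kernel P"]) (auto simp: csubspace_kernel closed_kernel)
qed

text \<open>Complementability is handled through bounded projections, for which adding a vector to the range or
  imposing a further linear equation on it is an explicit rank-one correction.\<close>

lemma projection_onto_cspan_insert:
  fixes P :: "'a::complex_normed_vector \<Rightarrow>\<^sub>C\<^sub>L 'a"
  assumes P: "P o\<^sub>C\<^sub>L P = P"
  shows "\<exists>Q :: 'a \<Rightarrow>\<^sub>C\<^sub>L 'a. Q o\<^sub>C\<^sub>L Q = Q \<and> op_range Q = cspan (insert b (op_range P))"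
proof (cases "b \<in> op_range P")
  case True
  then show ?thesis
    using P by (intro exI [of _ P]) (auto simp: insert_absorb csubspace_op_range cvec.span_eq_iff [THEN iffD2])
next
  case False
  have PP: "P (P x) = P x" for x
    using P by (metis cblinfun_apply_simps(2))
  have range: "op_range P = {x. P x = x}"
    by (rule op_range_projection [OF P])
  \<comment> \<open>Only the part of \<open>b\<close> outside the old range is new, and \<open>P\<close> annihilates it.\<close>
  define v where "v = b - P b"
  have "v \<notin> {0}"
    using False by (auto simp: v_def range)
  then obtain \<psi> :: "'a \<Rightarrow>\<^sub>C\<^sub>L complex" where \<psi>: "\<psi> v = 1"
    using closed_subspace_separation [of "{0}" v] by auto
  have Pv: "P v = 0"
    by (simp add: v_def PP)
  obtain R :: "'a \<Rightarrow>\<^sub>C\<^sub>L 'a" where R: "\<And>x. R x = (\<psi> o\<^sub>C\<^sub>L (id_cblinfun - P)) x *\<^sub>C v"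
    using rank_one_op by metis
  define Q where "Q = P + R"
  have Q: "Q x = P x + \<psi> (x - P x) *\<^sub>C v" for x
    by (simp add: Q_def R)
  have "Q (Q x) = Q x" for x
    unfolding Q by (simp add: PP Pv \<psi>)
  then have QQ: "Q o\<^sub>C\<^sub>L Q = Q"
    by (intro cblinfun_eqI) simp
  have "op_range Q = cspan (insert b (op_range P))"
  proof
    show "op_range Q \<subseteq> cspan (insert b (op_range P))"
    proof
      fix y assume "y \<in> op_range Q"
      then obtain x where "y = P x + \<psi> (x - P x) *\<^sub>C (b - P b)"
        by (auto simp: op_range_def Q v_def)
      then show "y \<in> cspan (insert b (op_range P))"
        by (auto intro!: cvec.span_add cvec.span_scale cvec.span_diff intro: cvec.span_base
            simp: op_range_def)
    qed
    have "Q b = b"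
      using \<psi> by (simp add: Q v_def)
    moreover have "Q (P x) = P x" for x
      by (simp add: Q PP)
    ultimately show "cspan (insert b (op_range P)) \<subseteq> op_range Q"
      by (intro cvec.span_minimal csubspace_op_range) (auto simp: op_range_def image_iff; metis)
  qed
  then show ?thesis
    using QQ by blast
qed

lemma projection_onto_vanishing:
  fixes P :: "'a::complex_normed_vector \<Rightarrow>\<^sub>C\<^sub>L 'a"
  assumes P: "P o\<^sub>C\<^sub>L P = P" and "finite \<Phi>"
  shows "\<exists>Q :: 'a \<Rightarrow>\<^sub>C\<^sub>L 'a. Q o\<^sub>C\<^sub>L Q = Q \<and> op_range Q = op_range P \<inter> vanishing \<Phi> \<and>
    finite_rank_mod True (P - Q)"
  using \<open>finite \<Phi>\<close>
proof induction
  case empty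
  have "finite_rank_mod True (P - P)"
    unfolding finite_rank_mod_def by (auto simp: op_range_def intro!: exI [of _ "{}"])
  then show ?case
    using P by auto
next
  case (insert \<phi> \<Phi>)
  then obtain Q :: "'a \<Rightarrow>\<^sub>C\<^sub>L 'a" where Q: "Q o\<^sub>C\<^sub>L Q = Q" "op_range Q = op_range P \<inter> vanishing \<Phi>"
      "finite_rank_mod True (P - Q)"
    by blast
  have QQ: "Q (Q x) = Q x" for x
    using Q(1) by (metis cblinfun_apply_simps(2))
  have range: "op_range Q = {x. Q x = x}"
    by (rule op_range_projection [OF Q(1)])
  show ?case
  proof (cases "\<forall>x\<in>op_range Q. \<phi> x = 0")
    case True
    then have "op_range Q = op_range P \<inter> vanishing (insert \<phi> \<Phi>)"
      unfolding Q(2) vanishing_insert by blast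
    then show ?thesis
      using Q by blast
  next
    case False
    then obtain e0 where e0: "Q e0 = e0" "\<phi> e0 \<noteq> 0"
      by (auto simp: range)
    define e where "e = inverse (\<phi> e0) *\<^sub>C e0"
    have e: "Q e = e" "\<phi> e = 1"
      using e0 by (simp_all add: e_def)
    obtain R :: "'a \<Rightarrow>\<^sub>C\<^sub>L 'a" where R: "\<And>x. R x = (\<phi> o\<^sub>C\<^sub>L Q) x *\<^sub>C e"
      using rank_one_op by metis
    define Q' where "Q' = Q - R"
    have Q': "Q' x = Q x - \<phi> (Q x) *\<^sub>C e" for x
      by (simp add: Q'_def R)
    have Q'_idem: "Q' o\<^sub>C\<^sub>L Q' = Q'"
      by (intro cblinfun_eqI) (simp add: Q' QQ e)
    have "Q' x = x \<longleftrightarrow> Q x = x \<and> \<phi> x = 0" for x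
    proof
      assume x: "Q' x = x"
      have "Q (Q' x) = Q' x" "\<phi> (Q' x) = 0"
        by (simp_all add: Q' QQ e)
      then show "Q x = x \<and> \<phi> x = 0"
        unfolding x by blast
    qed (simp add: Q')
    then have "op_range Q' = op_range Q \<inter> {x. \<phi> x = 0}"
      unfolding op_range_projection [OF Q'_idem] range by blast
    then have "op_range Q' = op_range P \<inter> vanishing (insert \<phi> \<Phi>)"
      unfolding Q(2) vanishing_insert by blast
    moreover have "finite_rank_mod True ((P - Q) + R)"
    proof (rule finite_rank_mod_add [OF Q(3)])
      show "finite_rank_mod True R"
        unfolding finite_rank_mod_def
        by (intro exI [of _ "{e}"]) (auto simp: op_range_def R cvec.span_singleton)
    qed
    moreover have "(P - Q) + R = P - Q'"
      by (simp add: Q'_def)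
    ultimately show ?thesis
      using Q'_idem by metis
  qed
qed

text \<open>If \<open>S T = I\<close> on \<open>vanishing \<Phi>\<close> and \<open>P\<close> projects onto that space, then \<open>T P S\<close> projects onto
  \<open>T(vanishing \<Phi>)\<close>, to which only finitely many vectors have to be added to reach the range of \<open>T\<close>.\<close>

lemma Phi_l_iff: "T \<in> Phi_l \<longleftrightarrow> left_invertible_mod True T"
  for T :: "'a::cbanach \<Rightarrow>\<^sub>C\<^sub>L 'a"
proof
  assume "T \<in> Phi_l"
  then obtain F Z where F: "finite F" "cspan F = kernel T"
      and Z: "csubspace Z" "closed Z" "op_range T \<inter> Z = {0}"
        "{x + y |x y. x \<in> op_range T \<and> y \<in> Z} = UNIV"
    unfolding Phi_l_def nullity_finite_iff closed_complemented_def by blast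
  obtain \<Phi> :: "('a \<Rightarrow>\<^sub>C\<^sub>L complex) set" where \<Phi>:
      "vanishing \<Phi> \<inter> cspan F = {0}" "\<And>x. \<exists>n\<in>vanishing \<Phi>. x - n \<in> cspan F"
    using finite_dim_complement [OF F(1)] by metis
  have "\<exists>z\<in>Z. y - z \<in> op_range T" for y
  proof -
    have "y \<in> {x + y |x y. x \<in> op_range T \<and> y \<in> Z}"
      unfolding Z(4) by simp
    then show ?thesis
      by force
  qed
  then obtain S :: "'a \<Rightarrow>\<^sub>C\<^sub>L 'a" where S: "\<And>x. x - S (T x) \<in> kernel T"
    using generalized_inverse [OF csubspace_vanishing closed_vanishing _ _ Z(1,2), of \<Phi> T] \<Phi> Z(3)
    unfolding F(2) by (auto simp: Int_commute)
  then show "left_invertible_mod True T"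
    unfolding left_invertible_mod_def finite_rank_mod_def
    using F by (intro exI [of _ S] exI [of _ F]) (auto simp: op_range_def)
next
  assume left: "left_invertible_mod True T"
  then obtain S where S: "finite_rank_mod True (id_cblinfun - S o\<^sub>C\<^sub>L T)"
    by (auto simp: left_invertible_mod_def)
  obtain \<Phi> where \<Phi>: "finite \<Phi>" "\<And>x. x \<in> vanishing \<Phi> \<Longrightarrow> (id_cblinfun - S o\<^sub>C\<^sub>L T) x = 0"
    using finite_rank_vanishing [OF S] by metis
  have ST: "S (T x) = x" if "x \<in> vanishing \<Phi>" for x
    using \<Phi>(2) [OF that] by simp
  have "id_cblinfun o\<^sub>C\<^sub>L id_cblinfun = (id_cblinfun :: 'a \<Rightarrow>\<^sub>C\<^sub>L 'a)" "op_range (id_cblinfun :: 'a \<Rightarrow>\<^sub>C\<^sub>L 'a) = UNIV"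
    by (auto intro: cblinfun_eqI simp: op_range_def)
  then obtain P :: "'a \<Rightarrow>\<^sub>C\<^sub>L 'a" where P: "P o\<^sub>C\<^sub>L P = P" "op_range P = vanishing \<Phi>"
    using projection_onto_vanishing [OF _ \<Phi>(1), of id_cblinfun] by auto
  have Pmem: "P x \<in> vanishing \<Phi>" for x
    using P(2) by (auto simp: op_range_def)
  have Pfix: "P x = x" if "x \<in> vanishing \<Phi>" for x
    using that op_range_projection [OF P(1)] P(2) by auto
  let ?R = "T o\<^sub>C\<^sub>L P o\<^sub>C\<^sub>L S"
  have R: "?R o\<^sub>C\<^sub>L ?R = ?R"
    by (intro cblinfun_eqI) (simp add: ST Pmem Pfix)
  have rangeR: "op_range ?R = cblinfun_apply T ` vanishing \<Phi>"
  proof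
    show "op_range ?R \<subseteq> cblinfun_apply T ` vanishing \<Phi>"
      using Pmem by (auto simp: op_range_def)
    show "cblinfun_apply T ` vanishing \<Phi> \<subseteq> op_range ?R"
    proof
      fix y assume "y \<in> cblinfun_apply T ` vanishing \<Phi>"
      then obtain x where "x \<in> vanishing \<Phi>" "y = T x"
        by blast
      then have "?R y = y"
        by (simp add: ST Pfix)
      then show "y \<in> op_range ?R"
        unfolding op_range_def by (metis rangeI)
    qed
  qed
  have "\<exists>Q :: 'a \<Rightarrow>\<^sub>C\<^sub>L 'a. Q o\<^sub>C\<^sub>L Q = Q \<and> op_range Q = cspan (E \<union> op_range ?R)" if "finite E" for E
    using that
  proof induction
    case empty
    show ?case
      using R csubspace_op_range [of ?R] by (metis Un_empty_left cvec.span_eq_iff)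
  next
    case (insert b E)
    then obtain Q :: "'a \<Rightarrow>\<^sub>C\<^sub>L 'a" where Q: "Q o\<^sub>C\<^sub>L Q = Q" "op_range Q = cspan (E \<union> op_range ?R)"
      by blast
    show ?case
      using projection_onto_cspan_insert [OF Q(1), of b]
      unfolding Q(2) cspan_insert_cspan by simp
  qed
  then obtain Q :: "'a \<Rightarrow>\<^sub>C\<^sub>L 'a" where "Q o\<^sub>C\<^sub>L Q = Q" "op_range Q = op_range T"
    using op_range_eq_cspan [OF \<Phi>(1), of T] rangeR by metis
  then have "closed_complemented (op_range T)"
    using closed_complemented_op_range_projection by metis
  moreover have "nullity T < \<infinity>"
    unfolding nullity_finite_iff
    using left_invertible_mod_imp_bounded_below_mod [OF left] by (auto simp: bounded_below_mod_iff)
  ultimately show "T \<in> Phi_l"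
    by (simp add: Phi_l_def)
qed

text \<open>If \<open>T S = I\<close> on \<open>vanishing \<Phi>\<close> and \<open>P\<close> projects onto that space, then \<open>I - S P T\<close> projects onto the
  set of all \<open>x\<close> with \<open>P (T x) = 0\<close>, inside which finitely many linear equations describe the kernel of \<open>T\<close>.\<close>

lemma Phi_r_iff: "T \<in> Phi_r \<longleftrightarrow> right_invertible_mod True T"
  for T :: "'a::cbanach \<Rightarrow>\<^sub>C\<^sub>L 'a"
proof
  assume T: "T \<in> Phi_r"
  then obtain N where N: "csubspace N" "closed N" "kernel T \<inter> N = {0}"
        "{x + y |x y. x \<in> kernel T \<and> y \<in> N} = UNIV"
    by (auto simp: Phi_r_def closed_complemented_def)
  have "T \<in> Phi_minus"
    using T by (simp add: Phi_r_def Phi_minus_def)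
  then obtain E where "finite E" "\<forall>y. \<exists>z\<in>cspan E. y - z \<in> op_range T"
    by (auto simp: Phi_minus_iff onto_mod_def)
  then obtain G where G: "finite G" "quotient_basis (op_range T) G"
    using exists_quotient_basis [OF csubspace_op_range] finite_subset by metis
  have "\<exists>n\<in>N. x - n \<in> kernel T" for x
  proof -
    have "x \<in> {x + y |x y. x \<in> kernel T \<and> y \<in> N}"
      unfolding N(4) by simp
    then show ?thesis
      by force
  qed
  then obtain S :: "'a \<Rightarrow>\<^sub>C\<^sub>L 'a" where S: "\<And>y. y - T (S y) \<in> cspan G"
    using generalized_inverse [OF N(1,2) _ _ cvec.subspace_span closed_cspan_finite [OF G(1)], of T]
      N(3) quotient_basis_Int [OF G csubspace_op_range] G(2)
    unfolding quotient_basis_cspan [OF G(1)] by (auto simp: Int_commute)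
  then show "right_invertible_mod True T"
    unfolding right_invertible_mod_def finite_rank_mod_def
    using G by (intro exI [of _ S] exI [of _ G]) (auto simp: op_range_def)
next
  assume right: "right_invertible_mod True T"
  then obtain S where S: "finite_rank_mod True (id_cblinfun - T o\<^sub>C\<^sub>L S)"
    by (auto simp: right_invertible_mod_def)
  obtain \<Phi> where \<Phi>: "finite \<Phi>" "\<And>x. x \<in> vanishing \<Phi> \<Longrightarrow> (id_cblinfun - T o\<^sub>C\<^sub>L S) x = 0"
    using finite_rank_vanishing [OF S] by metis
  have TS: "T (S x) = x" if "x \<in> vanishing \<Phi>" for x
    using \<Phi>(2) [OF that] by simp
  have "id_cblinfun o\<^sub>C\<^sub>L id_cblinfun = (id_cblinfun :: 'a \<Rightarrow>\<^sub>C\<^sub>L 'a)" "op_range (id_cblinfun :: 'a \<Rightarrow>\<^sub>C\<^sub>L 'a) = UNIV"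
    by (auto intro: cblinfun_eqI simp: op_range_def)
  then obtain P :: "'a \<Rightarrow>\<^sub>C\<^sub>L 'a" where P: "P o\<^sub>C\<^sub>L P = P" "op_range P = vanishing \<Phi>"
      "finite_rank_mod True (id_cblinfun - P)"
    using projection_onto_vanishing [OF _ \<Phi>(1), of id_cblinfun] by auto
  obtain \<Psi> where \<Psi>: "finite \<Psi>" "\<And>x. x \<in> vanishing \<Psi> \<Longrightarrow> (id_cblinfun - P) x = 0"
    using finite_rank_vanishing [OF P(3)] by metis
  have Pmem: "P x \<in> vanishing \<Phi>" for x
    using P(2) by (auto simp: op_range_def)
  have PP: "P (P x) = P x" for x
    using P(1) by (metis cblinfun_apply_simps(2))
  let ?Q = "id_cblinfun - S o\<^sub>C\<^sub>L P o\<^sub>C\<^sub>L T"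
  have Q: "?Q o\<^sub>C\<^sub>L ?Q = ?Q"
    by (intro cblinfun_eqI) (simp add: TS Pmem PP)
  let ?\<Theta> = "(\<lambda>\<psi>. \<psi> o\<^sub>C\<^sub>L T) ` \<Psi>"
  have "kernel T = op_range ?Q \<inter> vanishing ?\<Theta>"
  proof
    show "kernel T \<subseteq> op_range ?Q \<inter> vanishing ?\<Theta>"
      unfolding op_range_projection [OF Q] by (auto simp: kernel_def vanishing_def)
    show "op_range ?Q \<inter> vanishing ?\<Theta> \<subseteq> kernel T"
    proof
      fix x assume x: "x \<in> op_range ?Q \<inter> vanishing ?\<Theta>"
      then obtain w where "x = ?Q w"
        by (auto simp: op_range_def)
      then have "P (T x) = 0"
        by (simp add: TS Pmem PP)
      moreover have "T x \<in> vanishing \<Psi>"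
        using x by (auto simp: vanishing_def)
      ultimately show "x \<in> kernel T"
        using \<Psi>(2) [of "T x"] by (simp add: kernel_def)
    qed
  qed
  then obtain Q' :: "'a \<Rightarrow>\<^sub>C\<^sub>L 'a" where "Q' o\<^sub>C\<^sub>L Q' = Q'" "op_range Q' = kernel T"
    using projection_onto_vanishing [OF Q, of ?\<Theta>] \<Psi>(1) by auto
  then have "closed_complemented (kernel T)"
    using closed_complemented_op_range_projection by metis
  moreover have "T \<in> Phi_minus"
    using right_invertible_mod_imp_onto_mod [OF right] by (simp add: Phi_minus_iff)
  ultimately show "T \<in> Phi_r"
    by (simp add: Phi_r_def Phi_minus_def)
qed

section \<open>The single valued extension property and semi-Fredholm operators\<close>

text \<open>The bound on the nullity makes the kernel finite-dimensional, and trivial if \<open>T\<close> is surjective.\<close>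

lemma SVEP_imp_bounded_below_mod:
  fixes T :: "'a::cbanach \<Rightarrow>\<^sub>C\<^sub>L 'a"
  assumes onto: "onto_mod p T" and svep: "SVEP_at T 0"
  shows "bounded_below_mod p T"
proof -
  obtain F where F: "finite F" "p \<or> F = {}" "\<And>y. \<exists>z\<in>cspan F. y - z \<in> op_range T"
    using onto by (auto simp: onto_mod_def)
  have le: "card G \<le> card F" if "finite G" "G \<subseteq> kernel T" "\<not> cvec.dependent G" for G
    by (rule SVEP_imp_nullity_le_deficiency [OF F(1,3) that svep])
  obtain B where B: "B \<subseteq> kernel T" "\<not> cvec.dependent B" "kernel T \<subseteq> cspan B"
    using cvec.maximal_independent_subset by metis
  have "finite B"
  proof (rule ccontr)
    assume "infinite B"
    then obtain G where "finite G" "card G = Suc (card F)" "G \<subseteq> B"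
      using infinite_arbitrarily_large by metis
    then show False
      using le [of G] B cvec.independent_mono [OF B(2)] by auto
  qed
  moreover have "p \<or> B = {}"
    using le [OF \<open>finite B\<close> B(1,2)] F(2) \<open>finite B\<close> by auto
  moreover have "cspan B = kernel T"
    using cvec.span_minimal [OF B(1) csubspace_kernel] B(3) by blast
  ultimately show ?thesis
    unfolding bounded_below_mod_iff using onto_mod_closed_range [OF onto] by blast
qed

text \<open>Given \<open>\<eta>\<close>, the functional \<open>T x \<mapsto> \<eta> x\<close> on the image of \<open>vanishing \<Phi>\<close> is bounded because \<open>T\<close> is bounded
  below there. An extension \<open>\<xi>\<close> satisfies \<open>\<eta> - \<xi> T = 0\<close> on \<open>vanishing \<Phi>\<close>, so this difference is a combination
  of \<open>\<Phi>\<close>.\<close>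

lemma onto_mod_dual:
  fixes T :: "'a::cbanach \<Rightarrow>\<^sub>C\<^sub>L 'a"
  assumes "bounded_below_mod p T"
  shows "onto_mod p (dual_op T)"
proof -
  obtain \<Phi> c where \<Phi>: "finite \<Phi>" "p \<or> \<Phi> = {}"
      and bd: "\<And>x. x \<in> vanishing \<Phi> \<Longrightarrow> norm x \<le> c * norm (T x)"
    using assms by (auto simp: bounded_below_mod_def)
  let ?N = "vanishing \<Phi>"
  have inj: "x = x'" if "x \<in> ?N" "x' \<in> ?N" "T x = T x'" for x x'
    using bd [of "x - x'"] that cvec.subspace_diff [OF csubspace_vanishing that(1,2)] by simp
  have "\<exists>z\<in>cspan \<Phi>. \<eta> - z \<in> op_range (dual_op T)" for \<eta>
  proof -
    define s where "s y = (THE x. x \<in> ?N \<and> T x = y)" for y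
    have s_eq: "s (T x) = x" if "x \<in> ?N" for x
      unfolding s_def using that inj by blast
    have "\<exists>\<xi> :: 'a \<Rightarrow>\<^sub>C\<^sub>L complex. \<forall>y\<in>cblinfun_apply T ` ?N. \<xi> y = \<eta> (s y)"
    proof (rule complex_Hahn_Banach [where K = "norm \<eta> * \<bar>c\<bar>"])
      show "csubspace (cblinfun_apply T ` ?N)"
        by (rule csubspace_image [OF csubspace_vanishing])
      show "\<eta> (s (y + y')) = \<eta> (s y) + \<eta> (s y')"
        if y: "y \<in> cblinfun_apply T ` ?N" "y' \<in> cblinfun_apply T ` ?N" for y y'
      proof -
        obtain x x' where x: "x \<in> ?N" "x' \<in> ?N" "y = T x" "y' = T x'"
          using y by blast
        then show ?thesis
          using s_eq [OF cvec.subspace_add [OF csubspace_vanishing x(1,2)]] by (simp add: s_eq)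
      qed
      show "\<eta> (s (k *\<^sub>C y)) = k * \<eta> (s y)" if y: "y \<in> cblinfun_apply T ` ?N" for k y
      proof -
        obtain x where x: "x \<in> ?N" "y = T x"
          using y by blast
        then show ?thesis
          using s_eq [OF cvec.subspace_scale [OF csubspace_vanishing x(1)]] by (simp add: s_eq)
      qed
      show "cmod (\<eta> (s y)) \<le> norm \<eta> * \<bar>c\<bar> * norm y" if y: "y \<in> cblinfun_apply T ` ?N" for y
      proof -
        obtain x where x: "x \<in> ?N" "y = T x"
          using y by blast
        have "norm x \<le> \<bar>c\<bar> * norm y"
          using bd [OF x(1)] mult_right_mono [OF abs_ge_self [of c] norm_ge_zero [of y]] by (simp add: x(2))
        then have "norm \<eta> * norm x \<le> norm \<eta> * (\<bar>c\<bar> * norm y)"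
          by (intro mult_left_mono) auto
        then show ?thesis
          using cblinfun_norm_le [of \<eta> x] by (simp add: x s_eq mult.assoc)
      qed
    qed simp
    then obtain \<xi> :: "'a \<Rightarrow>\<^sub>C\<^sub>L complex" where \<xi>: "\<And>x. x \<in> ?N \<Longrightarrow> \<xi> (T x) = \<eta> x"
      using s_eq by auto
    have "\<eta> - dual_op T \<xi> \<in> cspan \<Phi>"
      by (rule functional_in_cspan [OF \<Phi>(1)]) (simp add: \<xi>)
    moreover have "\<eta> - (\<eta> - dual_op T \<xi>) \<in> op_range (dual_op T)"
      by (simp add: op_range_def)
    ultimately show ?thesis
      by blast
  qed
  then show ?thesis
    using \<Phi> unfolding onto_mod_def by blast
qed

text \<open>The kernel of the dual operator consists of the functionals that annihilate the range of \<open>T\<close>. Once it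
  is finite-dimensional, finitely many functionals cut out the range, which is closed.\<close>

lemma SVEP_dual_imp_onto_mod:
  fixes T :: "'a::cbanach \<Rightarrow>\<^sub>C\<^sub>L 'a"
  assumes bb: "bounded_below_mod p T" and svep: "SVEP_at (dual_op T) 0"
  shows "onto_mod p T"
proof -
  have "bounded_below_mod p (dual_op T)"
    by (rule SVEP_imp_bounded_below_mod [OF onto_mod_dual [OF bb] svep])
  then obtain \<Psi> where \<Psi>: "finite \<Psi>" "p \<or> \<Psi> = {}" "cspan \<Psi> = kernel (dual_op T)"
    by (auto simp: bounded_below_mod_iff)
  have range: "vanishing \<Psi> \<subseteq> op_range T"
  proof
    fix x assume x: "x \<in> vanishing \<Psi>"
    show "x \<in> op_range T"
    proof (rule ccontr)
      assume "x \<notin> op_range T"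
      then obtain \<phi> :: "'a \<Rightarrow>\<^sub>C\<^sub>L complex" where \<phi>: "\<phi> x = 1" "\<And>y. y \<in> op_range T \<Longrightarrow> \<phi> y = 0"
        using closed_subspace_separation [OF csubspace_op_range] bb
        unfolding bounded_below_mod_iff by metis
      have "\<phi> o\<^sub>C\<^sub>L T = 0"
        by (intro cblinfun_eqI) (simp add: \<phi>(2) op_range_def)
      then have "\<phi> \<in> cspan \<Psi>"
        unfolding \<Psi>(3) by (simp add: kernel_def)
      then show False
        using vanishing_cspan x \<phi>(1) by force
    qed
  qed
  obtain F where F: "finite F" "\<Psi> = {} \<longrightarrow> F = {}" "\<forall>x. \<exists>z\<in>cspan F. x - z \<in> vanishing \<Psi>"
    using vanishing_finite_codim [OF cvec.subspace_UNIV \<Psi>(1)] by auto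
  then have "\<forall>x. \<exists>z\<in>cspan F. x - z \<in> op_range T"
    using range by blast
  then show ?thesis
    using F(1,2) \<Psi>(2) unfolding onto_mod_def by (intro exI [of _ F]) blast
qed

section \<open>Upper triangular operator matrices\<close>

text \<open>The first component is an invariant subspace on which the matrix operator acts as \<open>A\<close>; so \<open>A\<close>
  inherits the left-hand properties.\<close>

lemma bounded_below_mod_upper_triangular_fst:
  fixes A :: "'a::complex_normed_vector \<Rightarrow>\<^sub>C\<^sub>L 'a" and B :: "'b::complex_normed_vector \<Rightarrow>\<^sub>C\<^sub>L 'b"
  assumes "bounded_below_mod p (upper_triangular_op A C B)"
  shows "bounded_below_mod p A"
proof -
  obtain \<Phi> c where \<Phi>: "finite \<Phi>" "p \<or> \<Phi> = {}"
      "\<And>w. w \<in> vanishing \<Phi> \<Longrightarrow> norm w \<le> c * norm (upper_triangular_op A C B w)"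
    using assms by (auto simp: bounded_below_mod_def)
  have "norm x \<le> c * norm (A x)" if "x \<in> vanishing ((\<lambda>\<phi>. \<phi> o\<^sub>C\<^sub>L inl_op) ` \<Phi>)" for x
    using \<Phi>(3) [of "(x, 0)"] that by (auto simp: vanishing_def norm_Pair)
  then show ?thesis
    using \<Phi>(1,2) unfolding bounded_below_mod_def
    by (intro exI [of _ "(\<lambda>\<phi>. \<phi> o\<^sub>C\<^sub>L inl_op) ` \<Phi>"] exI [of _ c]) auto
qed

lemma left_invertible_mod_upper_triangular_fst:
  fixes A :: "'a::complex_normed_vector \<Rightarrow>\<^sub>C\<^sub>L 'a" and B :: "'b::complex_normed_vector \<Rightarrow>\<^sub>C\<^sub>L 'b"
  assumes "left_invertible_mod p (upper_triangular_op A C B)"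
  shows "left_invertible_mod p A"
proof -
  obtain S where S: "finite_rank_mod p (id_cblinfun - S o\<^sub>C\<^sub>L upper_triangular_op A C B)"
    using assms by (auto simp: left_invertible_mod_def)
  have "finite_rank_mod p (fst_op o\<^sub>C\<^sub>L ((id_cblinfun - S o\<^sub>C\<^sub>L upper_triangular_op A C B) o\<^sub>C\<^sub>L inl_op))"
    by (intro finite_rank_mod_compose_left finite_rank_mod_compose_right S)
  moreover have "fst_op o\<^sub>C\<^sub>L ((id_cblinfun - S o\<^sub>C\<^sub>L upper_triangular_op A C B) o\<^sub>C\<^sub>L inl_op)
      = id_cblinfun - (fst_op o\<^sub>C\<^sub>L S o\<^sub>C\<^sub>L inl_op) o\<^sub>C\<^sub>L A"
    by (intro cblinfun_eqI) simp
  ultimately show ?thesis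
    unfolding left_invertible_mod_def by metis
qed

text \<open>Modulo the first component the matrix operator acts as \<open>B\<close>; so \<open>B\<close> inherits the right-hand
  properties.\<close>

lemma onto_mod_upper_triangular_snd:
  fixes A :: "'a::complex_normed_vector \<Rightarrow>\<^sub>C\<^sub>L 'a" and B :: "'b::complex_normed_vector \<Rightarrow>\<^sub>C\<^sub>L 'b"
  assumes "onto_mod p (upper_triangular_op A C B)"
  shows "onto_mod p B"
proof -
  obtain F where F: "finite F" "p \<or> F = {}"
      "\<And>w. \<exists>z\<in>cspan F. w - z \<in> op_range (upper_triangular_op A C B)"
    using assms by (auto simp: onto_mod_def)
  have "\<exists>z\<in>cspan (cblinfun_apply snd_op ` F). y - z \<in> op_range B" for y
  proof -
    obtain z w where z: "z \<in> cspan F" "(0, y) - z = upper_triangular_op A C B w"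
      using F(3) [of "(0, y)"] by (auto simp: op_range_def)
    have "y - snd z = B (snd w)"
      using arg_cong [OF z(2), of snd] by (cases w) simp
    then show ?thesis
      using z(1) unfolding cspan_image op_range_def by (intro bexI [of _ "snd_op z"]) auto
  qed
  then show ?thesis
    using F(1,2) unfolding onto_mod_def by (intro exI [of _ "cblinfun_apply snd_op ` F"]) auto
qed

lemma right_invertible_mod_upper_triangular_snd:
  fixes A :: "'a::complex_normed_vector \<Rightarrow>\<^sub>C\<^sub>L 'a" and B :: "'b::complex_normed_vector \<Rightarrow>\<^sub>C\<^sub>L 'b"
  assumes "right_invertible_mod p (upper_triangular_op A C B)"
  shows "right_invertible_mod p B"
proof -
  obtain S where S: "finite_rank_mod p (id_cblinfun - upper_triangular_op A C B o\<^sub>C\<^sub>L S)"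
    using assms by (auto simp: right_invertible_mod_def)
  have "finite_rank_mod p (snd_op o\<^sub>C\<^sub>L ((id_cblinfun - upper_triangular_op A C B o\<^sub>C\<^sub>L S) o\<^sub>C\<^sub>L inr_op))"
    by (intro finite_rank_mod_compose_left finite_rank_mod_compose_right S)
  moreover have "snd (upper_triangular_op A C B w) = B (snd w)" for w
    by (cases w) simp
  then have "snd_op o\<^sub>C\<^sub>L ((id_cblinfun - upper_triangular_op A C B o\<^sub>C\<^sub>L S) o\<^sub>C\<^sub>L inr_op)
      = id_cblinfun - B o\<^sub>C\<^sub>L (snd_op o\<^sub>C\<^sub>L S o\<^sub>C\<^sub>L inr_op)"
    by (intro cblinfun_eqI) simp
  ultimately show ?thesis
    unfolding right_invertible_mod_def by metis
qed

text \<open>If \<open>A U = I\<close> up to finite rank, then \<open>W y = (- U C y, y)\<close> is sent by the matrix operator to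
  \<open>(0, B y)\<close> up to finite rank, which transfers lower bounds and left inverses to \<open>B\<close>.\<close>

lemma bounded_below_mod_upper_triangular_snd:
  fixes A :: "'a::complex_normed_vector \<Rightarrow>\<^sub>C\<^sub>L 'a" and B :: "'b::complex_normed_vector \<Rightarrow>\<^sub>C\<^sub>L 'b"
  assumes M: "bounded_below_mod p (upper_triangular_op A C B)" and A: "right_invertible_mod p A"
  shows "bounded_below_mod p B"
proof -
  obtain \<Phi> c where \<Phi>: "finite \<Phi>" "p \<or> \<Phi> = {}"
      "\<And>w. w \<in> vanishing \<Phi> \<Longrightarrow> norm w \<le> c * norm (upper_triangular_op A C B w)"
    using M by (auto simp: bounded_below_mod_def)
  obtain U where U: "finite_rank_mod p (id_cblinfun - A o\<^sub>C\<^sub>L U)"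
    using A by (auto simp: right_invertible_mod_def)
  obtain \<Psi> where \<Psi>: "finite \<Psi>" "p \<or> \<Psi> = {}" "\<And>x. x \<in> vanishing \<Psi> \<Longrightarrow> (id_cblinfun - A o\<^sub>C\<^sub>L U) x = 0"
    using finite_rank_vanishing [OF U] by metis
  define W where "W = inr_op - inl_op o\<^sub>C\<^sub>L U o\<^sub>C\<^sub>L C"
  have W: "W y = (- U (C y), y)" for y
    by (simp add: W_def)
  let ?\<Theta> = "(\<lambda>\<phi>. \<phi> o\<^sub>C\<^sub>L W) ` \<Phi> \<union> (\<lambda>\<psi>. \<psi> o\<^sub>C\<^sub>L C) ` \<Psi>"
  have "norm y \<le> c * norm (B y)" if y: "y \<in> vanishing ?\<Theta>" for y
  proof -
    have "W y \<in> vanishing \<Phi>" "C y \<in> vanishing \<Psi>"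
      using y by (simp_all add: vanishing_Un vanishing_compose)
    then have "norm (W y) \<le> c * norm (upper_triangular_op A C B (W y))" "A (U (C y)) = C y"
      using \<Phi>(3) \<Psi>(3) by auto
    then have "norm (W y) \<le> c * norm (B y)"
      by (simp add: W norm_Pair)
    then show ?thesis
      using norm_snd_le [of y "- U (C y)"] by (simp add: W)
  qed
  then show ?thesis
    using \<Phi>(1,2) \<Psi>(1,2) unfolding bounded_below_mod_def
    by (intro exI [of _ ?\<Theta>] exI [of _ c]) auto
qed

lemma left_invertible_mod_upper_triangular_snd:
  fixes A :: "'a::complex_normed_vector \<Rightarrow>\<^sub>C\<^sub>L 'a" and B :: "'b::complex_normed_vector \<Rightarrow>\<^sub>C\<^sub>L 'b"
  assumes M: "left_invertible_mod p (upper_triangular_op A C B)" and A: "right_invertible_mod p A"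
  shows "left_invertible_mod p B"
proof -
  let ?M = "upper_triangular_op A C B"
  obtain S where S: "finite_rank_mod p (id_cblinfun - S o\<^sub>C\<^sub>L ?M)"
    using M by (auto simp: left_invertible_mod_def)
  obtain U where U: "finite_rank_mod p (id_cblinfun - A o\<^sub>C\<^sub>L U)"
    using A by (auto simp: right_invertible_mod_def)
  define W where "W = inr_op - inl_op o\<^sub>C\<^sub>L U o\<^sub>C\<^sub>L C"
  have W: "W y = (- U (C y), y)" for y
    by (simp add: W_def)
  have "finite_rank_mod p (snd_op o\<^sub>C\<^sub>L ((id_cblinfun - S o\<^sub>C\<^sub>L ?M) o\<^sub>C\<^sub>L W)
      + (snd_op o\<^sub>C\<^sub>L S o\<^sub>C\<^sub>L inl_op) o\<^sub>C\<^sub>L ((id_cblinfun - A o\<^sub>C\<^sub>L U) o\<^sub>C\<^sub>L C))"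
    by (intro finite_rank_mod_add finite_rank_mod_compose_left finite_rank_mod_compose_right S U)
  moreover have "snd_op o\<^sub>C\<^sub>L ((id_cblinfun - S o\<^sub>C\<^sub>L ?M) o\<^sub>C\<^sub>L W)
      + (snd_op o\<^sub>C\<^sub>L S o\<^sub>C\<^sub>L inl_op) o\<^sub>C\<^sub>L ((id_cblinfun - A o\<^sub>C\<^sub>L U) o\<^sub>C\<^sub>L C)
      = id_cblinfun - (snd_op o\<^sub>C\<^sub>L S o\<^sub>C\<^sub>L inr_op) o\<^sub>C\<^sub>L B"
  proof (rule cblinfun_eqI)
    fix y
    have "(C y - A (U (C y)), B y) = (C y - A (U (C y)), 0) + (0, B y)"
      by simp
    then have "S (C y - A (U (C y)), B y) = S (C y - A (U (C y)), 0) + S (0, B y)"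
      by (simp only: cblinfun_add)
    moreover have "S (C y - A (U (C y)), 0) = S (C y, 0) - S (A (U (C y)), 0)"
      by (simp flip: cblinfun_diff)
    ultimately show "(snd_op o\<^sub>C\<^sub>L ((id_cblinfun - S o\<^sub>C\<^sub>L ?M) o\<^sub>C\<^sub>L W)
        + (snd_op o\<^sub>C\<^sub>L S o\<^sub>C\<^sub>L inl_op) o\<^sub>C\<^sub>L ((id_cblinfun - A o\<^sub>C\<^sub>L U) o\<^sub>C\<^sub>L C)) y
      = (id_cblinfun - (snd_op o\<^sub>C\<^sub>L S o\<^sub>C\<^sub>L inr_op) o\<^sub>C\<^sub>L B) y"
      by (simp add: W)
  qed
  ultimately show ?thesis
    unfolding left_invertible_mod_def by metis
qed

text \<open>If \<open>(x, 0)\<close> is hit by \<open>(x', y')\<close> up to finitely many dimensions, then \<open>B y'\<close> is confined to finitely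
  many dimensions, hence so is \<open>y'\<close> because \<open>U B = I\<close> up to finite rank; thus \<open>A x'\<close> equals \<open>x\<close> up to finitely
  many dimensions.\<close>

lemma onto_mod_upper_triangular_fst:
  fixes A :: "'a::complex_normed_vector \<Rightarrow>\<^sub>C\<^sub>L 'a" and B :: "'b::complex_normed_vector \<Rightarrow>\<^sub>C\<^sub>L 'b"
  assumes M: "onto_mod p (upper_triangular_op A C B)" and B: "left_invertible_mod p B"
  shows "onto_mod p A"
proof -
  obtain F where F: "finite F" "p \<or> F = {}"
      "\<And>w. \<exists>z\<in>cspan F. w - z \<in> op_range (upper_triangular_op A C B)"
    using M by (auto simp: onto_mod_def)
  obtain U G where G: "finite G" "p \<or> G = {}" "op_range (id_cblinfun - U o\<^sub>C\<^sub>L B) \<subseteq> cspan G"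
    using B by (auto simp: left_invertible_mod_def finite_rank_mod_def)
  let ?V = "fst_op - C o\<^sub>C\<^sub>L U o\<^sub>C\<^sub>L snd_op"
  let ?H = "cblinfun_apply ?V ` F \<union> cblinfun_apply C ` G"
  have "\<exists>z\<in>cspan ?H. x - z \<in> op_range A" for x
  proof -
    obtain z w where z: "z \<in> cspan F" "(x, 0) - z = upper_triangular_op A C B w"
      using F(3) [of "(x, 0)"] by (auto simp: op_range_def)
    obtain x' y' where w: "w = (x', y')"
      by fastforce
    have fst: "x - fst z = A x' + C y'" and snd: "B y' = - snd z"
      using arg_cong [OF z(2), of fst] arg_cong [OF z(2), of snd] by (simp_all add: w)
    define g where "g = (id_cblinfun - U o\<^sub>C\<^sub>L B) y'"
    have g: "g \<in> cspan G"
      using G(3) by (auto simp: g_def op_range_def)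
    have y': "y' = g - U (snd z)"
      by (simp add: g_def snd)
    have "?V z + C g \<in> cspan ?H"
      unfolding cvec.span_Un cspan_image using z(1) g by blast
    moreover have "x - (?V z + C g) = A x'"
      using fst by (simp add: y' algebra_simps)
    ultimately show ?thesis
      unfolding op_range_def by (metis rangeI)
  qed
  then show ?thesis
    using F(1,2) G(1,2) unfolding onto_mod_def by (intro exI [of _ ?H]) auto
qed

lemma right_invertible_mod_upper_triangular_fst:
  fixes A :: "'a::complex_normed_vector \<Rightarrow>\<^sub>C\<^sub>L 'a" and B :: "'b::complex_normed_vector \<Rightarrow>\<^sub>C\<^sub>L 'b"
  assumes M: "right_invertible_mod p (upper_triangular_op A C B)" and B: "left_invertible_mod p B"
  shows "right_invertible_mod p A"
proof -
  let ?M = "upper_triangular_op A C B"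
  obtain S where S: "finite_rank_mod p (id_cblinfun - ?M o\<^sub>C\<^sub>L S)"
    using M by (auto simp: right_invertible_mod_def)
  obtain U where U: "finite_rank_mod p (id_cblinfun - U o\<^sub>C\<^sub>L B)"
    using B by (auto simp: left_invertible_mod_def)
  define V where "V = fst_op - C o\<^sub>C\<^sub>L U o\<^sub>C\<^sub>L snd_op"
  have V: "V p = fst p - C (U (snd p))" for p
    by (simp add: V_def)
  have "finite_rank_mod p (V o\<^sub>C\<^sub>L ((id_cblinfun - ?M o\<^sub>C\<^sub>L S) o\<^sub>C\<^sub>L inl_op)
      + C o\<^sub>C\<^sub>L ((id_cblinfun - U o\<^sub>C\<^sub>L B) o\<^sub>C\<^sub>L (snd_op o\<^sub>C\<^sub>L S o\<^sub>C\<^sub>L inl_op)))"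
    by (intro finite_rank_mod_add finite_rank_mod_compose_left finite_rank_mod_compose_right S U)
  moreover have "V o\<^sub>C\<^sub>L ((id_cblinfun - ?M o\<^sub>C\<^sub>L S) o\<^sub>C\<^sub>L inl_op)
      + C o\<^sub>C\<^sub>L ((id_cblinfun - U o\<^sub>C\<^sub>L B) o\<^sub>C\<^sub>L (snd_op o\<^sub>C\<^sub>L S o\<^sub>C\<^sub>L inl_op))
      = id_cblinfun - A o\<^sub>C\<^sub>L (fst_op o\<^sub>C\<^sub>L S o\<^sub>C\<^sub>L inl_op)"
  proof (rule cblinfun_eqI)
    fix x
    obtain x' y' where "S (x, 0) = (x', y')"
      by fastforce
    then show "(V o\<^sub>C\<^sub>L ((id_cblinfun - ?M o\<^sub>C\<^sub>L S) o\<^sub>C\<^sub>L inl_op)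
        + C o\<^sub>C\<^sub>L ((id_cblinfun - U o\<^sub>C\<^sub>L B) o\<^sub>C\<^sub>L (snd_op o\<^sub>C\<^sub>L S o\<^sub>C\<^sub>L inl_op))) x
        = (id_cblinfun - A o\<^sub>C\<^sub>L (fst_op o\<^sub>C\<^sub>L S o\<^sub>C\<^sub>L inl_op)) x"
      by (simp add: V)
  qed
  ultimately show ?thesis
    unfolding right_invertible_mod_def by metis
qed

lemma bounded_below_mod_upper_triangular:
  fixes A :: "'a::complex_normed_vector \<Rightarrow>\<^sub>C\<^sub>L 'a" and B :: "'b::complex_normed_vector \<Rightarrow>\<^sub>C\<^sub>L 'b"
  assumes A: "bounded_below_mod p A" and B: "bounded_below_mod p B"
  shows "bounded_below_mod p (upper_triangular_op A C B)"
proof -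
  obtain \<Phi> c where \<Phi>: "finite \<Phi>" "p \<or> \<Phi> = {}" "\<And>x. x \<in> vanishing \<Phi> \<Longrightarrow> norm x \<le> c * norm (A x)"
    using A by (auto simp: bounded_below_mod_def)
  obtain \<Psi> d where \<Psi>: "finite \<Psi>" "p \<or> \<Psi> = {}" "\<And>y. y \<in> vanishing \<Psi> \<Longrightarrow> norm y \<le> d * norm (B y)"
    using B by (auto simp: bounded_below_mod_def)
  let ?\<Theta> = "(\<lambda>\<phi>. \<phi> o\<^sub>C\<^sub>L fst_op) ` \<Phi> \<union> (\<lambda>\<psi>. \<psi> o\<^sub>C\<^sub>L snd_op) ` \<Psi>"
  \<comment> \<open>First \<open>y\<close> is bounded through \<open>B y\<close>, then \<open>x\<close> through \<open>A x = (A x + C y) - C y\<close>.\<close>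
  define k where "k = \<bar>c\<bar> * (1 + norm C * \<bar>d\<bar>) + \<bar>d\<bar>"
  have "norm w \<le> k * norm (upper_triangular_op A C B w)" if w: "w \<in> vanishing ?\<Theta>" for w
  proof -
    obtain x y where xy: "w = (x, y)"
      by fastforce
    define m where "m = norm (upper_triangular_op A C B w)"
    have m: "norm (A x + C y) \<le> m" "norm (B y) \<le> m" "m \<ge> 0"
      using norm_fst_le [of "A x + C y" "B y"] norm_snd_le [of "B y" "A x + C y"]
      by (simp_all add: m_def xy)
    have "x \<in> vanishing \<Phi>" "y \<in> vanishing \<Psi>"
      using w by (simp_all add: vanishing_Un vanishing_compose xy)
    then have x: "norm x \<le> \<bar>c\<bar> * norm (A x)" and y: "norm y \<le> \<bar>d\<bar> * norm (B y)"
      using order_trans [OF \<Phi>(3) mult_right_mono [OF abs_ge_self norm_ge_zero]]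
        order_trans [OF \<Psi>(3) mult_right_mono [OF abs_ge_self norm_ge_zero]] by blast+
    have ym: "norm y \<le> \<bar>d\<bar> * m"
      using order_trans [OF y mult_left_mono [OF m(2)]] by simp
    have "norm (A x) \<le> norm (A x + C y) + norm (C y)"
      using norm_triangle_ineq4 [of "A x + C y" "C y"] by simp
    also have "\<dots> \<le> m + norm C * (\<bar>d\<bar> * m)"
      using m(1) order_trans [OF cblinfun_norm_le mult_left_mono [OF ym norm_ge_zero], of C] by simp
    finally have "norm x \<le> \<bar>c\<bar> * (m + norm C * (\<bar>d\<bar> * m))"
      using order_trans [OF x mult_left_mono] by simp
    then have "norm x + norm y \<le> k * m"
      using ym by (simp add: k_def algebra_simps)
    then show ?thesis
      using norm_Pair_le [of x y] by (simp add: m_def xy)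
  qed
  then show ?thesis
    using \<Phi>(1,2) \<Psi>(1,2) unfolding bounded_below_mod_def
    by (intro exI [of _ ?\<Theta>] exI [of _ k]) auto
qed

text \<open>The inverse of an invertible upper triangular matrix operator has the off-diagonal entry
  \<open>- S C U\<close>; the same formula serves one-sided inverses modulo finite rank.\<close>

lemma left_invertible_mod_upper_triangular:
  fixes A :: "'a::complex_normed_vector \<Rightarrow>\<^sub>C\<^sub>L 'a" and B :: "'b::complex_normed_vector \<Rightarrow>\<^sub>C\<^sub>L 'b"
  assumes A: "left_invertible_mod p A" and B: "left_invertible_mod p B"
  shows "left_invertible_mod p (upper_triangular_op A C B)"
proof -
  obtain S where S: "finite_rank_mod p (id_cblinfun - S o\<^sub>C\<^sub>L A)"
    using A by (auto simp: left_invertible_mod_def)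
  obtain U where U: "finite_rank_mod p (id_cblinfun - U o\<^sub>C\<^sub>L B)"
    using B by (auto simp: left_invertible_mod_def)
  let ?N = "upper_triangular_op S (- (S o\<^sub>C\<^sub>L C o\<^sub>C\<^sub>L U)) U"
  have "finite_rank_mod p ((inl_op o\<^sub>C\<^sub>L ((id_cblinfun - S o\<^sub>C\<^sub>L A) o\<^sub>C\<^sub>L fst_op))
      + ((inr_op - inl_op o\<^sub>C\<^sub>L S o\<^sub>C\<^sub>L C) o\<^sub>C\<^sub>L ((id_cblinfun - U o\<^sub>C\<^sub>L B) o\<^sub>C\<^sub>L snd_op)))"
    by (intro finite_rank_mod_add finite_rank_mod_compose_left finite_rank_mod_compose_right S U)
  moreover have "(inl_op o\<^sub>C\<^sub>L ((id_cblinfun - S o\<^sub>C\<^sub>L A) o\<^sub>C\<^sub>L fst_op))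
      + ((inr_op - inl_op o\<^sub>C\<^sub>L S o\<^sub>C\<^sub>L C) o\<^sub>C\<^sub>L ((id_cblinfun - U o\<^sub>C\<^sub>L B) o\<^sub>C\<^sub>L snd_op))
      = id_cblinfun - ?N o\<^sub>C\<^sub>L upper_triangular_op A C B"
  proof (rule cblinfun_eqI)
    fix w :: "'a \<times> 'b"
    show "((inl_op o\<^sub>C\<^sub>L ((id_cblinfun - S o\<^sub>C\<^sub>L A) o\<^sub>C\<^sub>L fst_op))
      + ((inr_op - inl_op o\<^sub>C\<^sub>L S o\<^sub>C\<^sub>L C) o\<^sub>C\<^sub>L ((id_cblinfun - U o\<^sub>C\<^sub>L B) o\<^sub>C\<^sub>L snd_op))) w
      = (id_cblinfun - ?N o\<^sub>C\<^sub>L upper_triangular_op A C B) w"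
      by (cases w) (simp add: algebra_simps)
  qed
  ultimately show ?thesis
    unfolding left_invertible_mod_def by metis
qed

lemma onto_mod_upper_triangular:
  fixes A :: "'a::complex_normed_vector \<Rightarrow>\<^sub>C\<^sub>L 'a" and B :: "'b::complex_normed_vector \<Rightarrow>\<^sub>C\<^sub>L 'b"
  assumes A: "onto_mod p A" and B: "onto_mod p B"
  shows "onto_mod p (upper_triangular_op A C B)"
proof -
  obtain F where F: "finite F" "p \<or> F = {}" "\<And>x. \<exists>z\<in>cspan F. x - z \<in> op_range A"
    using A by (auto simp: onto_mod_def)
  obtain G where G: "finite G" "p \<or> G = {}" "\<And>y. \<exists>z\<in>cspan G. y - z \<in> op_range B"
    using B by (auto simp: onto_mod_def)
  let ?H = "cblinfun_apply inl_op ` F \<union> cblinfun_apply inr_op ` G"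
  have "\<exists>z\<in>cspan ?H. w - z \<in> op_range (upper_triangular_op A C B)" for w
  proof -
    obtain x y where w: "w = (x, y)"
      by fastforce
    obtain g y' where g: "g \<in> cspan G" "y - g = B y'"
      using G(3) [of y] by (auto simp: op_range_def)
    obtain f x' where f: "f \<in> cspan F" "x - C y' - f = A x'"
      using F(3) [of "x - C y'"] by (auto simp: op_range_def)
    have "inl_op f + inr_op g \<in> cspan ?H"
      unfolding cvec.span_Un cspan_image using f(1) g(1) by blast
    moreover have "w - (inl_op f + inr_op g) = upper_triangular_op A C B (x', y')"
      using f(2) g(2) by (simp add: w algebra_simps)
    ultimately show ?thesis
      unfolding op_range_def by (metis rangeI)
  qed
  then show ?thesis
    using F(1,2) G(1,2) unfolding onto_mod_def by (intro exI [of _ ?H]) auto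
qed

lemma right_invertible_mod_upper_triangular:
  fixes A :: "'a::complex_normed_vector \<Rightarrow>\<^sub>C\<^sub>L 'a" and B :: "'b::complex_normed_vector \<Rightarrow>\<^sub>C\<^sub>L 'b"
  assumes A: "right_invertible_mod p A" and B: "right_invertible_mod p B"
  shows "right_invertible_mod p (upper_triangular_op A C B)"
proof -
  obtain S where S: "finite_rank_mod p (id_cblinfun - A o\<^sub>C\<^sub>L S)"
    using A by (auto simp: right_invertible_mod_def)
  obtain U where U: "finite_rank_mod p (id_cblinfun - B o\<^sub>C\<^sub>L U)"
    using B by (auto simp: right_invertible_mod_def)
  let ?N = "upper_triangular_op S (- (S o\<^sub>C\<^sub>L C o\<^sub>C\<^sub>L U)) U"
  have "finite_rank_mod p ((inl_op o\<^sub>C\<^sub>L ((id_cblinfun - A o\<^sub>C\<^sub>L S) o\<^sub>C\<^sub>L (fst_op - C o\<^sub>C\<^sub>L U o\<^sub>C\<^sub>L snd_op)))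
      + (inr_op o\<^sub>C\<^sub>L ((id_cblinfun - B o\<^sub>C\<^sub>L U) o\<^sub>C\<^sub>L snd_op)))"
    by (intro finite_rank_mod_add finite_rank_mod_compose_left finite_rank_mod_compose_right S U)
  moreover have "(inl_op o\<^sub>C\<^sub>L ((id_cblinfun - A o\<^sub>C\<^sub>L S) o\<^sub>C\<^sub>L (fst_op - C o\<^sub>C\<^sub>L U o\<^sub>C\<^sub>L snd_op)))
      + (inr_op o\<^sub>C\<^sub>L ((id_cblinfun - B o\<^sub>C\<^sub>L U) o\<^sub>C\<^sub>L snd_op))
      = id_cblinfun - upper_triangular_op A C B o\<^sub>C\<^sub>L ?N"
  proof (rule cblinfun_eqI)
    fix w :: "'a \<times> 'b"
    show "((inl_op o\<^sub>C\<^sub>L ((id_cblinfun - A o\<^sub>C\<^sub>L S) o\<^sub>C\<^sub>L (fst_op - C o\<^sub>C\<^sub>L U o\<^sub>C\<^sub>L snd_op)))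
      + (inr_op o\<^sub>C\<^sub>L ((id_cblinfun - B o\<^sub>C\<^sub>L U) o\<^sub>C\<^sub>L snd_op))) w
      = (id_cblinfun - upper_triangular_op A C B o\<^sub>C\<^sub>L ?N) w"
      by (cases w) (simp add: algebra_simps)
  qed
  ultimately show ?thesis
    unfolding right_invertible_mod_def by metis
qed

definition semi_Fredholm_mod :: "bool \<Rightarrow> 'a::cbanach \<Rightarrow>\<^sub>C\<^sub>L 'a \<Rightarrow> bool" where
  "semi_Fredholm_mod p T \<longleftrightarrow> bounded_below_mod p T \<or> onto_mod p T"

definition one_sided_invertible_mod :: "bool \<Rightarrow> 'a::cbanach \<Rightarrow>\<^sub>C\<^sub>L 'a \<Rightarrow> bool" where
  "one_sided_invertible_mod p T \<longleftrightarrow> left_invertible_mod p T \<or> right_invertible_mod p T"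

lemma one_sided_invertible_mod_imp_semi_Fredholm_mod:
  "one_sided_invertible_mod p T \<Longrightarrow> semi_Fredholm_mod p T"
  unfolding one_sided_invertible_mod_def semi_Fredholm_mod_def
  using left_invertible_mod_imp_bounded_below_mod right_invertible_mod_imp_onto_mod by blast

text \<open>A one-sided property together with the SVEP on the matching side gives the properties of both
  sides.\<close>

lemma SVEP_imp_Fredholm_mod:
  fixes T :: "'a::cbanach \<Rightarrow>\<^sub>C\<^sub>L 'a"
  assumes "bounded_below_mod p T \<and> SVEP_at (dual_op T) 0 \<or> onto_mod p T \<and> SVEP_at T 0"
  shows "bounded_below_mod p T" "onto_mod p T" "left_invertible_mod p T" "right_invertible_mod p T"
proof -
  show "bounded_below_mod p T" "onto_mod p T"
    using assms SVEP_dual_imp_onto_mod SVEP_imp_bounded_below_mod by blast+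
  then show "left_invertible_mod p T" "right_invertible_mod p T"
    by (rule Fredholm_imp_invertible_mod)+
qed

lemma SVEP_semi_Fredholm_imp_Fredholm_mod:
  fixes T :: "'a::cbanach \<Rightarrow>\<^sub>C\<^sub>L 'a"
  assumes "semi_Fredholm_mod p T" "SVEP_at T 0" "SVEP_at (dual_op T) 0"
  shows "bounded_below_mod p T" "onto_mod p T" "left_invertible_mod p T" "right_invertible_mod p T"
  using assms SVEP_imp_Fredholm_mod unfolding semi_Fredholm_mod_def by blast+

context
  fixes A :: "'a::cbanach \<Rightarrow>\<^sub>C\<^sub>L 'a" and B :: "'b::cbanach \<Rightarrow>\<^sub>C\<^sub>L 'b" and C :: "'b \<Rightarrow>\<^sub>C\<^sub>L 'a"
begin

text \<open>Whichever one-sided property \<open>M\<close> has, one of the diagonal entries inherits it, becomes two-sided by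
  the SVEP, and can then be split off from \<open>M\<close>.\<close>

lemma semi_Fredholm_mod_upper_triangularD:
  assumes M: "semi_Fredholm_mod p (upper_triangular_op A C B)"
    and svep: "SVEP_at (dual_op A) 0" "SVEP_at B 0"
  shows "semi_Fredholm_mod p A \<and> semi_Fredholm_mod p B"
  using M unfolding semi_Fredholm_mod_def
proof
  assume M: "bounded_below_mod p (upper_triangular_op A C B)"
  then have "bounded_below_mod p A"
    by (rule bounded_below_mod_upper_triangular_fst)
  moreover from this have "right_invertible_mod p A"
    using svep by (intro SVEP_imp_Fredholm_mod) blast
  ultimately show "(bounded_below_mod p A \<or> onto_mod p A) \<and> (bounded_below_mod p B \<or> onto_mod p B)"
    using bounded_below_mod_upper_triangular_snd [OF M] by blast
next
  assume M: "onto_mod p (upper_triangular_op A C B)"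
  then have "onto_mod p B"
    by (rule onto_mod_upper_triangular_snd)
  moreover from this have "left_invertible_mod p B"
    using svep by (intro SVEP_imp_Fredholm_mod) blast
  ultimately show "(bounded_below_mod p A \<or> onto_mod p A) \<and> (bounded_below_mod p B \<or> onto_mod p B)"
    using onto_mod_upper_triangular_fst [OF M] by blast
qed

lemma one_sided_invertible_mod_upper_triangularD:
  assumes M: "one_sided_invertible_mod p (upper_triangular_op A C B)"
    and svep: "SVEP_at (dual_op A) 0" "SVEP_at B 0"
  shows "one_sided_invertible_mod p A \<and> one_sided_invertible_mod p B"
  using M unfolding one_sided_invertible_mod_def
proof
  assume M: "left_invertible_mod p (upper_triangular_op A C B)"
  then have A: "left_invertible_mod p A"
    by (rule left_invertible_mod_upper_triangular_fst)
  then have "right_invertible_mod p A"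
    using svep left_invertible_mod_imp_bounded_below_mod by (intro SVEP_imp_Fredholm_mod) blast
  then show "(left_invertible_mod p A \<or> right_invertible_mod p A) \<and>
      (left_invertible_mod p B \<or> right_invertible_mod p B)"
    using A left_invertible_mod_upper_triangular_snd [OF M] by blast
next
  assume M: "right_invertible_mod p (upper_triangular_op A C B)"
  then have B: "right_invertible_mod p B"
    by (rule right_invertible_mod_upper_triangular_snd)
  then have "left_invertible_mod p B"
    using svep right_invertible_mod_imp_onto_mod by (intro SVEP_imp_Fredholm_mod) blast
  then show "(left_invertible_mod p A \<or> right_invertible_mod p A) \<and>
      (left_invertible_mod p B \<or> right_invertible_mod p B)"
    using B right_invertible_mod_upper_triangular_fst [OF M] by blast
qed

lemma semi_Fredholm_mod_upper_triangularI:
  assumes "semi_Fredholm_mod p A" and "semi_Fredholm_mod p B"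
    and "SVEP_at A 0 \<and> SVEP_at (dual_op A) 0 \<or> SVEP_at B 0 \<and> SVEP_at (dual_op B) 0"
  shows "semi_Fredholm_mod p (upper_triangular_op A C B)"
  using assms SVEP_semi_Fredholm_imp_Fredholm_mod(1,2) [of p A] SVEP_semi_Fredholm_imp_Fredholm_mod(1,2) [of p B]
    bounded_below_mod_upper_triangular [of p A B C] onto_mod_upper_triangular [of p A B C]
  unfolding semi_Fredholm_mod_def by blast

lemma one_sided_invertible_mod_upper_triangularI:
  assumes "one_sided_invertible_mod p A" and "one_sided_invertible_mod p B"
    and "SVEP_at A 0 \<and> SVEP_at (dual_op A) 0 \<or> SVEP_at B 0 \<and> SVEP_at (dual_op B) 0"
  shows "one_sided_invertible_mod p (upper_triangular_op A C B)"
  using assms one_sided_invertible_mod_imp_semi_Fredholm_mod [of p A]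
    one_sided_invertible_mod_imp_semi_Fredholm_mod [of p B]
    SVEP_semi_Fredholm_imp_Fredholm_mod(3,4) [of p A] SVEP_semi_Fredholm_imp_Fredholm_mod(3,4) [of p B]
    left_invertible_mod_upper_triangular [of p A B C] right_invertible_mod_upper_triangular [of p A B C]
  unfolding one_sided_invertible_mod_def by blast

end

section \<open>The four spectra\<close>

primrec regular :: "spectrum_label \<Rightarrow> 'a::cbanach \<Rightarrow>\<^sub>C\<^sub>L 'a \<Rightarrow> bool" where
  "regular Spec_K T = semi_Fredholm_mod True T"
| "regular Spec_K3 T = one_sided_invertible_mod True T"
| "regular Spec_SF0 T = semi_Fredholm_mod False T"
| "regular Spec_lr T = one_sided_invertible_mod False T"

lemma sigma_star_iff: "z \<in> sigma_star s T \<longleftrightarrow> \<not> regular s (T - z *\<^sub>C id_cblinfun)"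
  by (cases s)
    (simp_all add: sigma_K_def sigma_K3_def sigma_SF0_def sigma_lr_def semi_Fredholm_mod_def
      one_sided_invertible_mod_def Phi_plus_iff Phi_minus_iff Phi_l_iff Phi_r_iff SF0_iff
      left_invertible_iff right_invertible_iff)

lemma regular_upper_triangularD:
  assumes "regular s (upper_triangular_op A C B)" and "SVEP_at (dual_op A) 0" "SVEP_at B 0"
  shows "regular s A \<and> regular s B"
  using assms semi_Fredholm_mod_upper_triangularD [of True A C B]
    semi_Fredholm_mod_upper_triangularD [of False A C B]
    one_sided_invertible_mod_upper_triangularD [of True A C B]
    one_sided_invertible_mod_upper_triangularD [of False A C B]
  by (cases s) simp_all

lemma regular_upper_triangularI:
  assumes "regular s A" and "regular s B"
    and "SVEP_at A 0 \<and> SVEP_at (dual_op A) 0 \<or> SVEP_at B 0 \<and> SVEP_at (dual_op B) 0"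
  shows "regular s (upper_triangular_op A C B)"
  using assms semi_Fredholm_mod_upper_triangularI [of True A B C]
    semi_Fredholm_mod_upper_triangularI [of False A B C]
    one_sided_invertible_mod_upper_triangularI [of True A B C]
    one_sided_invertible_mod_upper_triangularI [of False A B C]
  by (cases s) simp_all

lemma upper_triangular_op_shift:
  "upper_triangular_op A C B - z *\<^sub>C id_cblinfun =
    upper_triangular_op (A - z *\<^sub>C id_cblinfun) C (B - z *\<^sub>C id_cblinfun)"
proof (rule cblinfun_eqI)
  fix w
  show "(upper_triangular_op A C B - z *\<^sub>C id_cblinfun) w =
      upper_triangular_op (A - z *\<^sub>C id_cblinfun) C (B - z *\<^sub>C id_cblinfun) w"
    by (cases w) (simp add: algebra_simps)
qed

lemma dual_op_shift: "dual_op (T - z *\<^sub>C id_cblinfun) = dual_op T - z *\<^sub>C id_cblinfun"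
  by (intro cblinfun_eqI) simp

text \<open>Solutions for the shifted operator on \<open>V\<close> are translates of solutions for \<open>T\<close> on \<open>z + V\<close>.\<close>

lemma SVEP_at_shift:
  assumes "SVEP_at T z"
  shows "SVEP_at (T - z *\<^sub>C id_cblinfun) 0"
proof -
  obtain r where r: "r > 0"
    and svep: "\<forall>V. open V \<and> V \<subseteq> ball z r \<longrightarrow> (\<forall>f. vec_analytic_on f V \<and>
      (\<forall>\<mu>\<in>V. (T - \<mu> *\<^sub>C id_cblinfun) (f \<mu>) = 0) \<longrightarrow> (\<forall>\<mu>\<in>V. f \<mu> = 0))"
    using assms unfolding SVEP_at_def by (elim exE conjE)
  show ?thesis
    unfolding SVEP_at_def
  proof (intro exI [of _ r] conjI r allI impI)
    fix V and f :: "complex \<Rightarrow> 'a"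
    assume V: "open V \<and> V \<subseteq> ball 0 r"
      and f: "vec_analytic_on f V \<and> (\<forall>\<mu>\<in>V. (T - z *\<^sub>C id_cblinfun - \<mu> *\<^sub>C id_cblinfun) (f \<mu>) = 0)"
    let ?W = "(+) z ` V" and ?g = "\<lambda>\<mu>. f (\<mu> - z)"
    have "open ?W" "?W \<subseteq> ball z r"
      using V by (auto simp: open_translation dist_norm)
    moreover have "vec_analytic_on ?g ?W"
      unfolding vec_analytic_on_def
    proof
      fix v assume "v \<in> ?W"
      then obtain u where u: "u \<in> V" "v = z + u"
        by blast
      then obtain d where "((\<lambda>w. inverse (w - u) *\<^sub>C (f w - f u)) \<longlongrightarrow> d) (at u)"
        using f by (auto simp: vec_analytic_on_def)
      then have "((\<lambda>w. inverse (w - z - u) *\<^sub>C (f (w - z) - f u)) \<longlongrightarrow> d) (at v)"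
        using filterlim_shift_iff [of "\<lambda>w. inverse (w - u) *\<^sub>C (f w - f u)" "-z" "nhds d" u] u
        by (simp add: o_def add.commute)
      then show "\<exists>d. ((\<lambda>w. inverse (w - v) *\<^sub>C (?g w - ?g v)) \<longlongrightarrow> d) (at v)"
        using u by (auto simp: algebra_simps)
    qed
    moreover have "(T - \<mu> *\<^sub>C id_cblinfun) (?g \<mu>) = 0" if "\<mu> \<in> ?W" for \<mu>
      using that f by (force simp: scaleC_add_left algebra_simps)
    ultimately have "\<forall>\<mu>\<in>?W. ?g \<mu> = 0"
      using svep [rule_format, of ?W ?g] by blast
    then show "\<forall>\<mu>\<in>V. f \<mu> = 0"
      by auto
  qed
qed

theorem theorem3p7:
  fixes A :: "'a::cbanach \<Rightarrow>\<^sub>C\<^sub>L 'a"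
    and B :: "'b::cbanach \<Rightarrow>\<^sub>C\<^sub>L 'b"
    and C :: "'b \<Rightarrow>\<^sub>C\<^sub>L 'a"
    and s :: spectrum_label
  assumes "cedim (UNIV :: 'a set) = \<infinity>"
    and "cedim (UNIV :: 'b set) = \<infinity>"
  shows "(sigma_star s (upper_triangular_op A C B)
            \<union> not_SVEP (dual_op A) \<union> not_SVEP A \<union> not_SVEP B
          = sigma_star s A \<union> sigma_star s B
            \<union> not_SVEP (dual_op A) \<union> not_SVEP A \<union> not_SVEP B)
       \<and> (sigma_star s (upper_triangular_op A C B)
            \<union> not_SVEP (dual_op A) \<union> not_SVEP B \<union> not_SVEP (dual_op B)
          = sigma_star s A \<union> sigma_star s B
            \<union> not_SVEP (dual_op A) \<union> not_SVEP B \<union> not_SVEP (dual_op B))"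
proof -
  have "z \<in> sigma_star s (upper_triangular_op A C B) \<longleftrightarrow> z \<in> sigma_star s A \<union> sigma_star s B"
    if svep: "SVEP_at (dual_op A) z" "SVEP_at B z" "SVEP_at A z \<or> SVEP_at (dual_op B) z" for z
  proof -
    let ?A = "A - z *\<^sub>C id_cblinfun" and ?B = "B - z *\<^sub>C id_cblinfun"
    have "SVEP_at (dual_op ?A) 0" "SVEP_at ?B 0"
      unfolding dual_op_shift by (rule SVEP_at_shift [OF svep(1)] SVEP_at_shift [OF svep(2)])+
    moreover have "SVEP_at ?A 0 \<or> SVEP_at (dual_op ?B) 0"
      unfolding dual_op_shift
      using svep(3) SVEP_at_shift [of A z] SVEP_at_shift [of "dual_op B" z] by blast
    ultimately have "regular s (upper_triangular_op ?A C ?B) \<longleftrightarrow> regular s ?A \<and> regular s ?B"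
      using regular_upper_triangularD [of s ?A C ?B] regular_upper_triangularI [of s ?A ?B C] by blast
    then show ?thesis
      by (simp add: sigma_star_iff upper_triangular_op_shift)
  qed
  then show ?thesis
    unfolding not_SVEP_def by (intro conjI set_eqI) (auto simp del: sigma_star.simps)
qed

end
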